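(* Fix an integer $d\ge2$, $0<\beta<1$ and $\kappa_*>0$. Let $\rho_0\in C_c^{1,\beta}(\mathbb R^d)$ satisfy $\rho_0\ge0$ and $\int_{\mathbb R^d}\rho_0\,dx=1$. There exists $T_*>0$, depending only on $d,\rho_0,\beta,\kappa_*$, such that for every $0\le\kappa\le\kappa_*$ the Cauchy problem $$\partial_t\rho+\nabla\cdot(\rho u_\rho^\kappa)=0,\qquad u_\rho^\kappa=-\nabla g_{\kappa,d}*\rho,\qquad \rho(0)=\rho_0,$$ has a unique classical solution $\rho^\kappa$ satisfying $$\rho^\kappa\in L^\infty_{\mathrm{loc}}\bigl([0,T_* );C^{1,\beta}(\mathbb R^d)\bigr),\qquad \rho^\kappa\in C\bigl([0,T_* );C^{1,\beta'}(\mathbb R^d)\bigr)\cap C^1\bigl([0,T_* );C^{0,\beta'}(\mathbb R^d)\bigr)$$ for every $0<\beta'<\beta$. Uniqueness holds within the class of nonnegative unit-mass solutions satisfying these bounds and having compact support on each compact time interval. Moreover, for every $0<T<T_*$ there is $R_T=R_T(d,\beta,\kappa_*,\rho_0,T)<\infty$, independent of $\kappa\in[0,\kappa_*]$, such that $\operatorname{supp}\rho^\kappa(t)\subset B_{R_T}$ for all $0\le t\le T$, $0\le\kappa\le\kappa_*$, and $$\sup_{0\le\kappa\le\kappa_*}\ \sup_{0\le t\le T}\Bigl[\|\rho^\kappa(t)\|_{L^\infty}+[\rho^\kappa(t)]_{C^{0,\beta}}+\int_{\mathbb R^d}|x|^2\rho^\kappa(t,x)\,dx+\|u_{\rho^\kappa}^\kappa(t)\|_{W^{1,\infty}}\Bigr]<\infty.$$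 In particular, for $0<\kappa\le\kappa_*$ and every $[0,T]\subset[0,T_* )$ these solutions satisfy $\rho^\kappa\in C([0,T];(\mathcal P_2(\mathbb R^d),W_2))$ and $1+\sup_{t\le T}(\|\rho^\kappa(t)\|_{L^\infty}+\|u_{\rho^\kappa}^\kappa(t)\|_{W^{1,\infty}})<\infty$.
   Context: Kernels: for $\kappa>0$, $g_{\kappa,d}(x)=(2\pi)^{-d/2}(\kappa/|x|)^{\nu_d}K_{\nu_d}(\kappa|x|)$, $\nu_d=\frac d2-1$, with $K_\nu$ the modified Bessel function of the second kind; $(-\Delta+\kappa^2)g_{\kappa,d}=\delta_0$. For $\kappa=0$: $g_{0,2}(x)=-\frac1{2\pi}\log|x|+\frac{\log2-\gamma_E}{2\pi}$ and $g_{0,d}(x)=\frac{|x|^{2-d}}{(d-2)|\mathbb S^{d-1}|}$ for $d\ge3$. "Classical" means that the equation holds pointwise with the displayed time and space regularity. $[\cdot]_{C^{0,\beta}}$ is the Hölder seminorm; $C_c^{1,\beta}$ denotes compactly supported $C^{1,\beta}$ functions. $\mathcal P_2$ is the set of probability measures with finite second moment, $W_2$ the quadratic Wasserstein distance. *)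

theory Defs
  imports "HOL-Probability.Probability"
begin

text \<open>Norms and seminorms take values in \<^typ>\<open>ennreal\<close>, so that finiteness of a norm is
  a genuine condition.\<close>

subsection \<open>Function spaces\<close>

text \<open>\<open>frechet_derivative\<close> is an arbitrary value where \<open>f\<close> is not differentiable. Below, the gradient
  is only used for everywhere differentiable functions and, under an integral, for kernels that are
  smooth away from the origin.\<close>

definition gradient :: "('a::euclidean_space \<Rightarrow> real) \<Rightarrow> 'a \<Rightarrow> 'a" where
  "gradient f x = (\<Sum>b\<in>Basis. frechet_derivative f (at x) b *\<^sub>R b)"

definition divergence :: "('a::euclidean_space \<Rightarrow> 'a) \<Rightarrow> 'a \<Rightarrow> real" where
  "divergence F x = (\<Sum>b\<in>Basis. frechet_derivative F (at x) b \<bullet> b)"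

definition supp :: "('a::topological_space \<Rightarrow> real) \<Rightarrow> 'a set" where
  "supp f = closure {x. f x \<noteq> 0}"

definition sup_norm :: "('a \<Rightarrow> 'b::real_normed_vector) \<Rightarrow> ennreal" where
  "sup_norm f = (SUP x. ennreal (norm (f x)))"

text \<open>The pairs with \<open>x = y\<close> contribute \<open>0 / 0 = 0\<close>.\<close>

definition holder_seminorm ::
    "real \<Rightarrow> ('a::metric_space \<Rightarrow> 'b::real_normed_vector) \<Rightarrow> ennreal" where
  "holder_seminorm \<beta> f = (SUP x. SUP y. ennreal (norm (f x - f y) / dist x y powr \<beta>))"

definition C0_norm :: "real \<Rightarrow> ('a::metric_space \<Rightarrow> 'b::real_normed_vector) \<Rightarrow> ennreal" where
  "C0_norm \<beta> f = sup_norm f + holder_seminorm \<beta> f"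

definition C1_norm :: "real \<Rightarrow> ('a::euclidean_space \<Rightarrow> real) \<Rightarrow> ennreal" where
  "C1_norm \<beta> f = sup_norm f + sup_norm (gradient f) + holder_seminorm \<beta> (gradient f)"

definition C0_space :: "real \<Rightarrow> ('a::metric_space \<Rightarrow> real) set" where
  "C0_space \<beta> = {f. C0_norm \<beta> f < \<infinity>}"

text \<open>Continuity of the gradient follows from finiteness of its Hoelder seminorm, for \<open>\<beta> > 0\<close>.\<close>

definition C1_space :: "real \<Rightarrow> ('a::euclidean_space \<Rightarrow> real) set" where
  "C1_space \<beta> = {f. (\<forall>x. f differentiable (at x)) \<and> C1_norm \<beta> f < \<infinity>}"

definition C1c_space :: "real \<Rightarrow> ('a::euclidean_space \<Rightarrow> real) set" where
  "C1c_space \<beta> = {f \<in> C1_space \<beta>. compact (supp f)}"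

definition Linf_norm :: "('a::euclidean_space \<Rightarrow> 'b::real_normed_vector) \<Rightarrow> ennreal" where
  "Linf_norm f = esssup lborel (\<lambda>x. ennreal (norm (f x)))"

primrec Ck :: "nat \<Rightarrow> ('a::euclidean_space \<Rightarrow> real) \<Rightarrow> bool" where
  "Ck 0 f \<longleftrightarrow> continuous_on UNIV f"
| "Ck (Suc k) f \<longleftrightarrow> (\<forall>x. f differentiable (at x)) \<and>
     (\<forall>b\<in>Basis. Ck k (\<lambda>x. frechet_derivative f (at x) b))"

definition test_function :: "('a::euclidean_space \<Rightarrow> real) \<Rightarrow> bool" where
  "test_function \<phi> \<longleftrightarrow> (\<forall>k. Ck k \<phi>) \<and> compact (supp \<phi>)"

definition locally_integrable :: "('a::euclidean_space \<Rightarrow> 'b::euclidean_space) \<Rightarrow> bool" where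
  "locally_integrable f \<longleftrightarrow> (\<forall>K. compact K \<longrightarrow> set_integrable lborel K f)"

definition weak_partial ::
    "'a \<Rightarrow> ('a::euclidean_space \<Rightarrow> 'b::euclidean_space) \<Rightarrow> ('a \<Rightarrow> 'b) \<Rightarrow> bool" where
  "weak_partial b f h \<longleftrightarrow> locally_integrable f \<and> locally_integrable h \<and>
     (\<forall>\<phi>. test_function \<phi> \<longrightarrow>
        (LINT x|lborel. frechet_derivative \<phi> (at x) b *\<^sub>R f x) = - (LINT x|lborel. \<phi> x *\<^sub>R h x))"

text \<open>The infimum is \<open>\<infinity>\<close> if there is no weak partial derivative; otherwise all weak partial
  derivatives agree almost everywhere and the infimum is over a single value.\<close>

definition W1inf_norm :: "('a::euclidean_space \<Rightarrow> 'b::euclidean_space) \<Rightarrow> ennreal" where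
  "W1inf_norm f =
     Linf_norm f + (\<Sum>b\<in>Basis. INF h\<in>{h. weak_partial b f h}. Linf_norm h)"

subsection \<open>Kernels and velocity fields\<close>

text \<open>The modified Bessel function of the second kind, for \<open>z > 0\<close>, by its integral
  representation (DLMF 10.32.9).\<close>

definition bessel_K :: "real \<Rightarrow> real \<Rightarrow> real" where
  "bessel_K \<nu> z = (LINT t:{0<..}|lborel. exp (- z * cosh t) * cosh (\<nu> * t))"

text \<open>\<open>d |B\<^sub>1|\<close> is the surface area of the unit sphere of \<open>\<real>\<^sup>d\<close>.\<close>

definition sphere_area :: "nat \<Rightarrow> real" where
  "sphere_area d = real d * unit_ball_vol (real d)"

definition kernel :: "real \<Rightarrow> 'a::euclidean_space \<Rightarrow> real" where
  "kernel \<kappa> x =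
    (let d = DIM('a); \<nu> = real d / 2 - 1 in
      if \<kappa> > 0 then
        (2 * pi) powr (- real d / 2) * (\<kappa> / norm x) powr \<nu> * bessel_K \<nu> (\<kappa> * norm x)
      else if d = 2 then
        - 1 / (2 * pi) * ln (norm x) + (ln 2 - euler_mascheroni) / (2 * pi)
      else
        norm x powr (2 - real d) / ((real d - 2) * sphere_area d))"

text \<open>\<open>- \<nabla>g * f\<close>, where \<open>\<nabla>g\<close> is the gradient of the kernel away from the origin.\<close>

definition velocity :: "real \<Rightarrow> ('a::euclidean_space \<Rightarrow> real) \<Rightarrow> 'a \<Rightarrow> 'a" where
  "velocity \<kappa> f x = - (LINT y|lborel. f y *\<^sub>R gradient (kernel \<kappa>) (x - y))"

subsection \<open>Classical solutions\<close>

text \<open>\<open>L\<^sup>\<infinity>\<close> in time is bare essential boundedness of the norm: strong measurability into the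
  nonseparable Hoelder space is not required.\<close>

definition Linf_loc_C1 :: "real \<Rightarrow> real \<Rightarrow> (real \<Rightarrow> 'a::euclidean_space \<Rightarrow> real) \<Rightarrow> bool" where
  "Linf_loc_C1 \<beta> Ts \<rho> \<longleftrightarrow>
     (\<forall>T. 0 < T \<and> T < Ts \<longrightarrow>
        (\<exists>C<\<infinity>. AE t in lborel. t \<in> {0..T} \<longrightarrow> \<rho> t \<in> C1_space \<beta> \<and> C1_norm \<beta> (\<rho> t) \<le> C))"

definition cont_C1 :: "real \<Rightarrow> real \<Rightarrow> (real \<Rightarrow> 'a::euclidean_space \<Rightarrow> real) \<Rightarrow> bool" where
  "cont_C1 \<beta> Ts \<rho> \<longleftrightarrow>
     (\<forall>t\<in>{0..<Ts}. \<rho> t \<in> C1_space \<beta> \<and>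
        ((\<lambda>s. C1_norm \<beta> (\<lambda>x. \<rho> s x - \<rho> t x)) \<longlongrightarrow> 0) (at t within {0..<Ts}))"

definition cont_C0 :: "real \<Rightarrow> real \<Rightarrow> (real \<Rightarrow> 'a::euclidean_space \<Rightarrow> real) \<Rightarrow> bool" where
  "cont_C0 \<beta> Ts \<rho> \<longleftrightarrow>
     (\<forall>t\<in>{0..<Ts}. \<rho> t \<in> C0_space \<beta> \<and>
        ((\<lambda>s. C0_norm \<beta> (\<lambda>x. \<rho> s x - \<rho> t x)) \<longlongrightarrow> 0) (at t within {0..<Ts}))"

text \<open>\<open>\<rho> \<in> C\<^sup>1([0, Ts); C\<^bsup>0,\<beta>\<^esup>)\<close>, with one-sided derivative at time \<open>0\<close>.\<close>

definition cont_diff_C0 :: "real \<Rightarrow> real \<Rightarrow> (real \<Rightarrow> 'a::euclidean_space \<Rightarrow> real) \<Rightarrow> bool" where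
  "cont_diff_C0 \<beta> Ts \<rho> \<longleftrightarrow>
     (\<forall>t\<in>{0..<Ts}. \<rho> t \<in> C0_space \<beta>) \<and>
     (\<exists>\<rho>'. cont_C0 \<beta> Ts \<rho>' \<and>
        (\<forall>t\<in>{0..<Ts}.
           ((\<lambda>s. C0_norm \<beta> (\<lambda>x. (\<rho> s x - \<rho> t x) / (s - t) - \<rho>' t x)) \<longlongrightarrow> 0)
             (at t within {0..<Ts})))"

definition classical_solution ::
    "real \<Rightarrow> real \<Rightarrow> ('a::euclidean_space \<Rightarrow> real) \<Rightarrow> real \<Rightarrow> (real \<Rightarrow> 'a \<Rightarrow> real) \<Rightarrow> bool" where
  "classical_solution \<beta> \<kappa> \<rho>0 Ts \<rho> \<longleftrightarrow>
     Linf_loc_C1 \<beta> Ts \<rho> \<and>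
     (\<forall>\<beta>'. 0 < \<beta>' \<and> \<beta>' < \<beta> \<longrightarrow> cont_C1 \<beta>' Ts \<rho> \<and> cont_diff_C0 \<beta>' Ts \<rho>) \<and>
     \<rho> 0 = \<rho>0 \<and>
     (\<forall>t\<in>{0..<Ts}. \<forall>x.
        (\<lambda>y. \<rho> t y *\<^sub>R velocity \<kappa> (\<rho> t) y) differentiable (at x) \<and>
        (\<exists>D. ((\<lambda>s. \<rho> s x) has_real_derivative D) (at t within {0..<Ts}) \<and>
             D + divergence (\<lambda>y. \<rho> t y *\<^sub>R velocity \<kappa> (\<rho> t) y) x = 0))"

definition prob_density :: "('a::euclidean_space \<Rightarrow> real) \<Rightarrow> bool" where
  "prob_density f \<longleftrightarrow> (\<forall>x. f x \<ge> 0) \<and> (LINT x|lborel. f x) = 1"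

definition solution_class ::
    "real \<Rightarrow> real \<Rightarrow> ('a::euclidean_space \<Rightarrow> real) \<Rightarrow> real \<Rightarrow> (real \<Rightarrow> 'a \<Rightarrow> real) set" where
  "solution_class \<beta> \<kappa> \<rho>0 Ts =
     {\<rho>. classical_solution \<beta> \<kappa> \<rho>0 Ts \<rho> \<and>
         (\<forall>t\<in>{0..<Ts}. prob_density (\<rho> t)) \<and>
         (\<forall>T. 0 < T \<and> T < Ts \<longrightarrow> (\<exists>K. compact K \<and> (\<forall>t\<in>{0..T}. supp (\<rho> t) \<subseteq> K)))}"

subsection \<open>The quadratic Wasserstein space\<close>

definition P2 :: "'a::euclidean_space measure set" where
  "P2 = {\<mu>. sets \<mu> = sets borel \<and> prob_space \<mu> \<and> (\<integral>\<^sup>+x. ennreal ((norm x)\<^sup>2) \<partial>\<mu>) < \<infinity>}"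

definition couplings :: "'a::euclidean_space measure \<Rightarrow> 'a measure \<Rightarrow> ('a \<times> 'a) measure set" where
  "couplings \<mu> \<nu> =
     {\<pi>. sets \<pi> = sets (borel \<Otimes>\<^sub>M borel) \<and> distr \<pi> borel fst = \<mu> \<and> distr \<pi> borel snd = \<nu>}"

definition W2 :: "'a::euclidean_space measure \<Rightarrow> 'a measure \<Rightarrow> ennreal" where
  "W2 \<mu> \<nu> =
     (let c = (INF \<pi>\<in>couplings \<mu> \<nu>. \<integral>\<^sup>+p. ennreal ((dist (fst p) (snd p))\<^sup>2) \<partial>\<pi>)
      in if c = \<infinity> then \<infinity> else ennreal (sqrt (enn2real c)))"

definition cont_W2 :: "real \<Rightarrow> (real \<Rightarrow> 'a::euclidean_space measure) \<Rightarrow> bool" where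
  "cont_W2 T \<mu> \<longleftrightarrow>
     (\<forall>t\<in>{0..T}. \<mu> t \<in> P2 \<and> ((\<lambda>s. W2 (\<mu> s) (\<mu> t)) \<longlongrightarrow> 0) (at t within {0..T}))"

end

theory Submission
  imports Defs "HOL-Real_Asymp.Real_Asymp" "HOL-Complex_Analysis.Great_Picard"
begin

text \<open>Solutions are limits of the explicit scheme \<open>f \<mapsto> (f (1 - h div u)) \<circ> (id - h u)\<close> with
  \<open>u = - \<nabla>g * f\<close>. Since \<open>\<nabla>g\<close> is of order \<open>|x|\<^bsup>1-d\<^esup>\<close>, a bounded \<open>\<nabla>f\<close> makes \<open>Du\<close> Hoelder continuous
  without any singular integral, and \<open>- \<Delta>g = \<delta>\<^sub>0 - \<kappa>\<^sup>2 g\<close> makes \<open>div u\<close> as smooth as \<open>f\<close>. One step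
  therefore increases the \<open>C\<^bsup>1,\<beta>\<^esup>\<close> bound by \<open>O(h)\<close>, which keeps it under control up to a time depending
  only on constants uniform in \<open>\<kappa>\<close>. Arzela--Ascoli gives a limit, and interpolation between the
  uniform topology and the \<open>C\<^bsup>1,\<beta>\<^esup>\<close> bound upgrades the convergence. Uniqueness is a maximum
  principle for the square of the difference of two solutions.\<close>

subsection \<open>Hoelder-differentiable functions\<close>

text \<open>The ceiling \<open>N = M0 + 1\<close> for the C^{1,beta} constant and the radius
  \<open>R = R0 + 1\<close> are fixed before the scheme starts. Below them every field estimate has
  a fixed constant, so a step adds at most \<open>h * K\<close> to the constant of the density and
  \<open>h * L\<close> to the radius of its support, and any time with \<open>Ts * K\<close> and
  \<open>Ts * L\<close> at most 1 is safe. Only gradients of kernels enter: in two dimensions the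
  Bessel kernels themselves are unbounded as kappa tends to 0, but their gradients are controlled by
  one constant on the whole closed range of kappa. The map \<open>id - h u\<close> is only composed
  with, never inverted, so no characteristics have to be solved. The price is that the scheme need
  not conserve mass; unit mass is recovered for the limit, whose time derivative is a divergence.
  The time derivative contains the gradient, which a uniform distance delta controls only to a power
  gamma < 1. This suffices for existence but rules out a Gronwall argument in the uniform norm; the
  maximum principle works because at the extremal point the gradient term drops out.\<close>

lemma gradient_inner:
  fixes f :: "'a::euclidean_space \<Rightarrow> real"
  assumes "(f has_derivative D) (at x)"
  shows "gradient f x \<bullet> v = D v"
proof -
  have D: "frechet_derivative f (at x) = D"
    using frechet_derivative_at[OF assms] by simp
  have "gradient f x \<bullet> v = (\<Sum>b\<in>Basis. D b * (b \<bullet> v))"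
    by (simp add: gradient_def D inner_sum_left)
  also have "\<dots> = D (\<Sum>b\<in>Basis. (v \<bullet> b) *\<^sub>R b)"
    using has_derivative_linear[OF assms]
    by (simp add: linear_sum linear_cmul inner_commute mult.commute)
  also have "\<dots> = D v" by (simp add: euclidean_representation)
  finally show ?thesis .
qed

lemma has_derivative_gradient:
  fixes f :: "'a::euclidean_space \<Rightarrow> real"
  assumes "f differentiable (at x)"
  shows "(f has_derivative (\<lambda>v. gradient f x \<bullet> v)) (at x)"
proof -
  obtain D where D: "(f has_derivative D) (at x)"
    using assms by (auto simp: differentiable_def)
  then have "(\<lambda>v. gradient f x \<bullet> v) = D" by (auto simp: gradient_inner)
  with D show ?thesis by simp
qed

lemma gradient_eqI:
  fixes f :: "'a::euclidean_space \<Rightarrow> real"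
  assumes "(f has_derivative (\<lambda>v. g \<bullet> v)) (at x)"
  shows "gradient f x = g"
  by (metis assms gradient_inner inner_commute vector_eq_rdot)

text \<open>Directional derivatives of a convolution are again convolutions, so gradients are
  estimated through their inner products with unit vectors.\<close>

lemma norm_le_by_inner:
  fixes g :: "'a::euclidean_space"
  assumes "\<And>v. norm v = 1 \<Longrightarrow> g \<bullet> v \<le> M" and "0 \<le> M"
  shows "norm g \<le> M"
proof (cases "g = 0")
  case False
  have "g \<bullet> (g /\<^sub>R norm g) = norm g"
    using False by (simp add: dot_square_norm power2_eq_square)
  then show ?thesis using assms(1)[of "g /\<^sub>R norm g"] False by simp
qed (use assms in simp)

text \<open>The Lipschitz bound serves for d \<le> 1, the plain bound for d > 1; together they give
  a Hoelder bound at all distances.\<close>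

lemma powr_le_one_bound:
  fixes n K d \<beta> :: real
  assumes "n \<le> K * d" "n \<le> K" "0 \<le> d" "0 < \<beta>" "\<beta> \<le> 1" "0 \<le> K"
  shows "n \<le> K * d powr \<beta>"
proof (cases "d \<le> 1")
  case True
  have "d \<le> d powr \<beta>"
    using powr_mono'[of \<beta> 1 d] True assms by (cases "d = 0") auto
  then show ?thesis using assms mult_left_mono[of d "d powr \<beta>" K] by linarith
next
  case False
  then have "1 \<le> d powr \<beta>" using assms ge_one_powr_ge_zero by auto
  then show ?thesis using assms mult_left_mono[of 1 "d powr \<beta>" K] by linarith
qed

text \<open>With theta = beta'/beta, write n as n^(1-theta) n^theta and use the plain bound on one
  factor, the beta bound on the other. Smallness of \<open>e\<close> survives at the price of a
  smaller exponent.\<close>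

lemma powr_interpolation:
  fixes n e K d \<beta> \<beta>' :: real
  assumes "0 \<le> n" "n \<le> e" "n \<le> K * d powr \<beta>" "0 \<le> d" "0 < \<beta>'" "\<beta>' < \<beta>" "0 \<le> K"
  shows "n \<le> e powr (1 - \<beta>' / \<beta>) * K powr (\<beta>' / \<beta>) * d powr \<beta>'"
proof (cases "n = 0")
  case False
  define \<theta> where "\<theta> = \<beta>' / \<beta>"
  have th: "0 < \<theta>" "\<theta> < 1" using assms by (auto simp: \<theta>_def)
  have "n = n powr (1 - \<theta>) * n powr \<theta>"
    using False assms by (simp flip: powr_add)
  also have "\<dots> \<le> e powr (1 - \<theta>) * (K * d powr \<beta>) powr \<theta>"
    using assms th by (intro mult_mono powr_mono2) auto
  also have "(K * d powr \<beta>) powr \<theta> = K powr \<theta> * d powr \<beta>'"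
    using assms by (simp add: powr_mult powr_powr \<theta>_def)
  finally show ?thesis by (simp add: \<theta>_def mult.assoc)
qed simp

text \<open>Real inequalities with one constant in place of the extended norm: for differentiable
  functions \<open>C1_norm\<close> and the least such \<open>M\<close> agree up to the factor 3. In
  this maximum form a step of the scheme raises \<open>M\<close> by a term of order h.\<close>

definition C1b :: "real \<Rightarrow> real \<Rightarrow> ('a::euclidean_space \<Rightarrow> real) \<Rightarrow> bool" where
  "C1b \<beta> M f \<longleftrightarrow> (\<forall>x. f differentiable (at x)) \<and> (\<forall>x. \<bar>f x\<bar> \<le> M) \<and>
     (\<forall>x. norm (gradient f x) \<le> M) \<and>
     (\<forall>x y. norm (gradient f x - gradient f y) \<le> M * norm (x - y) powr \<beta>)"

lemma C1bD:
  assumes "C1b \<beta> M f"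
  shows "f differentiable (at x)" "\<bar>f x\<bar> \<le> M" "norm (gradient f x) \<le> M"
    "norm (gradient f x - gradient f y) \<le> M * norm (x - y) powr \<beta>"
    "(f has_derivative (\<lambda>v. gradient f x \<bullet> v)) (at x)"
  using assms has_derivative_gradient unfolding C1b_def by auto

lemma C1b_nonneg: "C1b \<beta> M f \<Longrightarrow> 0 \<le> M"
  using C1bD(2) abs_ge_zero order_trans by blast

lemma C1bI:
  assumes "\<And>x. (f has_derivative (\<lambda>v. g x \<bullet> v)) (at x)" "\<And>x. \<bar>f x\<bar> \<le> M"
    "\<And>x. norm (g x) \<le> M" "\<And>x y. norm (g x - g y) \<le> M * norm (x - y) powr \<beta>"
  shows "C1b \<beta> M f"
proof -
  have "gradient f x = g x" for x by (rule gradient_eqI) (rule assms(1))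
  then show ?thesis using assms by (auto simp: C1b_def differentiable_def)
qed

lemma C1b_mono:
  assumes "C1b \<beta> M f" "M \<le> M'"
  shows "C1b \<beta> M' f"
proof -
  have "M * norm (x - y) powr \<beta> \<le> M' * norm (x - y) powr \<beta>" for x y :: 'a
    using assms(2) by (simp add: mult_right_mono)
  then show ?thesis using assms unfolding C1b_def by (meson order_trans)
qed

lemma C1b_continuous: "C1b \<beta> M f \<Longrightarrow> continuous_on S f"
  by (meson C1bD(1) continuous_at_imp_continuous_on differentiable_imp_continuous_within)

lemma holder_imp_continuous:
  fixes F :: "'a::real_normed_vector \<Rightarrow> 'b::real_normed_vector"
  assumes "\<And>x y. norm (F x - F y) \<le> M * norm (x - y) powr \<beta>" "0 < \<beta>"
  shows "continuous_on S F"
proof -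
  have "isCont F x" for x
  proof -
    have "((\<lambda>y. M * norm (y - x) powr \<beta>) \<longlongrightarrow> 0) (at x)"
      using assms(2) by (auto intro!: tendsto_eq_intros)
    then have "((\<lambda>y. F y - F x) \<longlongrightarrow> 0) (at x)"
      by (rule Lim_null_comparison[rotated]) (auto simp: assms(1))
    then show ?thesis by (simp add: isCont_def LIM_zero_iff)
  qed
  then show ?thesis by (simp add: continuous_at_imp_continuous_on)
qed

lemma C1b_continuous_gradient: "C1b \<beta> M f \<Longrightarrow> 0 < \<beta> \<Longrightarrow> continuous_on S (gradient f)"
  by (rule holder_imp_continuous[of _ M \<beta>]) (auto intro: C1bD)

lemma bounded_gradient_lipschitz:
  fixes f :: "'a::euclidean_space \<Rightarrow> real"
  assumes "\<And>x. f differentiable (at x)" "\<And>x. norm (gradient f x) \<le> M"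
  shows "\<bar>f x - f y\<bar> \<le> M * norm (x - y)"
proof -
  have "norm (f x - f y) \<le> M * norm (x - y)"
  proof (rule differentiable_bound[of UNIV])
    show "(f has_derivative (\<lambda>v. gradient f x \<bullet> v)) (at x within UNIV)" for x
      using assms(1) has_derivative_gradient by auto
    show "onorm (\<lambda>v. gradient f x \<bullet> v) \<le> M" for x
    proof (rule onorm_le)
      fix v
      have "norm (gradient f x \<bullet> v) \<le> norm (gradient f x) * norm v"
        by (simp add: Cauchy_Schwarz_ineq2)
      then show "norm (gradient f x \<bullet> v) \<le> M * norm v"
        using assms(2)[of x] by (meson mult_right_mono norm_ge_zero order_trans)
    qed
  qed auto
  then show ?thesis by simp
qed

lemma C1b_lipschitz: "C1b \<beta> M f \<Longrightarrow> \<bar>f x - f y\<bar> \<le> M * norm (x - y)"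
  by (rule bounded_gradient_lipschitz) (auto dest: C1bD)

lemma C1b_holder:
  assumes "C1b \<beta> M f" "0 < \<beta>" "\<beta> \<le> 1"
  shows "\<bar>f x - f y\<bar> \<le> 2 * M * norm (x - y) powr \<beta>"
proof (rule powr_le_one_bound)
  have M: "0 \<le> M" using C1b_nonneg assms by blast
  have "M * norm (x - y) \<le> 2 * M * norm (x - y)" using M by (simp add: mult_right_mono)
  then show "\<bar>f x - f y\<bar> \<le> 2 * M * norm (x - y)"
    using C1b_lipschitz[OF assms(1), of x y] by linarith
  show "\<bar>f x - f y\<bar> \<le> 2 * M"
    using C1bD(2)[OF assms(1), of x] C1bD(2)[OF assms(1), of y] by linarith
qed (use assms C1b_nonneg in auto)

text \<open>The mean value theorem along the segment evaluates the gradient at an intermediate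
  point, at distance at most |v| from \<open>x\<close>; the Hoelder bound of the gradient gives the
  extra power beta.\<close>

lemma C1b_taylor:
  assumes "C1b \<beta> M f" "0 < \<beta>"
  shows "\<bar>f (x + v) - f x - gradient f x \<bullet> v\<bar> \<le> M * norm v powr (1 + \<beta>)"
proof -
  have M: "0 \<le> M" using C1b_nonneg assms by blast
  have der: "((\<lambda>t. f (x + t *\<^sub>R v)) has_real_derivative gradient f (x + t *\<^sub>R v) \<bullet> v) (at t)" for t
  proof -
    have "((\<lambda>t. f (x + t *\<^sub>R v)) has_derivative (\<lambda>s. gradient f (x + t *\<^sub>R v) \<bullet> (s *\<^sub>R v))) (at t)"
    proof (rule has_derivative_compose[where f = "\<lambda>t. x + t *\<^sub>R v" and g = f])
      show "((\<lambda>t. x + t *\<^sub>R v) has_derivative (\<lambda>s. s *\<^sub>R v)) (at t)"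
        by (auto intro!: derivative_eq_intros)
      show "(f has_derivative (\<lambda>w. gradient f (x + t *\<^sub>R v) \<bullet> w)) (at (x + t *\<^sub>R v))"
        by (rule C1bD(5)[OF assms(1)])
    qed
    then show ?thesis
      by (simp add: has_field_derivative_def mult_commute_abs)
  qed
  obtain t where t: "0 < t" "t < 1" "f (x + 1 *\<^sub>R v) - f (x + 0 *\<^sub>R v) = (1 - 0) * (gradient f (x + t *\<^sub>R v) \<bullet> v)"
    using MVT2[of 0 1 "\<lambda>t. f (x + t *\<^sub>R v)" "\<lambda>t. gradient f (x + t *\<^sub>R v) \<bullet> v"] der by auto
  have "\<bar>f (x + v) - f x - gradient f x \<bullet> v\<bar> = \<bar>(gradient f (x + t *\<^sub>R v) - gradient f x) \<bullet> v\<bar>"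
    using t by (simp add: inner_diff_left)
  also have "\<dots> \<le> norm (gradient f (x + t *\<^sub>R v) - gradient f x) * norm v"
    by (rule Cauchy_Schwarz_ineq2)
  also have "\<dots> \<le> (M * norm (t *\<^sub>R v) powr \<beta>) * norm v"
    using C1bD(4)[OF assms(1), of "x + t *\<^sub>R v" x] by (intro mult_right_mono) auto
  also have "\<dots> \<le> (M * norm v powr \<beta>) * norm v"
    using t M assms by (intro mult_right_mono mult_left_mono powr_mono2) (auto intro: mult_left_le_one_le)
  also have "\<dots> = M * norm v powr (1 + \<beta>)"
    by (cases "v = 0") (auto simp: powr_add)
  finally show ?thesis .
qed

text \<open>A remainder bounded by a power 1 + beta survives limits, convolution and integration in
  a parameter. The derivatives of uniform limits, convolutions and heat integrals are obtained from
  this criterion.\<close>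

lemma has_derivative_superlinear:
  fixes f :: "'a::real_normed_vector \<Rightarrow> 'b::real_normed_vector"
  assumes "bounded_linear D" "0 < \<beta>" "0 < \<delta>"
    "\<And>v. norm v \<le> \<delta> \<Longrightarrow> norm (f (x + v) - f x - D v) \<le> M * norm v powr (1 + \<beta>)"
  shows "(f has_derivative D) (at x)"
  unfolding has_derivative_at
proof (intro conjI assms(1))
  have "((\<lambda>h::'a. M * norm h powr \<beta>) \<longlongrightarrow> 0) (at 0)"
    using assms(2) by (auto intro!: tendsto_eq_intros)
  then show "(\<lambda>h. norm (f (x + h) - f x - D h) / norm h) \<midarrow>0\<rightarrow> 0"
  proof (rule Lim_null_comparison[rotated])
    have "\<forall>\<^sub>F h in at (0::'a). norm h < \<delta> \<and> h \<noteq> 0"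
      using eventually_at[of "\<lambda>h. norm h < \<delta> \<and> h \<noteq> 0" "0::'a" UNIV] assms(3) by (auto intro!: exI[of _ \<delta>])
    then show "\<forall>\<^sub>F h in at 0. norm (norm (f (x + h) - f x - D h) / norm h) \<le> M * norm h powr \<beta>"
    proof (rule eventually_mono)
      fix h :: 'a assume h: "norm h < \<delta> \<and> h \<noteq> 0"
      then show "norm (norm (f (x + h) - f x - D h) / norm h) \<le> M * norm h powr \<beta>"
        using assms(4)[of h] by (simp add: powr_add divide_simps mult_ac)
    qed
  qed
qed

section \<open>Sums, products and compositions\<close>

lemma C1b_add:
  assumes "C1b \<beta> M f" "C1b \<beta> M' g"
  shows "C1b \<beta> (M + M') (\<lambda>x. f x + g x)"
proof (rule C1bI)
  show "((\<lambda>x. f x + g x) has_derivative (\<lambda>v. (gradient f x + gradient g x) \<bullet> v)) (at x)" for x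
    using has_derivative_add[OF C1bD(5)[OF assms(1)] C1bD(5)[OF assms(2)]]
    by (simp add: inner_add_left)
  show "\<bar>f x + g x\<bar> \<le> M + M'" for x
    using C1bD(2)[OF assms(1), of x] C1bD(2)[OF assms(2), of x] by linarith
  show "norm (gradient f x + gradient g x) \<le> M + M'" for x
    using C1bD(3)[OF assms(1), of x] C1bD(3)[OF assms(2), of x] norm_triangle_mono by blast
  show "norm (gradient f x + gradient g x - (gradient f y + gradient g y)) \<le> (M + M') * norm (x - y) powr \<beta>" for x y
    using norm_triangle_mono[OF C1bD(4)[OF assms(1), of x y] C1bD(4)[OF assms(2), of x y]]
    by (simp add: algebra_simps)
qed

lemma C1b_cmult:
  assumes "C1b \<beta> M f"
  shows "C1b \<beta> (\<bar>c\<bar> * M) (\<lambda>x. c * f x)"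
proof (rule C1bI)
  show "((\<lambda>x. c * f x) has_derivative (\<lambda>v. (c *\<^sub>R gradient f x) \<bullet> v)) (at x)" for x
    using has_derivative_mult_right[OF C1bD(5)[OF assms(1)], of c x] by simp
  show "\<bar>c * f x\<bar> \<le> \<bar>c\<bar> * M" for x
    using C1bD(2)[OF assms(1), of x] by (simp add: abs_mult mult_left_mono)
  show "norm (c *\<^sub>R gradient f x) \<le> \<bar>c\<bar> * M" for x
    using C1bD(3)[OF assms(1), of x] by (simp add: mult_left_mono)
  show "norm (c *\<^sub>R gradient f x - c *\<^sub>R gradient f y) \<le> \<bar>c\<bar> * M * norm (x - y) powr \<beta>" for x y
    using C1bD(4)[OF assms(1), of x y]
    by (simp flip: scaleR_diff_right add: mult.assoc mult_left_mono)
qed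

lemma C1b_diff:
  assumes "C1b \<beta> M f" "C1b \<beta> M' g"
  shows "C1b \<beta> (M + M') (\<lambda>x. f x - g x)"
  using C1b_add[OF assms(1) C1b_cmult[OF assms(2), of "-1"]] by simp

lemma gradient_diff:
  assumes "f differentiable (at x)" "g differentiable (at x)"
  shows "gradient (\<lambda>x. f x - g x) x = gradient f x - gradient g x"
  by (rule gradient_eqI)
    (use has_derivative_diff[OF has_derivative_gradient[OF assms(1)] has_derivative_gradient[OF assms(2)]]
      in \<open>simp add: inner_diff_left\<close>)

text \<open>The constant is 1 + 2 + 1 + 2: the increment of the gradient of the product splits into
  four terms, and the two that contain a difference of function values carry the factor 2 of
  \<open>C1b_holder\<close>.\<close>

lemma C1b_mult:
  assumes f: "C1b \<beta> M f" and g: "C1b \<beta> M' g" and "0 < \<beta>" "\<beta> \<le> 1"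
  shows "C1b \<beta> (6 * M * M') (\<lambda>x. f x * g x)"
proof (rule C1bI)
  have M: "0 \<le> M" "0 \<le> M'" using C1b_nonneg f g by auto
  let ?G = "\<lambda>x. f x *\<^sub>R gradient g x + g x *\<^sub>R gradient f x"
  show "((\<lambda>x. f x * g x) has_derivative (\<lambda>v. ?G x \<bullet> v)) (at x)" for x
    by (rule has_derivative_eq_rhs[OF has_derivative_mult[OF C1bD(5)[OF f] C1bD(5)[OF g]]])
      (auto simp: inner_add_left algebra_simps)
  have MM: "0 \<le> M * M'" using M by simp
  have fg: "\<bar>f x * g x\<bar> \<le> M * M'" for x
    using mult_mono[OF C1bD(2)[OF f, of x] C1bD(2)[OF g, of x]] M by (simp add: abs_mult)
  show "\<bar>f x * g x\<bar> \<le> 6 * M * M'" for x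
    using MM fg[of x] by (simp add: mult.assoc)
  have "norm (f x *\<^sub>R gradient g x) \<le> M * M'" "norm (g x *\<^sub>R gradient f x) \<le> M * M'" for x
    using mult_mono[OF C1bD(2)[OF f, of x] C1bD(3)[OF g, of x]]
      mult_mono[OF C1bD(3)[OF f, of x] C1bD(2)[OF g, of x]] M by (simp_all add: mult.commute)
  then have G: "norm (?G x) \<le> M * M' + M * M'" for x
    by (meson norm_triangle_mono)
  show "norm (?G x) \<le> 6 * M * M'" for x
    using MM G[of x] by (simp add: mult.assoc)
  show "norm (?G x - ?G y) \<le> 6 * M * M' * norm (x - y) powr \<beta>" for x y
  proof -
    let ?d = "norm (x - y) powr \<beta>"
    have 1: "norm (f x *\<^sub>R (gradient g x - gradient g y)) \<le> M * (M' * ?d)"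
      using mult_mono[OF C1bD(2)[OF f, of x] C1bD(4)[OF g, of x y]] M by simp
    have 2: "norm ((f x - f y) *\<^sub>R gradient g y) \<le> (2 * M * ?d) * M'"
      using mult_mono[OF C1b_holder[OF f assms(3,4), of x y] C1bD(3)[OF g, of y]] M by simp
    have 3: "norm (g x *\<^sub>R (gradient f x - gradient f y)) \<le> M' * (M * ?d)"
      using mult_mono[OF C1bD(2)[OF g, of x] C1bD(4)[OF f, of x y]] M by simp
    have 4: "norm ((g x - g y) *\<^sub>R gradient f y) \<le> (2 * M' * ?d) * M"
      using mult_mono[OF C1b_holder[OF g assms(3,4), of x y] C1bD(3)[OF f, of y]] M by simp
    have "?G x - ?G y = (f x *\<^sub>R (gradient g x - gradient g y) + (f x - f y) *\<^sub>R gradient g y)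
        + (g x *\<^sub>R (gradient f x - gradient f y) + (g x - g y) *\<^sub>R gradient f y)"
      by (simp add: algebra_simps)
    then have "norm (?G x - ?G y) \<le> (M * (M' * ?d) + (2 * M * ?d) * M') + (M' * (M * ?d) + (2 * M' * ?d) * M)"
      using norm_triangle_mono[OF norm_triangle_mono[OF 1 2] norm_triangle_mono[OF 3 4]] by simp
    then show ?thesis by (simp add: algebra_simps)
  qed
qed

text \<open>The leading coefficient of \<open>M\<close> has to stay exactly 1. The Hoelder quotient
  of the new gradient gains one factor 1 + hL from the chain rule, another from the expansion of
  distances, and a summand hL from the oscillation of \<open>Du\<close>; as h \<le> 1, (1 + hL)^2 +
  hL \<le> 1 + h(3L + L^2).\<close>

lemma C1b_compose_flow:
  fixes u :: "'a::euclidean_space \<Rightarrow> 'a"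
  assumes p: "C1b \<beta> M p" and \<beta>: "0 < \<beta>" "\<beta> \<le> 1" and h: "0 \<le> h" "h \<le> 1" and L: "0 \<le> L"
    and u: "\<And>x. (u has_derivative Du x) (at x)" "\<And>x v. norm (Du x v) \<le> L * norm v"
      "\<And>x y v. norm (Du x v - Du y v) \<le> L * norm (x - y) powr \<beta> * norm v"
  shows "C1b \<beta> (M + h * (M * (3 * L + L\<^sup>2))) (\<lambda>x. p (x - h *\<^sub>R u x))"
proof -
  have M: "0 \<le> M" using C1b_nonneg p by blast
  let ?\<phi> = "\<lambda>x. x - h *\<^sub>R u x"
  let ?K = "M + h * (M * (3 * L + L\<^sup>2))"
  have hL: "0 \<le> h * L" using h L by simp
  have der: "((\<lambda>x. p (?\<phi> x)) has_derivative (\<lambda>v. gradient p (?\<phi> x) \<bullet> (v - h *\<^sub>R Du x v))) (at x)" for x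
  proof (rule has_derivative_compose[where f = ?\<phi> and g = p])
    show "(?\<phi> has_derivative (\<lambda>v. v - h *\<^sub>R Du x v)) (at x)"
      by (auto intro!: derivative_eq_intros u)
    show "(p has_derivative (\<lambda>w. gradient p (?\<phi> x) \<bullet> w)) (at (?\<phi> x))"
      by (rule C1bD(5)[OF p])
  qed
  have dv: "norm (v - h *\<^sub>R Du x v) \<le> 1 + h * L" if "norm v = 1" for x v
  proof -
    have "norm (v - h *\<^sub>R Du x v) \<le> norm v + h * norm (Du x v)"
      using norm_triangle_ineq4[of v "h *\<^sub>R Du x v"] h by simp
    then show ?thesis using u(2)[of x v] that h by (smt (verit) mult_left_mono mult_cancel_left1)
  qed
  have grad: "gradient (\<lambda>x. p (?\<phi> x)) x \<bullet> v = gradient p (?\<phi> x) \<bullet> (v - h *\<^sub>R Du x v)" for x v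
    by (rule gradient_inner[OF der])
  have hh: "(1 + h * L) * (1 + h * L) + h * L \<le> 1 + h * (3 * L + L\<^sup>2)"
  proof -
    have "h * (h * L\<^sup>2) \<le> 1 * (h * L\<^sup>2)" using h by (intro mult_right_mono) auto
    then show ?thesis by (simp add: algebra_simps power2_eq_square)
  qed
  have K: "M * ((1 + h * L) * (1 + h * L) + h * L) \<le> ?K"
    using mult_left_mono[OF hh M] by (simp add: algebra_simps)
  have K1: "M * (1 + h * L) \<le> ?K"
  proof -
    have "h * (M * L) \<le> h * (M * (3 * L + L\<^sup>2))" using M h L by (intro mult_left_mono) auto
    then show ?thesis by (simp add: algebra_simps)
  qed
  have lip: "norm (u x - u y) \<le> L * norm (x - y)" for x y
    by (rule differentiable_bound[of UNIV, OF _ u(1)]) (auto intro!: onorm_le u(2))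
  have philip: "norm (?\<phi> x - ?\<phi> y) \<le> (1 + h * L) * norm (x - y)" for x y
  proof -
    have "norm (?\<phi> x - ?\<phi> y) = norm ((x - y) - h *\<^sub>R (u x - u y))" by (simp add: algebra_simps)
    also have "\<dots> \<le> norm (x - y) + h * norm (u x - u y)"
      using norm_triangle_ineq4[of "x - y" "h *\<^sub>R (u x - u y)"] h by simp
    also have "\<dots> \<le> norm (x - y) + h * (L * norm (x - y))"
      using lip h by (intro add_left_mono mult_left_mono) auto
    finally show ?thesis by (simp add: algebra_simps)
  qed
  show ?thesis unfolding C1b_def
  proof (intro conjI allI)
    show "(\<lambda>x. p (?\<phi> x)) differentiable at x" for x using der by (auto simp: differentiable_def)
    have "M \<le> ?K" using M h L by simp
    then show "\<bar>p (?\<phi> x)\<bar> \<le> ?K" for x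
      using C1bD(2)[OF p] order_trans by blast
    show "norm (gradient (\<lambda>x. p (?\<phi> x)) x) \<le> ?K" for x
    proof (rule norm_le_by_inner)
      fix v :: 'a assume v: "norm v = 1"
      have "gradient (\<lambda>x. p (?\<phi> x)) x \<bullet> v \<le> norm (gradient p (?\<phi> x)) * norm (v - h *\<^sub>R Du x v)"
        unfolding grad by (rule norm_cauchy_schwarz)
      also have "\<dots> \<le> M * (1 + h * L)"
        using C1bD(3)[OF p] dv[OF v] M by (intro mult_mono) auto
      finally show "gradient (\<lambda>x. p (?\<phi> x)) x \<bullet> v \<le> ?K" using K1 by simp
    qed (use \<open>M \<le> ?K\<close> M in simp)
    show "norm (gradient (\<lambda>x. p (?\<phi> x)) x - gradient (\<lambda>x. p (?\<phi> x)) y) \<le> ?K * norm (x - y) powr \<beta>" for x y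
    proof (rule norm_le_by_inner)
      fix v :: 'a assume v: "norm v = 1"
      let ?d = "norm (x - y) powr \<beta>"
      have 1: "norm (gradient p (?\<phi> x) - gradient p (?\<phi> y)) \<le> M * ((1 + h * L) * ?d)"
      proof -
        have "norm (?\<phi> x - ?\<phi> y) powr \<beta> \<le> ((1 + h * L) * norm (x - y)) powr \<beta>"
          using philip \<beta> by (intro powr_mono2) auto
        also have "\<dots> = (1 + h * L) powr \<beta> * ?d" using hL by (simp add: powr_mult)
        also have "\<dots> \<le> (1 + h * L) * ?d"
          using powr_mono[of \<beta> 1 "1 + h * L"] hL \<beta> by (intro mult_right_mono) auto
        finally show ?thesis using C1bD(4)[OF p, of "?\<phi> x" "?\<phi> y"] M
          by (meson mult_left_mono order_trans)
      qed
      have 2: "norm (h *\<^sub>R (Du y v - Du x v)) \<le> h * (L * ?d)"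
        using u(3)[of y v x] v h by (simp add: mult_left_mono norm_minus_commute)
      have "(gradient (\<lambda>x. p (?\<phi> x)) x - gradient (\<lambda>x. p (?\<phi> x)) y) \<bullet> v
        = (gradient p (?\<phi> x) - gradient p (?\<phi> y)) \<bullet> (v - h *\<^sub>R Du x v)
          + gradient p (?\<phi> y) \<bullet> (h *\<^sub>R (Du y v - Du x v))"
        unfolding inner_diff_left grad by (simp add: algebra_simps inner_diff_left inner_diff_right)
      also have "\<dots> \<le> M * ((1 + h * L) * ?d) * (1 + h * L) + M * (h * (L * ?d))"
      proof (rule add_mono)
        show "(gradient p (?\<phi> x) - gradient p (?\<phi> y)) \<bullet> (v - h *\<^sub>R Du x v) \<le> M * ((1 + h * L) * ?d) * (1 + h * L)"
          by (rule order_trans[OF norm_cauchy_schwarz]) (use 1 dv[OF v, of x] M hL in \<open>auto intro!: mult_mono\<close>)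
        show "gradient p (?\<phi> y) \<bullet> (h *\<^sub>R (Du y v - Du x v)) \<le> M * (h * (L * ?d))"
          by (rule order_trans[OF norm_cauchy_schwarz]) (use 2 C1bD(3)[OF p, of "?\<phi> y"] M hL in \<open>auto intro!: mult_mono\<close>)
      qed
      also have "\<dots> = M * ((1 + h * L) * (1 + h * L) + h * L) * ?d" by (simp add: algebra_simps)
      also have "\<dots> \<le> ?K * ?d" using K by (intro mult_right_mono) auto
      finally show "(gradient (\<lambda>x. p (?\<phi> x)) x - gradient (\<lambda>x. p (?\<phi> x)) y) \<bullet> v \<le> ?K * ?d" .
    qed (use \<open>M \<le> ?K\<close> M in simp)
  qed
qed

text \<open>Taylor expansion with step s = delta^(1/(1+beta)); this choice balances the quotient
  delta/s of the values against the remainder M s^beta.\<close>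

lemma gradient_interpolation:
  assumes F: "C1b \<beta> M F" and "0 < \<beta>" "0 < \<delta>" "\<And>x. \<bar>F x\<bar> \<le> \<delta>"
  shows "norm (gradient F x) \<le> (2 + M) * \<delta> powr (\<beta> / (1 + \<beta>))"
proof (rule norm_le_by_inner)
  have M: "0 \<le> M" using C1b_nonneg F by blast
  then show "0 \<le> (2 + M) * \<delta> powr (\<beta> / (1 + \<beta>))" by simp
  fix v :: 'a assume v: "norm v = 1"
  define s where "s = \<delta> powr (1 / (1 + \<beta>))"
  have s: "0 < s" "s powr (1 + \<beta>) = \<delta>" using assms by (auto simp: s_def powr_powr)
  have "\<bar>F (x + s *\<^sub>R v) - F x - gradient F x \<bullet> (s *\<^sub>R v)\<bar> \<le> M * norm (s *\<^sub>R v) powr (1 + \<beta>)"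
    by (rule C1b_taylor) (use assms in auto)
  then have "s * (gradient F x \<bullet> v) \<le> M * \<delta> + 2 * \<delta>"
    using assms(4)[of x] assms(4)[of "x + s *\<^sub>R v"] v s by (simp add: abs_le_iff)
  then have "gradient F x \<bullet> v \<le> (2 + M) * (\<delta> / s)"
    using s by (simp add: field_simps)
  also have "\<delta> / s = \<delta> powr (1 - 1 / (1 + \<beta>))"
    using assms by (simp add: s_def powr_diff)
  also have "1 - 1 / (1 + \<beta>) = \<beta> / (1 + \<beta>)" using assms by (simp add: field_simps)
  finally show "gradient F x \<bullet> v \<le> (2 + M) * \<delta> powr (\<beta> / (1 + \<beta>))" .
qed

lemma gradient_diff_interpolation:
  assumes f: "C1b \<beta> M f" and g: "C1b \<beta> M g" and "0 < \<beta>" "0 < \<delta>" "\<And>x. \<bar>f x - g x\<bar> \<le> \<delta>"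
  shows "norm (gradient f x - gradient g x) \<le> (2 + 2 * M) * \<delta> powr (\<beta> / (1 + \<beta>))"
proof -
  have "norm (gradient (\<lambda>x. f x - g x) x) \<le> (2 + (M + M)) * \<delta> powr (\<beta> / (1 + \<beta>))"
    by (rule gradient_interpolation[OF C1b_diff[OF f g]]) (use assms in auto)
  then show ?thesis by (simp add: gradient_diff[OF C1bD(1)[OF f] C1bD(1)[OF g]])
qed

text \<open>By interpolation the gradients form a Cauchy sequence at each point, which yields the
  candidate \<open>G\<close>. That it is the derivative follows by passing to the limit in the
  Taylor inequality, pointwise in \<open>x\<close> and \<open>v\<close>.\<close>

lemma C1b_uniform_limit:
  fixes f :: "nat \<Rightarrow> 'a::euclidean_space \<Rightarrow> real"
  assumes f: "\<And>n. C1b \<beta> M (f n)" and \<beta>: "0 < \<beta>" and lim: "uniform_limit UNIV f g sequentially"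
  shows "C1b \<beta> M g"
proof -
  have M: "0 \<le> M" using C1b_nonneg f by blast
  define \<gamma> where "\<gamma> = \<beta> / (1 + \<beta>)"
  have \<gamma>: "0 < \<gamma>" using \<beta> by (simp add: \<gamma>_def)
  have "Cauchy (\<lambda>n. gradient (f n) x)" for x
  proof (rule metric_CauchyI)
    fix e :: real assume e: "0 < e"
    define \<delta> where "\<delta> = (e / (3 + 2 * M)) powr (1 / \<gamma>)"
    have \<delta>: "0 < \<delta>" "\<delta> powr \<gamma> = e / (3 + 2 * M)"
      using e M \<gamma> by (auto simp: \<delta>_def powr_powr)
    have "\<forall>\<^sub>F n in sequentially. \<forall>x\<in>UNIV. dist (f n x) (g x) < \<delta> / 2"
      using lim \<delta> by (intro uniform_limitD) auto
    then obtain N where N: "\<And>n x. n \<ge> N \<Longrightarrow> dist (f n x) (g x) < \<delta> / 2"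
      by (auto simp: eventually_sequentially)
    have "dist (gradient (f m) x) (gradient (f n) x) < e" if "m \<ge> N" "n \<ge> N" for m n
    proof -
      have "\<bar>f m y - f n y\<bar> \<le> \<delta>" for y
        using N[OF that(1), of y] N[OF that(2), of y] unfolding dist_real_def by linarith
      then have "norm (gradient (f m) x - gradient (f n) x) \<le> (2 + 2 * M) * \<delta> powr \<gamma>"
        unfolding \<gamma>_def using f \<beta> \<delta> by (intro gradient_diff_interpolation) auto
      also have "\<dots> < e" using e M by (simp add: \<delta> divide_simps)
      finally show ?thesis by (simp add: dist_norm)
    qed
    then show "\<exists>N. \<forall>m\<ge>N. \<forall>n\<ge>N. dist (gradient (f m) x) (gradient (f n) x) < e" by blast
  qed
  then have "(\<lambda>n. gradient (f n) x) \<longlonglongrightarrow> lim (\<lambda>n. gradient (f n) x)" for x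
    using Cauchy_convergent_iff convergent_LIMSEQ_iff by blast
  moreover define G where "G x = lim (\<lambda>n. gradient (f n) x)" for x
  ultimately have G: "(\<lambda>n. gradient (f n) x) \<longlonglongrightarrow> G x" for x
    by simp
  have fg: "(\<lambda>n. f n x) \<longlonglongrightarrow> g x" for x
    using lim by (rule tendsto_uniform_limitI) simp
  show ?thesis
  proof (rule C1bI)
    show "\<bar>g x\<bar> \<le> M" for x
      by (rule LIMSEQ_le_const2[OF tendsto_rabs[OF fg]]) (use C1bD(2)[OF f] in auto)
    show "norm (G x) \<le> M" for x
      by (rule LIMSEQ_le_const2[OF tendsto_norm[OF G]]) (use C1bD(3)[OF f] in auto)
    show "norm (G x - G y) \<le> M * norm (x - y) powr \<beta>" for x y
      by (rule LIMSEQ_le_const2[OF tendsto_norm[OF tendsto_diff[OF G G]]]) (use C1bD(4)[OF f] in auto)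
    show "(g has_derivative (\<lambda>v. G x \<bullet> v)) (at x)" for x
    proof (rule has_derivative_superlinear[OF bounded_linear_inner_right \<beta> zero_less_one])
      fix v
      have "(\<lambda>n. norm (f n (x + v) - f n x - gradient (f n) x \<bullet> v)) \<longlonglongrightarrow> norm (g (x + v) - g x - G x \<bullet> v)"
        by (intro tendsto_intros fg G)
      then show "norm (g (x + v) - g x - G x \<bullet> v) \<le> M * norm v powr (1 + \<beta>)"
        by (rule LIMSEQ_le_const2) (use C1b_taylor[OF f \<beta>] in auto)
    qed
  qed
qed

subsection \<open>Integration on Euclidean space\<close>

lemma lborel_distr_reflect:
  "distr lborel borel (\<lambda>y. x - y) = (lborel :: 'a::euclidean_space measure)"
  using lborel_affine[of "-1" x] by (simp add: density_1)

lemma lborel_integral_reflect: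
  fixes g :: "'a::euclidean_space \<Rightarrow> 'b::{banach, second_countable_topology}"
  shows "(LINT y|lborel. g (x - y)) = (LINT y|lborel. g y)"
proof (cases "g \<in> borel_measurable borel")
  case True
  have "(LINT y|lborel. g y) = (LINT y|distr lborel borel (\<lambda>y. x - y). g y)"
    by (simp add: lborel_distr_reflect)
  also have "\<dots> = (LINT y|lborel. g (x - y))"
    using True by (subst integral_distr) auto
  finally show ?thesis ..
next
  case False
  \<comment> \<open>A nonmeasurable \<open>g\<close> makes both integrals the default value
    0.\<close>
  have "\<not> integrable lborel g" using False borel_measurable_integrable[of lborel g] by auto
  moreover have "\<not> integrable lborel (\<lambda>y. g (x - y))"
  proof
    assume "integrable lborel (\<lambda>y. g (x - y))"
    then have [measurable]: "(\<lambda>y. g (x - y)) \<in> borel_measurable borel"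
      using borel_measurable_integrable[of lborel "\<lambda>y. g (x - y)"] by auto
    have "(\<lambda>z. (\<lambda>y. g (x - y)) (x - z)) \<in> borel_measurable borel" by measurable
    then show False using False by simp
  qed
  ultimately show ?thesis by (simp add: not_integrable_integral_eq)
qed

lemma lborel_integrable_reflect:
  fixes g :: "'a::euclidean_space \<Rightarrow> 'b::{banach, second_countable_topology}"
  assumes "integrable lborel g"
  shows "integrable lborel (\<lambda>y. g (x - y))"
proof -
  have "integrable (distr lborel borel (\<lambda>y. x - y)) g"
    using assms by (simp add: lborel_distr_reflect)
  then show ?thesis by (rule integrable_distr[rotated]) simp
qed

lemma lborel_integral_translate:
  fixes g :: "'a::euclidean_space \<Rightarrow> 'b::{banach, second_countable_topology}"
  assumes "integrable lborel g"
  shows "integrable lborel (\<lambda>y. g (y + c))" "(LINT y|lborel. g (y + c)) = (LINT y|lborel. g y)"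
proof -
  have [measurable]: "g \<in> borel_measurable borel"
    using borel_measurable_integrable[OF assms] by simp
  have "integrable (distr lborel borel ((+) c)) g"
    using assms by (simp add: lborel_distr_plus)
  then show "integrable lborel (\<lambda>y. g (y + c))"
    by (subst (asm) integrable_distr_eq) (auto simp: add.commute)
  have "(LINT y|lborel. g y) = (LINT y|distr lborel borel ((+) c). g y)"
    by (simp add: lborel_distr_plus)
  also have "\<dots> = (LINT y|lborel. g (y + c))"
    by (subst integral_distr) (auto simp: add.commute)
  finally show "(LINT y|lborel. g (y + c)) = (LINT y|lborel. g y)" ..
qed

lemma emeasure_cball_less_top: "emeasure lborel (cball (x::'a::euclidean_space) R) < \<infinity>"
  using emeasure_bounded_finite[of "cball x R"] by auto

lemma integrable_cball_indicator: "integrable lborel (indicator (cball (x::'a::euclidean_space) R) :: 'a \<Rightarrow> real)"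
  using emeasure_cball_less_top by (auto intro!: integrable_real_indicator)

lemma integrable_bounded_support:
  fixes g :: "'a::euclidean_space \<Rightarrow> 'b::{banach, second_countable_topology}"
  assumes "g \<in> borel_measurable borel" "\<And>y. norm (g y) \<le> B * indicator (cball x R) y"
  shows "integrable lborel g" "norm (LINT y|lborel. g y) \<le> B * measure lborel (cball x R)"
proof -
  have i: "integrable lborel (\<lambda>y. B * indicator (cball x R) y)"
    using integrable_cball_indicator by (intro integrable_mult_right)
  show g: "integrable lborel g"
    by (rule Bochner_Integration.integrable_bound[OF i])
       (use assms(1) order_trans[OF assms(2) abs_ge_self] in \<open>auto simp del: abs_mult\<close>)
  have "norm (LINT y|lborel. g y) \<le> (LINT y|lborel. B * indicator (cball x R) y)"
    by (rule Bochner_Integration.integral_norm_bound_integral[OF g i assms(2)])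
  also have "\<dots> = B * measure lborel (cball x R)"
    by simp
  finally show "norm (LINT y|lborel. g y) \<le> B * measure lborel (cball x R)" .
qed

lemma lipschitz_borel_measurable:
  fixes V :: "'a::euclidean_space \<Rightarrow> 'b::euclidean_space"
  assumes "\<And>x y. norm (V x - V y) \<le> L * norm (x - y)"
  shows "V \<in> borel_measurable borel"
proof -
  have "continuous_on UNIV V"
    by (rule holder_imp_continuous[of V L 1]) (use assms in auto)
  then show ?thesis by (rule borel_measurable_continuous_onI)
qed

text \<open>The integral of every difference quotient vanishes by translation invariance.\<close>

lemma integral_directional_derivative_zero:
  fixes V :: "'a::euclidean_space \<Rightarrow> 'b::euclidean_space"
  assumes lip: "\<And>x y. norm (V x - V y) \<le> L * norm (x - y)"
    and supp: "\<And>x. R < norm x \<Longrightarrow> V x = 0"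
    and D: "D \<in> borel_measurable borel"
    and der: "AE x in lborel. ((\<lambda>t. (V (x + t *\<^sub>R b) - V x) /\<^sub>R t) \<longlongrightarrow> D x) (at 0)"
    and b: "norm b \<le> 1"
  shows "integrable lborel D" "(LINT x|lborel. D x) = 0"
proof -
  have L: "0 \<le> L" if "x \<noteq> y" for x y :: 'a
    using lip[of x y] that by (metis norm_ge_zero order_trans right_minus_eq zero_le_mult_iff zero_less_norm_iff leD)
  have L0: "0 \<le> L"
    using L[of 0 "SOME i. i \<in> Basis"] nonzero_Basis by (metis some_in_eq nonempty_Basis)
  have [measurable]: "V \<in> borel_measurable borel"
    using lip by (rule lipschitz_borel_measurable)
  have Vint: "integrable lborel V"
  proof (rule integrable_bounded_support)
    fix y
    show "norm (V y) \<le> (norm (V 0) + L * \<bar>R\<bar>) * indicator (cball 0 \<bar>R\<bar>) y"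
    proof (cases "norm y \<le> \<bar>R\<bar>")
      case True
      have "norm (V y) \<le> norm (V 0) + norm (V y - V 0)"
        by (metis add_diff_cancel_left' add_diff_eq norm_triangle_ineq)
      also have "\<dots> \<le> norm (V 0) + L * \<bar>R\<bar>"
        using lip[of y 0] True L0 mult_left_mono[OF True L0] by simp
      finally show ?thesis using True by simp
    qed (use supp in simp)
  qed simp
  \<comment> \<open>Steps of length at most 1 keep all difference quotients inside the ball of
    radius |R| + 1, where the Lipschitz constant dominates them.\<close>
  define t where "t n = 1 / real (Suc n)" for n
  have t: "t n > 0" "t n \<le> 1" for n by (auto simp: t_def)
  have t0: "filterlim t (at 0) sequentially"
    unfolding filterlim_at t_def using LIMSEQ_inverse_real_of_nat by (auto simp: inverse_eq_divide)
  define s where "s n x = (V (x + t n *\<^sub>R b) - V x) /\<^sub>R t n" for n x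
  have s0: "(LINT x|lborel. s n x) = 0" for n
    using lborel_integral_translate[OF Vint, of "t n *\<^sub>R b"] Vint
    by (simp add: s_def)
  have bd: "norm (s n x) \<le> L * indicator (cball 0 (\<bar>R\<bar> + 1)) x" for n x
  proof (cases "norm x \<le> \<bar>R\<bar> + 1")
    case True
    have "norm (V (x + t n *\<^sub>R b) - V x) \<le> L * norm (t n *\<^sub>R b)"
      using lip[of "x + t n *\<^sub>R b" x] by simp
    also have "\<dots> \<le> L * t n"
      using L0 b t[of n] by (intro mult_left_mono) (auto simp: mult_left_le)
    finally have "norm (V (x + t n *\<^sub>R b) - V x) / t n \<le> L"
      using t[of n] by (simp add: pos_divide_le_eq)
    then show ?thesis using True t[of n] by (simp add: s_def divide_inverse mult.commute)
  next
    case False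
    have "norm (t n *\<^sub>R b) \<le> 1"
      using b t[of n] by (simp add: mult_le_one)
    then have "norm (x + t n *\<^sub>R b) > \<bar>R\<bar>"
      using False norm_diff_ineq[of x "t n *\<^sub>R b"] by linarith
    then show ?thesis using False supp by (simp add: s_def)
  qed
  have w: "integrable lborel (\<lambda>x. L * indicator (cball 0 (\<bar>R\<bar> + 1)) x)"
    using integrable_cball_indicator by (intro integrable_mult_right)
  have conv: "AE x in lborel. (\<lambda>n. s n x) \<longlonglongrightarrow> D x"
    using der
  proof eventually_elim
    case (elim x)
    then show ?case unfolding s_def by (rule filterlim_compose[OF _ t0])
  qed
  have meas: "\<And>n. s n \<in> borel_measurable lborel" unfolding s_def by measurable
  have Dm: "D \<in> borel_measurable lborel" using D by simp
  show "integrable lborel D"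
    by (rule integrable_dominated_convergence[OF Dm meas w conv]) (use bd in auto)
  have "(\<lambda>n. LINT x|lborel. s n x) \<longlonglongrightarrow> (LINT x|lborel. D x)"
    by (rule integral_dominated_convergence[OF Dm meas w conv]) (use bd in auto)
  then show "(LINT x|lborel. D x) = 0"
    by (simp add: s0 LIMSEQ_const_iff)
qed

lemma directional_derivative_tendsto:
  fixes V :: "'a::real_normed_vector \<Rightarrow> 'b::real_normed_vector"
  assumes "(V has_derivative D) (at x)"
  shows "((\<lambda>t. (V (x + t *\<^sub>R b) - V x) /\<^sub>R t) \<longlongrightarrow> D b) (at 0)"
proof -
  have "((\<lambda>t. V (x + t *\<^sub>R b)) has_derivative (\<lambda>t. D (t *\<^sub>R b))) (at 0)"
  proof (rule has_derivative_compose[where f = "\<lambda>t. x + t *\<^sub>R b" and g = V])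
    show "((\<lambda>t. x + t *\<^sub>R b) has_derivative (\<lambda>t. t *\<^sub>R b)) (at 0)"
      by (auto intro!: derivative_eq_intros)
  qed (use assms in simp)
  then have "((\<lambda>t. V (x + t *\<^sub>R b)) has_vector_derivative D b) (at 0)"
    using linear_cmul[OF has_derivative_linear[OF assms]] by (simp add: has_vector_derivative_def)
  then have "(\<lambda>t. norm (V (x + t *\<^sub>R b) - V x - t *\<^sub>R D b) / norm t) \<midarrow>0\<rightarrow> 0"
    by (simp add: has_vector_derivative_def has_derivative_at)
  then have "(\<lambda>t. norm ((V (x + t *\<^sub>R b) - V x) /\<^sub>R t - D b)) \<midarrow>0\<rightarrow> 0"
  proof (rule Lim_transform_eventually)
    have "\<forall>\<^sub>F t in at (0::real). t \<noteq> 0" by (simp add: eventually_at_filter)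
    then show "\<forall>\<^sub>F t in at 0. norm (V (x + t *\<^sub>R b) - V x - t *\<^sub>R D b) / norm t
        = norm ((V (x + t *\<^sub>R b) - V x) /\<^sub>R t - D b)"
    proof eventually_elim
      case (elim t)
      then have "(V (x + t *\<^sub>R b) - V x) /\<^sub>R t - D b = (V (x + t *\<^sub>R b) - V x - t *\<^sub>R D b) /\<^sub>R t"
        by (simp add: scaleR_diff_right)
      then show ?case by (simp add: divide_inverse mult.commute)
    qed
  qed
  then show ?thesis
    by (simp add: LIM_zero_iff tendsto_norm_zero_iff)
qed

subsection \<open>Integrable singularities\<close>

text \<open>On the dyadic shell between radii r_{j+1} and r_j the weight is at most r_{j+1}^(-a).
  Full balls in place of shells cost only a constant: the integrals form a geometric series of ratio
  2^(a-d), which converges as a < d.\<close>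

lemma ball_power_integrable:
  fixes a :: real
  assumes a: "0 \<le> a" "a < DIM('a)"
  shows "integrable lborel (\<lambda>y::'a::euclidean_space. indicator (cball 0 1) y * norm y powr (- a))"
proof (rule integrableI_bounded)
  let ?d = "DIM('a)" and ?v = "unit_ball_vol (real DIM('a))"
  define r where "r j = (1/2::real) ^ j" for j
  define q where "q = 2 powr (a - ?d)"
  have q: "0 < q" "q < 1" using a powr_less_mono[of "a - ?d" 0 2] by (auto simp: q_def)
  have coeff: "r (Suc j) powr (- a) * (?v * r j ^ ?d) = (?v * 2 powr a) * q ^ j" for j
  proof -
    have "r (Suc j) = 2 powr (- real (Suc j))"
      by (simp only: r_def powr_minus powr_realpow) (simp add: power_one_over inverse_eq_divide)
    then have "r (Suc j) powr (- a) = 2 powr (a * Suc j)"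
      by (simp only: powr_powr) (simp add: algebra_simps)
    moreover have "r j ^ ?d = 2 powr (- (real ?d) * j)"
      by (simp add: r_def powr_minus powr_powr power_divide field_simps flip: powr_realpow power_mult)
    moreover have "q ^ j = 2 powr ((a - ?d) * j)"
      by (simp add: q_def powr_powr flip: powr_realpow)
    ultimately show ?thesis
      by (simp add: powr_add[symmetric] algebra_simps)
  qed
  have bd: "ennreal (norm (indicator (cball 0 1) y * norm y powr (- a)))
      \<le> (\<Sum>j. ennreal (r (Suc j) powr (- a)) * indicator (cball 0 (r j)) y)" for y :: 'a
  proof (cases "y = 0 \<or> norm y > 1")
    case True
    then show ?thesis by auto
  next
    case False
    then have y: "norm y \<le> 1" "norm y > 0" by auto
    define n where "n = (LEAST n. (1/2) ^ n < norm y)"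
    have n: "(1/2) ^ n < norm y"
      unfolding n_def by (rule LeastI_ex) (use real_arch_pow_inv[OF y(2), of "1/2"] in simp)
    have "n \<noteq> 0" using n y by (metis not_le power_0)
    then obtain j where j: "n = Suc j" by (cases n) auto
    have "\<not> (1/2) ^ j < norm y" using not_less_Least[of j "\<lambda>n. (1/2) ^ n < norm y"] j n_def by auto
    then have yj: "y \<in> cball 0 (r j)" by (simp add: r_def)
    have "norm y powr (- a) \<le> r (Suc j) powr (- a)"
      using n j a y by (intro powr_mono2') (auto simp: r_def)
    then have "ennreal (norm (indicator (cball 0 1) y * norm y powr (- a)))
       \<le> ennreal (r (Suc j) powr (- a)) * indicator (cball 0 (r j)) y"
      using y yj by (auto intro!: ennreal_leI)
    also have "\<dots> \<le> (\<Sum>j. ennreal (r (Suc j) powr (- a)) * indicator (cball 0 (r j)) y)"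
      using sum_le_suminf[OF summableI, of "{j}" "\<lambda>j. ennreal (r (Suc j) powr (- a)) * indicator (cball 0 (r j)) y"]
      by (simp del: sum_mult_indicator)
    finally show ?thesis .
  qed
  have "(\<integral>\<^sup>+ y. ennreal (norm (indicator (cball 0 1) y * norm y powr (- a))) \<partial>(lborel::'a measure))
     \<le> (\<integral>\<^sup>+ y. (\<Sum>j. ennreal (r (Suc j) powr (- a)) * indicator (cball 0 (r j)) y) \<partial>(lborel::'a measure))"
    by (rule nn_integral_mono) (rule bd)
  also have "\<dots> = (\<Sum>j. \<integral>\<^sup>+ y. ennreal (r (Suc j) powr (- a)) * indicator (cball 0 (r j)) y \<partial>(lborel::'a measure))"
    by (rule nn_integral_suminf, intro borel_measurable_times_ennreal borel_measurable_const borel_measurable_indicator) simp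
  also have "\<dots> = (\<Sum>j. ennreal (r (Suc j) powr (- a) * (?v * r j ^ ?d)))"
  proof -
    have "(\<integral>\<^sup>+ y. ennreal (r (Suc j) powr (- a)) * indicator (cball 0 (r j)) y \<partial>(lborel::'a measure))
        = ennreal (r (Suc j) powr (- a) * (?v * r j ^ ?d))" for j
    proof -
      have "0 \<le> r j" by (simp add: r_def)
      then show ?thesis
        by (subst nn_integral_cmult_indicator) (simp_all add: emeasure_cball ennreal_mult')
    qed
    then show ?thesis by simp
  qed
  also have "\<dots> = (\<Sum>j. ennreal ((?v * 2 powr a) * q ^ j))"
    by (simp only: coeff)
  also have "\<dots> = ennreal (\<Sum>j. (?v * 2 powr a) * q ^ j)"
    using q by (intro suminf_ennreal2) (auto intro!: mult_nonneg_nonneg summable_mult summable_geometric)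
  also have "\<dots> < \<infinity>" by simp
  finally show "(\<integral>\<^sup>+ y. ennreal (norm (indicator (cball 0 1) y * norm y powr (- a))) \<partial>(lborel::'a measure)) < \<infinity>" .
  have "(\<lambda>y::'a. norm y powr (- a)) \<in> borel_measurable lborel"
    by (intro powr_real_measurable borel_measurable_const) simp
  then show "(\<lambda>y::'a. indicator (cball 0 1) y * norm y powr (- a)) \<in> borel_measurable lborel"
    by (intro borel_measurable_times borel_measurable_indicator) auto
qed

text \<open>A bound for the integral of |y|^(-a) over the ball of radius \<open>R\<close> about any
  centre: inside the unit ball the full integral is taken, outside it the weight is at most 1.
  Independence of the centre makes the convolution bounds uniform in space.\<close>

definition ball_weight :: "'a::euclidean_space itself \<Rightarrow> real \<Rightarrow> real \<Rightarrow> real" where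
  "ball_weight _ a R = (LINT y|(lborel::'a measure). indicator (cball 0 1) y * norm y powr (- a))
     + measure lborel (cball (0::'a) R)"

lemma measure_cball_translate: "measure lborel (cball (x::'a::euclidean_space) R) = measure lborel (cball (0::'a) R)"
proof (cases "R \<ge> 0")
  case True
  then show ?thesis by (simp add: measure_def emeasure_cball)
qed simp

lemma ball_weight_bound:
  fixes x :: "'a::euclidean_space" and a :: real
  assumes a: "0 \<le> a" "a < DIM('a)"
  shows "integrable lborel (\<lambda>y. indicator (cball x R) y * norm y powr (- a))"
    and "(LINT y|lborel. indicator (cball x R) y * norm y powr (- a)) \<le> ball_weight TYPE('a) a R"
proof -
  have bd: "indicator (cball x R) y * norm y powr (- a)
     \<le> indicator (cball 0 1) y * norm y powr (- a) + indicator (cball x R) y" for y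
  proof (cases "norm y \<le> 1")
    case False
    then have "norm y powr (- a) \<le> 1" using a powr_mono[of "- a" 0 "norm y"] by (auto split: if_splits)
    then show ?thesis by (auto simp: indicator_def)
  qed (auto simp: indicator_def)
  have i: "integrable lborel (\<lambda>y. indicator (cball 0 1) y * norm y powr (- a) + indicator (cball x R) y)"
    using ball_power_integrable[OF a] integrable_cball_indicator by (rule Bochner_Integration.integrable_add)
  show w: "integrable lborel (\<lambda>y. indicator (cball x R) y * norm y powr (- a))"
    by (rule Bochner_Integration.integrable_bound[OF i]) (use bd in \<open>auto simp: indicator_def\<close>)
  have "(LINT y|lborel. indicator (cball x R) y * norm y powr (- a))
     \<le> (LINT y|lborel. indicator (cball 0 1) y * norm y powr (- a) + indicator (cball x R) y)"
    by (rule integral_mono[OF w i bd])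
  also have "\<dots> = ball_weight TYPE('a) a R"
    using ball_power_integrable[OF a] integrable_cball_indicator[of x R]
    by (subst Bochner_Integration.integral_add) (auto simp: ball_weight_def measure_cball_translate[of x])
  finally show "(LINT y|lborel. indicator (cball x R) y * norm y powr (- a)) \<le> ball_weight TYPE('a) a R" .
qed

lemma ball_weight_nonneg:
  "0 \<le> ball_weight TYPE('a::euclidean_space) a R"
  unfolding ball_weight_def by (intro add_nonneg_nonneg integral_nonneg_AE) auto

lemma weight_dominated:
  fixes g :: "'a::euclidean_space \<Rightarrow> 'b::{banach, second_countable_topology}" and a :: real
  assumes a: "0 \<le> a" "a < DIM('a)" and g: "g \<in> borel_measurable borel" and B: "0 \<le> B"
    and bd: "\<And>y. norm (g y) \<le> B * (indicator (cball x R) y * norm y powr (- a))"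
  shows "integrable lborel g" "norm (LINT y|lborel. g y) \<le> B * ball_weight TYPE('a) a R"
proof -
  have i: "integrable lborel (\<lambda>y. B * (indicator (cball x R) y * norm y powr (- a)))"
    using ball_weight_bound[OF a] by (intro integrable_mult_right)
  show gi: "integrable lborel g"
    by (rule Bochner_Integration.integrable_bound[OF i]) (use g order_trans[OF bd abs_ge_self] in \<open>auto simp del: abs_mult\<close>)
  have "norm (LINT y|lborel. g y) \<le> (LINT y|lborel. B * (indicator (cball x R) y * norm y powr (- a)))"
    by (rule Bochner_Integration.integral_norm_bound_integral[OF gi i bd])
  also have "\<dots> \<le> B * ball_weight TYPE('a) a R"
    using ball_weight_bound(2)[OF a, of x R] B by (simp add: mult_left_mono)
  finally show "norm (LINT y|lborel. g y) \<le> B * ball_weight TYPE('a) a R" .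
qed

subsection \<open>Convolution with a singular kernel\<close>

text \<open>The translation acts on the density, so that an \<open>x\<close>-derivative falls on
  \<open>f\<close> and leaves the singular factor \<open>q\<close> alone;
  \<open>conv_commute\<close> moves it to the kernel.\<close>

definition conv :: "('a::euclidean_space \<Rightarrow> real) \<Rightarrow> ('a \<Rightarrow> 'b::euclidean_space) \<Rightarrow> 'a \<Rightarrow> 'b" where
  "conv f q x = (LINT y|lborel. f (x - y) *\<^sub>R q y)"

lemma conv_commute: "conv f q x = (LINT y|lborel. f y *\<^sub>R q (x - y))"
  unfolding conv_def using lborel_integral_reflect[of "\<lambda>y. f (x - y) *\<^sub>R q y" x] by simp

lemma conv_bound:
  fixes q :: "'a::euclidean_space \<Rightarrow> 'b::euclidean_space" and a b :: real
  assumes a: "0 \<le> a" "a < DIM('a)"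
    and q: "q \<in> borel_measurable borel" "\<And>y. norm (q y) \<le> C * norm y powr (- a)" "0 \<le> C"
    and f: "f \<in> borel_measurable borel" "\<And>y. \<bar>f y\<bar> \<le> M" "\<And>y. R < norm y \<Longrightarrow> f y = 0"
  shows "integrable lborel (\<lambda>y. f (x - y) *\<^sub>R q y)"
    "norm (conv f q x) \<le> M * C * ball_weight TYPE('a) a R"
proof -
  have M: "0 \<le> M" using f(2)[of 0] by simp
  note [measurable] = q(1) f(1)
  have bd: "norm (f (x - y) *\<^sub>R q y) \<le> (M * C) * (indicator (cball x R) y * norm y powr (- a))" for y
  proof (cases "norm (x - y) \<le> R")
    case True
    then have "norm (f (x - y) *\<^sub>R q y) \<le> M * (C * norm y powr (- a))"
      using mult_mono[OF f(2)[of "x - y"] q(2)[of y]] M by simp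
    then show ?thesis using True by (simp add: dist_norm mult_ac)
  qed (use f(3)[of "x - y"] in \<open>simp add: dist_norm\<close>)
  show "integrable lborel (\<lambda>y. f (x - y) *\<^sub>R q y)"
    by (rule weight_dominated[OF a _ _ bd]) (use M q(3) in auto)
  show "norm (conv f q x) \<le> M * C * ball_weight TYPE('a) a R"
    unfolding conv_def by (rule weight_dominated[OF a _ _ bd]) (use M q(3) in auto)
qed

text \<open>The increment falls on the kernel, so a bounded \<open>f\<close> already gives a Hoelder
  continuous convolution. Each of the two weights is brought to the form of
  \<open>ball_weight\<close> by reflection.\<close>

lemma conv_holder_kernel:
  fixes q :: "'a::euclidean_space \<Rightarrow> 'b::euclidean_space" and a b :: real
  assumes a: "0 \<le> a" "a < DIM('a)" and b: "0 \<le> b" "b < DIM('a)"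
    and q: "q \<in> borel_measurable borel" "\<And>y. norm (q y) \<le> C * norm y powr (- b)" "0 \<le> C"
    and hol: "\<And>y z. norm (q y - q z) \<le> C * norm (y - z) powr \<beta> * (norm y powr (- a) + norm z powr (- a))"
    and f: "f \<in> borel_measurable borel" "\<And>y. \<bar>f y\<bar> \<le> M" "\<And>y. R < norm y \<Longrightarrow> f y = 0"
  shows "norm (conv f q x - conv f q x') \<le> 2 * M * C * ball_weight TYPE('a) a R * norm (x - x') powr \<beta>"
proof -
  have M: "0 \<le> M" using f(2)[of 0] by simp
  note [measurable] = q(1) f(1)
  let ?B = "M * C * norm (x - x') powr \<beta>"
  let ?w = "\<lambda>(x::'a) y. indicator (cball 0 R) y * norm (x - y) powr (- a)"
  have wr: "(\<lambda>z. ?w x (x - z)) = (\<lambda>z. indicator (cball x R) z * norm z powr (- a))" for x :: 'a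
    by (rule ext) (simp add: indicator_def dist_norm norm_minus_commute[of x])
  have w: "integrable lborel (?w x)" "(LINT y|lborel. ?w x y) \<le> ball_weight TYPE('a) a R" for x :: 'a
  proof -
    have "integrable lborel (\<lambda>z. ?w x (x - z))"
      unfolding wr by (rule ball_weight_bound(1)[OF a])
    from lborel_integrable_reflect[OF this, where x = x] show "integrable lborel (?w x)" by simp
    have "(LINT y|lborel. ?w x y) = (LINT z|lborel. ?w x (x - z))"
      by (rule lborel_integral_reflect[symmetric])
    also have "\<dots> = (LINT z|lborel. indicator (cball x R) z * norm z powr (- a))"
      by (rule arg_cong[OF wr, where f = "integral\<^sup>L lborel"])
    also have "\<dots> \<le> ball_weight TYPE('a) a R"
      by (rule ball_weight_bound(2)[OF a])
    finally show "(LINT y|lborel. ?w x y) \<le> ball_weight TYPE('a) a R" .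
  qed
  have int: "integrable lborel (\<lambda>y. f y *\<^sub>R q (x - y))" for x :: 'a
    using lborel_integrable_reflect[OF conv_bound(1)[OF b q f, where x = x], where x = x] by simp
  have bd: "norm (f y *\<^sub>R q (x - y) - f y *\<^sub>R q (x' - y)) \<le> ?B * (?w x y + ?w x' y)" for y
  proof (cases "norm y \<le> R")
    case True
    have "norm (f y *\<^sub>R (q (x - y) - q (x' - y)))
      \<le> M * (C * norm (x - x') powr \<beta> * (norm (x - y) powr (- a) + norm (x' - y) powr (- a)))"
      using mult_mono[OF f(2)[of y] hol[of "x - y" "x' - y"]] M by simp
    then show ?thesis using True by (simp add: scaleR_diff_right mult_ac)
  qed (use f(3) in simp)
  have i: "integrable lborel (\<lambda>y. ?B * (?w x y + ?w x' y))"
    using w by (intro integrable_mult_right Bochner_Integration.integrable_add)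
  have "norm (conv f q x - conv f q x') = norm (LINT y|lborel. f y *\<^sub>R q (x - y) - f y *\<^sub>R q (x' - y))"
    unfolding conv_commute by (subst Bochner_Integration.integral_diff) (use int in auto)
  also have "\<dots> \<le> (LINT y|lborel. ?B * (?w x y + ?w x' y))"
    by (rule Bochner_Integration.integral_norm_bound_integral[OF _ i bd]) (use int in auto)
  also have "\<dots> = ?B * ((LINT y|lborel. ?w x y) + (LINT y|lborel. ?w x' y))"
    using w by simp
  also have "\<dots> \<le> ?B * (ball_weight TYPE('a) a R + ball_weight TYPE('a) a R)"
    using w(2) M q(3) by (intro mult_left_mono add_mono) auto
  finally show ?thesis by (simp add: algebra_simps)
qed

text \<open>The counterpart of \<open>conv_holder_kernel\<close>: the increment falls on the
  density, and only the size of the kernel enters.\<close>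

lemma conv_holder_density:
  fixes q :: "'a::euclidean_space \<Rightarrow> 'b::euclidean_space" and a b :: real
  assumes a: "0 \<le> a" "a < DIM('a)"
    and q: "q \<in> borel_measurable borel" "\<And>y. norm (q y) \<le> C * norm y powr (- a)" "0 \<le> C"
    and f: "f \<in> borel_measurable borel" "\<And>y. \<bar>f y\<bar> \<le> M" "\<And>y. R < norm y \<Longrightarrow> f y = 0"
    and hol: "\<And>y z. \<bar>f y - f z\<bar> \<le> H * norm (y - z) powr \<beta>" and H: "0 \<le> H"
  shows "norm (conv f q x - conv f q x') \<le> 2 * H * C * ball_weight TYPE('a) a R * norm (x - x') powr \<beta>"
proof -
  let ?B = "H * C * norm (x - x') powr \<beta>"
  let ?w = "\<lambda>x y. indicator (cball x R) y * norm y powr (- a)"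
  note int = conv_bound(1)[OF a q f]
  note w = ball_weight_bound[OF a, of _ R]
  have bd: "norm (f (x - y) *\<^sub>R q y - f (x' - y) *\<^sub>R q y) \<le> ?B * (?w x y + ?w x' y)" for y
  proof (cases "norm (x - y) \<le> R \<or> norm (x' - y) \<le> R")
    case True
    have "norm ((f (x - y) - f (x' - y)) *\<^sub>R q y) \<le> (H * norm (x - x') powr \<beta>) * (C * norm y powr (- a))"
      using mult_mono[OF hol[of "x - y" "x' - y"] q(2)[of y]] H by simp
    also have "\<dots> = ?B * norm y powr (- a)" by simp
    also have "\<dots> \<le> ?B * (?w x y + ?w x' y)"
      using True H q(3) by (intro mult_left_mono) (auto simp: dist_norm)
    finally show ?thesis by (simp add: scaleR_diff_left)
  qed (use f(3)[of "x - y"] f(3)[of "x' - y"] in \<open>simp add: dist_norm\<close>)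
  have i: "integrable lborel (\<lambda>y. ?B * (?w x y + ?w x' y))"
    using w by (intro integrable_mult_right Bochner_Integration.integrable_add)
  have "norm (conv f q x - conv f q x') = norm (LINT y|lborel. f (x - y) *\<^sub>R q y - f (x' - y) *\<^sub>R q y)"
    unfolding conv_def by (subst Bochner_Integration.integral_diff) (use int in auto)
  also have "\<dots> \<le> (LINT y|lborel. ?B * (?w x y + ?w x' y))"
    by (rule Bochner_Integration.integral_norm_bound_integral[OF _ i bd]) (use int in auto)
  also have "\<dots> = ?B * ((LINT y|lborel. ?w x y) + (LINT y|lborel. ?w x' y))"
    using w by simp
  also have "\<dots> \<le> ?B * (ball_weight TYPE('a) a R + ball_weight TYPE('a) a R)"
    using w(2) H q(3) by (intro mult_left_mono add_mono) auto
  finally show ?thesis by (simp add: algebra_simps)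
qed

lemma gradient_outside_support:
  fixes f :: "'a::euclidean_space \<Rightarrow> real"
  assumes "\<And>y. R < norm y \<Longrightarrow> f y = 0" "R < norm x"
  shows "gradient f x = 0"
proof (rule gradient_eqI)
  have "((\<lambda>_. 0) has_derivative (\<lambda>v. 0 \<bullet> v)) (at x)" by simp
  then show "(f has_derivative (\<lambda>v. 0 \<bullet> v)) (at x)"
  proof (rule has_derivative_transform_within_open)
    show "open {y. R < norm y}" by (intro open_Collect_less continuous_intros)
  qed (use assms in auto)
qed

text \<open>The error of the first-order expansion is the convolution of \<open>q\<close> with the
  Taylor remainder of \<open>f\<close>, which is uniformly of order 1 + beta; for |v| \<le> 1 it is
  supported in the ball of radius |R| + 1.\<close>

lemma conv_has_derivative:
  fixes q :: "'a::euclidean_space \<Rightarrow> 'b::euclidean_space" and a b :: real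
  assumes a: "0 \<le> a" "a < DIM('a)"
    and q: "q \<in> borel_measurable borel" "\<And>y. norm (q y) \<le> C * norm y powr (- a)" "0 \<le> C"
    and f: "C1b \<beta> M f" "\<And>y. R < norm y \<Longrightarrow> f y = 0" and \<beta>: "0 < \<beta>"
  shows "(conv f q has_derivative (\<lambda>v. conv (\<lambda>z. gradient f z \<bullet> v) q x)) (at x)"
proof -
  have [measurable]: "q \<in> borel_measurable borel" "f \<in> borel_measurable borel" "gradient f \<in> borel_measurable borel"
    using q(1) C1b_continuous[OF f(1)] C1b_continuous_gradient[OF f(1) \<beta>]
    by (auto intro: borel_measurable_continuous_onI)
  have M: "0 \<le> M" using C1b_nonneg f by blast
  have gbd: "\<bar>gradient f z \<bullet> v\<bar> \<le> M * norm v" for z v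
    using Cauchy_Schwarz_ineq2[of "gradient f z" v] C1bD(3)[OF f(1), of z]
    by (meson mult_right_mono norm_ge_zero order_trans)
  have gs: "gradient f z \<bullet> v = 0" if "R < norm z" for z v
    using gradient_outside_support[of R f] f(2) that by simp
  note fint = conv_bound(1)[OF a q _ C1bD(2)[OF f(1)] f(2)]
  note gint = conv_bound(1)[OF a q _ gbd gs]
  have fi: "integrable lborel (\<lambda>y. f (x - y) *\<^sub>R q y)" for x by (rule fint) auto
  have gi: "integrable lborel (\<lambda>y. (gradient f (x - y) \<bullet> v) *\<^sub>R q y)" for x v by (rule gint) auto
  let ?D = "\<lambda>v. conv (\<lambda>z. gradient f z \<bullet> v) q x"
  have Dbd: "norm (?D v) \<le> norm v * (M * C * ball_weight TYPE('a) a R)" for v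
    by (rule order_trans[OF conv_bound(2)[OF a q _ gbd gs]]) (auto simp: mult_ac)
  have "bounded_linear ?D"
  proof (rule bounded_linear_intro)
    show "?D (v + w) = ?D v + ?D w" for v w
      unfolding conv_def using gi by (simp add: inner_add_right scaleR_add_left)
    show "?D (r *\<^sub>R v) = r *\<^sub>R ?D v" for r v
      unfolding conv_def by (simp flip: scaleR_scaleR)
  qed (rule Dbd)
  then show ?thesis
  proof (rule has_derivative_superlinear[OF _ \<beta> zero_less_one])
    fix v :: 'a assume v: "norm v \<le> 1"
    let ?g = "\<lambda>z. f (z + v) - f z - gradient f z \<bullet> v"
    have "conv f q (x + v) - conv f q x - ?D v = conv ?g q x"
      unfolding conv_def using fi[of x] fi[of "x + v"] gi[of x v]
      by (simp add: scaleR_diff_left add_diff_eq[symmetric] add.commute[of x] diff_add_eq)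
    moreover have "norm (conv ?g q x) \<le> (M * norm v powr (1 + \<beta>)) * C * ball_weight TYPE('a) a (\<bar>R\<bar> + 1)"
    proof (rule conv_bound(2)[OF a q])
      show "\<bar>?g y\<bar> \<le> M * norm v powr (1 + \<beta>)" for y
        by (rule C1b_taylor[OF f(1) \<beta>])
      show "?g y = 0" if "\<bar>R\<bar> + 1 < norm y" for y
      proof -
        have "R < norm (y + v)" using norm_diff_ineq[of y v] v that by linarith
        then show ?thesis using f(2) gs that by simp
      qed
    qed auto
    ultimately show "norm (conv f q (x + v) - conv f q x - ?D v)
      \<le> (M * C * ball_weight TYPE('a) a (\<bar>R\<bar> + 1)) * norm v powr (1 + \<beta>)"
      by (simp add: mult_ac)
  qed
qed

subsection \<open>Radial kernels\<close>

text \<open>\<open>m\<close> is the divergence of \<open>k\<close> away from the origin and \<open>c\<close> the strength of its point mass at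
  the origin.\<close>

definition admissible ::
    "real \<Rightarrow> real \<Rightarrow> ('a::euclidean_space \<Rightarrow> 'a) \<Rightarrow> ('a \<Rightarrow> real) \<Rightarrow> real \<Rightarrow> bool" where
  "admissible C \<beta> k m c \<longleftrightarrow>
     k \<in> borel_measurable borel \<and> m \<in> borel_measurable borel \<and>
     (\<forall>x. norm (k x) \<le> C * norm x powr (- (real DIM('a) - 1))) \<and>
     (\<forall>x. \<bar>m x\<bar> \<le> C * norm x powr (- (real DIM('a) - 1))) \<and>
     (\<forall>x y. norm (k x - k y) \<le> C * norm (x - y) powr \<beta> *
        (norm x powr (- (real DIM('a) - 1 + \<beta>)) + norm y powr (- (real DIM('a) - 1 + \<beta>)))) \<and>
     \<bar>c\<bar> \<le> C \<and>
     (\<forall>\<gamma> M R f x. 0 < \<gamma> \<longrightarrow> C1b \<gamma> M f \<longrightarrow> (\<forall>y. R < norm y \<longrightarrow> f y = 0) \<longrightarrow>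
        (LINT y|lborel. gradient f (x - y) \<bullet> k y) = c * f x + conv f m x)"

text \<open>The divergence of \<open>G (norm x) *\<^sub>R x\<close>. The value 0 at the origin
  agrees with \<open>0 powr p = 0\<close>, so that the size bound holds there too.\<close>

definition radial_div :: "'a::euclidean_space itself \<Rightarrow> (real \<Rightarrow> real) \<Rightarrow> (real \<Rightarrow> real) \<Rightarrow> 'a \<Rightarrow> real" where
  "radial_div _ G G' x = (if x = 0 then 0 else real DIM('a) * G (norm x) + norm x * G' (norm x))"

text \<open>The bound \<open>div\<close> is one power better than what \<open>G\<close> and
  \<open>G'\<close> give separately. This cancellation expresses the equation of the kernel off the
  origin, and it leaves a divergence no more singular than the field itself.\<close>

locale radial_kernel =
  fixes G G' :: "real \<Rightarrow> real" and C :: real and T :: "'a::euclidean_space itself"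
  assumes C: "0 \<le> C"
    and der: "\<And>r. 0 < r \<Longrightarrow> (G has_real_derivative G' r) (at r)"
    and contG': "continuous_on {0<..} G'"
    and G: "\<And>r. 0 < r \<Longrightarrow> \<bar>G r\<bar> \<le> C * r powr (- real DIM('a))"
    and G': "\<And>r. 0 < r \<Longrightarrow> \<bar>G' r\<bar> \<le> C * r powr (- real DIM('a) - 1)"
    and div: "\<And>r. 0 < r \<Longrightarrow> \<bar>real DIM('a) * G r + r * G' r\<bar> \<le> C * r powr (1 - real DIM('a))"
begin

abbreviation k :: "'a \<Rightarrow> 'a" where "k x \<equiv> G (norm x) *\<^sub>R x"
abbreviation m :: "'a \<Rightarrow> real" where "m \<equiv> radial_div TYPE('a) G G'"

lemma contG: "continuous_on {0<..} G"
  by (meson DERIV_isCont continuous_at_imp_continuous_on der greaterThan_iff)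

lemma radial_measurable:
  fixes H :: "real \<Rightarrow> real"
  assumes "continuous_on {0<..} H"
  shows "(\<lambda>x::'a. if x = 0 then 0 else H (norm x)) \<in> borel_measurable borel"
proof -
  have "continuous_on (- {0::'a}) (\<lambda>x. H (norm x))"
    by (rule continuous_on_compose2[OF assms]) (auto intro: continuous_intros)
  then have "(\<lambda>x. indicator (- {0::'a}) x *\<^sub>R H (norm x)) \<in> borel_measurable borel"
    by (intro borel_measurable_continuous_on_indicator) auto
  then show ?thesis
    by (rule measurable_cong[THEN iffD1, rotated]) (auto simp: indicator_def)
qed

lemma k_measurable: "k \<in> borel_measurable borel"
proof -
  have "(\<lambda>x::'a. (if x = 0 then 0 else G (norm x)) *\<^sub>R x) \<in> borel_measurable borel"
    using radial_measurable[OF contG] by measurable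
  then show ?thesis
    by (rule measurable_cong[THEN iffD1, rotated]) auto
qed

lemma m_measurable: "m \<in> borel_measurable borel"
proof -
  have "continuous_on {0<..} (\<lambda>r. real DIM('a) * G r + r * G' r)"
    using contG contG' by (intro continuous_intros)
  from radial_measurable[OF this] show ?thesis
    by (rule measurable_cong[THEN iffD1, rotated]) (auto simp: radial_div_def)
qed

lemma k_bound: "norm (k x) \<le> C * norm x powr (- (real DIM('a) - 1))"
proof (cases "x = 0")
  case False
  have "norm (k x) \<le> C * norm x powr (- real DIM('a)) * norm x"
    using mult_right_mono[OF G[of "norm x"], of "norm x"] False by simp
  also have "\<dots> = C * (norm x powr (- real DIM('a)) * norm x powr 1)"
    using False by simp
  also have "\<dots> = C * norm x powr (- real DIM('a) + 1)"
    by (simp only: powr_add)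
  finally show ?thesis by (simp add: add.commute)
qed simp

lemma m_bound: "\<bar>m x\<bar> \<le> C * norm x powr (- (real DIM('a) - 1))"
  using div[of "norm x"] by (auto simp: radial_div_def)

lemma G_norm_has_derivative:
  fixes z :: 'a
  assumes "z \<noteq> 0"
  shows "((\<lambda>z. G (norm z)) has_derivative (\<lambda>h. G' (norm z) * ((z \<bullet> h) / norm z))) (at z)"
proof -
  have "(norm has_derivative (\<lambda>h. (z \<bullet> h) / norm z)) (at z)"
    using has_derivative_norm[OF assms] by (simp add: sgn_div_norm inner_commute divide_inverse mult.commute)
  then show ?thesis
    by (rule has_derivative_compose[where f = norm and g = G])
      (use der[of "norm z"] assms in \<open>simp add: has_field_derivative_def\<close>)
qed

lemma k_has_derivative:
  fixes z :: 'a
  assumes "z \<noteq> 0"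
  shows "(k has_derivative (\<lambda>h. G (norm z) *\<^sub>R h + (G' (norm z) * ((z \<bullet> h) / norm z)) *\<^sub>R z)) (at z)"
  by (rule has_derivative_scaleR[OF G_norm_has_derivative[OF assms] has_derivative_ident])

lemma k_derivative_bound:
  fixes z :: 'a
  assumes "z \<noteq> 0"
  shows "norm (G (norm z) *\<^sub>R h + (G' (norm z) * ((z \<bullet> h) / norm z)) *\<^sub>R z)
    \<le> 2 * C * norm z powr (- real DIM('a)) * norm h"
proof -
  have z: "norm z > 0" using assms by simp
  have 1: "norm (G (norm z) *\<^sub>R h) \<le> C * norm z powr (- real DIM('a)) * norm h"
    using mult_right_mono[OF G[OF z], of "norm h"] by simp
  have "norm ((G' (norm z) * ((z \<bullet> h) / norm z)) *\<^sub>R z) = \<bar>G' (norm z)\<bar> * \<bar>z \<bullet> h\<bar>"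
    using z by (simp add: abs_mult)
  also have "\<dots> \<le> (C * norm z powr (- real DIM('a) - 1)) * (norm z * norm h)"
    by (intro mult_mono G'[OF z] Cauchy_Schwarz_ineq2) (use C in auto)
  also have "\<dots> = C * norm z powr (- real DIM('a)) * norm h"
    using z by (simp add: powr_diff)
  finally have 2: "norm ((G' (norm z) * ((z \<bullet> h) / norm z)) *\<^sub>R z) \<le> C * norm z powr (- real DIM('a)) * norm h" .
  show ?thesis using norm_triangle_mono[OF 1 2] by (simp add: mult_ac)
qed

text \<open>All points of the ball of radius |x|/2 about x have norm at least |x|/2, so the mean
  value inequality applies away from the singularity.\<close>

lemma k_diff_near:
  fixes x y :: 'a
  assumes "x \<noteq> 0" "norm (x - y) \<le> norm x / 2"
  shows "norm (k x - k y) \<le> 2 * C * 2 powr DIM('a) * norm x powr (- real DIM('a)) * norm (x - y)"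
proof -
  let ?S = "cball x (norm x / 2)"
  have z: "norm z \<ge> norm x / 2" "z \<noteq> 0" if "z \<in> ?S" for z
  proof -
    have "norm x \<le> norm z + norm (x - z)" using norm_triangle_sub by blast
    then show "norm z \<ge> norm x / 2" using that by (simp add: dist_norm)
    then show "z \<noteq> 0" using assms by auto
  qed
  show ?thesis
  proof (rule differentiable_bound[of ?S])
    show "(k has_derivative (\<lambda>h. G (norm z) *\<^sub>R h + (G' (norm z) * ((z \<bullet> h) / norm z)) *\<^sub>R z)) (at z within ?S)"
      if "z \<in> ?S" for z
      by (rule has_derivative_at_withinI[OF k_has_derivative[OF z(2)[OF that]]])
    show "onorm (\<lambda>h. G (norm z) *\<^sub>R h + (G' (norm z) * ((z \<bullet> h) / norm z)) *\<^sub>R z)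
      \<le> 2 * C * 2 powr DIM('a) * norm x powr (- real DIM('a))" if "z \<in> ?S" for z
    proof (rule onorm_le)
      fix h :: 'a
      have "norm z powr (- real DIM('a)) \<le> (norm x / 2) powr (- real DIM('a))"
        using z[OF that] assms by (intro powr_mono2') auto
      also have "\<dots> = 2 powr DIM('a) * norm x powr (- real DIM('a))"
        by (simp add: powr_divide powr_minus field_simps)
      finally have "2 * C * norm z powr (- real DIM('a)) * norm h \<le> 2 * C * (2 powr DIM('a) * norm x powr (- real DIM('a))) * norm h"
        using C by (intro mult_right_mono mult_left_mono) auto
      then show "norm (G (norm z) *\<^sub>R h + (G' (norm z) * ((z \<bullet> h) / norm z)) *\<^sub>R z)
         \<le> 2 * C * 2 powr DIM('a) * norm x powr (- real DIM('a)) * norm h"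
        using k_derivative_bound[OF z(2)[OF that], of h] by (simp add: mult.assoc)
    qed
  qed (use assms in \<open>auto simp: dist_norm\<close>)
qed

lemma k_diff_near_powr:
  fixes x y :: 'a
  assumes \<beta>: "0 < \<beta>" "\<beta> < 1" and xy: "x \<noteq> 0" "norm (x - y) \<le> norm x / 2"
  shows "norm (k x - k y) \<le> 2 * C * 2 powr DIM('a) * norm (x - y) powr \<beta> * norm x powr (- (real DIM('a) - 1 + \<beta>))"
proof -
  have "norm (x - y) \<le> norm x" using xy norm_ge_zero[of "x - y"] by linarith
  have "norm (x - y) = norm (x - y) powr \<beta> * norm (x - y) powr (1 - \<beta>)"
    by (cases "x = y") (auto simp flip: powr_add)
  also have "\<dots> \<le> norm (x - y) powr \<beta> * norm x powr (1 - \<beta>)"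
    using \<beta> \<open>norm (x - y) \<le> norm x\<close> by (intro mult_left_mono powr_mono2) auto
  finally have "norm x powr (- real DIM('a)) * norm (x - y)
     \<le> norm x powr (- real DIM('a)) * (norm (x - y) powr \<beta> * norm x powr (1 - \<beta>))"
    by (intro mult_left_mono) auto
  also have "\<dots> = norm (x - y) powr \<beta> * norm x powr (- (real DIM('a) - 1 + \<beta>))"
    by (simp add: powr_add[symmetric] algebra_simps)
  finally have "2 * C * 2 powr DIM('a) * (norm x powr (- real DIM('a)) * norm (x - y))
    \<le> 2 * C * 2 powr DIM('a) * (norm (x - y) powr \<beta> * norm x powr (- (real DIM('a) - 1 + \<beta>)))"
    using C by (intro mult_left_mono) auto
  then show ?thesis using k_diff_near[OF xy] by (simp add: mult.assoc)
qed

lemma k_bound_powr: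
  fixes x :: 'a
  assumes \<beta>: "0 < \<beta>" "\<beta> < 1" and "norm x / 2 \<le> s"
  shows "norm (k x) \<le> 2 * C * 2 powr DIM('a) * s powr \<beta> * norm x powr (- (real DIM('a) - 1 + \<beta>))"
proof (cases "x = 0")
  case False
  have "\<beta> \<le> real DIM('a)"
    using \<beta> DIM_positive[where 'a='a] by (metis Suc_leI less_le_not_le of_nat_1 of_nat_mono One_nat_def order_trans)
  have "norm x powr (- (real DIM('a) - 1)) = norm x powr \<beta> * norm x powr (- (real DIM('a) - 1 + \<beta>))"
    by (simp flip: powr_add)
  also have "\<dots> \<le> (2 * s) powr \<beta> * norm x powr (- (real DIM('a) - 1 + \<beta>))"
    using assms by (intro mult_right_mono powr_mono2) auto
  also have "\<dots> = 2 powr \<beta> * s powr \<beta> * norm x powr (- (real DIM('a) - 1 + \<beta>))"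
    by (simp add: powr_mult)
  also have "\<dots> \<le> 2 powr DIM('a) * s powr \<beta> * norm x powr (- (real DIM('a) - 1 + \<beta>))"
    using \<open>\<beta> \<le> real DIM('a)\<close> by (intro mult_right_mono powr_mono) auto
  finally have "C * norm x powr (- (real DIM('a) - 1))
     \<le> C * (2 powr DIM('a) * s powr \<beta> * norm x powr (- (real DIM('a) - 1 + \<beta>)))"
    using C by (intro mult_left_mono)
  also have "\<dots> \<le> 2 * C * (2 powr DIM('a) * s powr \<beta> * norm x powr (- (real DIM('a) - 1 + \<beta>)))"
    using C by (intro mult_right_mono) auto
  finally show ?thesis using k_bound[of x] by (simp add: mult.assoc)
qed simp

text \<open>Either the distance is at most half the norm of one point, and the mean value inequality
  gives the bound with the weight of that point, or both norms are at most twice the distance, and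
  the sizes of \<open>k x\<close> and \<open>k y\<close> alone suffice.\<close>

lemma k_holder:
  fixes x y :: 'a
  assumes \<beta>: "0 < \<beta>" "\<beta> < 1"
  shows "norm (k x - k y) \<le> (2 * C * 2 powr DIM('a)) * norm (x - y) powr \<beta> *
        (norm x powr (- (real DIM('a) - 1 + \<beta>)) + norm y powr (- (real DIM('a) - 1 + \<beta>)))"
proof -
  let ?K = "2 * C * 2 powr DIM('a) * norm (x - y) powr \<beta>" and ?e = "- (real DIM('a) - 1 + \<beta>)"
  have K: "0 \<le> ?K" using C by simp
  have nn: "0 \<le> ?K * norm x powr ?e" "0 \<le> ?K * norm y powr ?e" using C by auto
  consider "x \<noteq> 0" "norm (x - y) \<le> norm x / 2" | "y \<noteq> 0" "norm (y - x) \<le> norm y / 2"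
    | "norm x / 2 \<le> norm (x - y)" "norm y / 2 \<le> norm (x - y)"
    by (metis linear norm_minus_commute norm_zero div_0 norm_ge_zero)
  then show ?thesis
  proof cases
    case 1
    then show ?thesis using k_diff_near_powr[OF \<beta> 1] nn unfolding distrib_left by linarith
  next
    case 2
    then show ?thesis using k_diff_near_powr[OF \<beta> 2] nn
      unfolding distrib_left norm_minus_commute[of y x] norm_minus_commute[of "k y" "k x"] by linarith
  next
    case 3
    then show ?thesis
      using k_bound_powr[OF \<beta> 3(1)] k_bound_powr[OF \<beta> 3(2)] norm_triangle_ineq4[of "k x" "k y"]
      unfolding distrib_left by linarith
  qed
qed

section \<open>The divergence of a radial field across the origin\<close>

lemma G_lipschitz:
  assumes "0 < \<epsilon>" "\<epsilon> \<le> s" "\<epsilon> \<le> t"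
  shows "\<bar>G s - G t\<bar> \<le> C * \<epsilon> powr (- real DIM('a) - 1) * \<bar>s - t\<bar>"
proof -
  have "norm (G s - G t) \<le> C * \<epsilon> powr (- real DIM('a) - 1) * norm (s - t)"
  proof (rule field_differentiable_bound[of "{\<epsilon>..}"])
    show "(G has_field_derivative G' r) (at r within {\<epsilon>..})" if "r \<in> {\<epsilon>..}" for r
      using der[of r] that assms has_field_derivative_at_within by (metis atLeast_iff less_le_trans)
    show "norm (G' r) \<le> C * \<epsilon> powr (- real DIM('a) - 1)" if "r \<in> {\<epsilon>..}" for r
    proof -
      have "r powr (- real DIM('a) - 1) \<le> \<epsilon> powr (- real DIM('a) - 1)"
        using that assms by (intro powr_mono2') auto
      then show ?thesis using G'[of r] that assms C mult_left_mono[OF _ C] by (fastforce intro: order_trans)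
    qed
  qed (use assms in auto)
  then show ?thesis by simp
qed

text \<open>The first two bounds degenerate as epsilon tends to 0 and serve to make the clipped
  field Lipschitz. The third is uniform in epsilon, since the power is decreasing, and provides the
  dominating function for the limit.\<close>

lemma clipped_G:
  assumes "0 < \<epsilon>"
  shows "\<bar>G (max (norm y) \<epsilon>)\<bar> \<le> C * \<epsilon> powr (- real DIM('a))"
    and "\<bar>G (max (norm y) \<epsilon>) - G (max (norm z) \<epsilon>)\<bar> \<le> C * \<epsilon> powr (- real DIM('a) - 1) * norm (y - z)"
    and "norm (G (max (norm x) \<epsilon>) *\<^sub>R x) \<le> C * norm (x::'a) powr (- (real DIM('a) - 1))"
proof -
  have m: "\<epsilon> \<le> max (norm y) \<epsilon>" for y :: 'b by simp
  have "(max (norm y) \<epsilon>) powr (- real DIM('a)) \<le> \<epsilon> powr (- real DIM('a))"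
    using assms by (intro powr_mono2') auto
  then show "\<bar>G (max (norm y) \<epsilon>)\<bar> \<le> C * \<epsilon> powr (- real DIM('a))"
    using G[of "max (norm y) \<epsilon>"] assms C mult_left_mono[OF _ C] by (fastforce intro: order_trans)
  have "\<bar>max (norm y) \<epsilon> - max (norm z) \<epsilon>\<bar> \<le> \<bar>norm y - norm z\<bar>" by linarith
  also have "\<dots> \<le> norm (y - z)" by (rule norm_triangle_ineq3)
  finally have "\<bar>max (norm y) \<epsilon> - max (norm z) \<epsilon>\<bar> \<le> norm (y - z)" .
  then have "C * \<epsilon> powr (- real DIM('a) - 1) * \<bar>max (norm y) \<epsilon> - max (norm z) \<epsilon>\<bar>
    \<le> C * \<epsilon> powr (- real DIM('a) - 1) * norm (y - z)"
    using C by (intro mult_left_mono) auto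
  then show "\<bar>G (max (norm y) \<epsilon>) - G (max (norm z) \<epsilon>)\<bar> \<le> C * \<epsilon> powr (- real DIM('a) - 1) * norm (y - z)"
    using G_lipschitz[OF assms, of "max (norm y) \<epsilon>" "max (norm z) \<epsilon>"] by simp
  show "norm (G (max (norm x) \<epsilon>) *\<^sub>R x) \<le> C * norm x powr (- (real DIM('a) - 1))"
  proof (cases "x = 0")
    case False
    have "(max (norm x) \<epsilon>) powr (- real DIM('a)) \<le> norm x powr (- real DIM('a))"
      using False by (intro powr_mono2') auto
    then have "\<bar>G (max (norm x) \<epsilon>)\<bar> \<le> C * norm x powr (- real DIM('a))"
      using G[of "max (norm x) \<epsilon>"] assms C mult_left_mono[OF _ C] by (fastforce intro: order_trans)
    then have "norm (G (max (norm x) \<epsilon>) *\<^sub>R x) \<le> C * norm x powr (- real DIM('a)) * norm x"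
      by (simp add: mult_right_mono)
    also have "\<dots> = C * (norm x powr (- real DIM('a)) * norm x powr 1)"
      using False by simp
    also have "\<dots> = C * norm x powr (- real DIM('a) + 1)"
      by (simp only: powr_add)
    finally show ?thesis by (simp add: add.commute)
  qed simp
qed

text \<open>The divergence theorem for the Lipschitz field obtained by freezing \<open>G\<close> inside the ball of
  radius \<open>\<epsilon>\<close>; the sphere where it is not differentiable is a null set.\<close>

lemma clipped_divergence_theorem:
  fixes F :: "'a \<Rightarrow> real"
  assumes F: "C1b \<gamma> M F" "0 < \<gamma>" and supp: "\<And>y. R < norm y \<Longrightarrow> F y = 0" and \<epsilon>: "0 < \<epsilon>"
  shows "(LINT y|lborel. G (max (norm y) \<epsilon>) * (y \<bullet> gradient F y)
      + (if norm y \<le> \<epsilon> then real DIM('a) * G \<epsilon> else m y) * F y) = 0"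
proof -
  have M: "0 \<le> M" using C1b_nonneg F by blast
  have gs: "gradient F y = 0" if "R < norm y" for y
    using gradient_outside_support[of R F] supp that by simp
  \<comment> \<open>The \<open>b\<close>-th partial derivative of the \<open>b\<close>-th component
    of the field \<open>(G (max (norm y) \<epsilon>) * F y) *\<^sub>R y\<close>, valid off the
    sphere of radius epsilon.\<close>
  define D where "D b y = G (max (norm y) \<epsilon>) * (F y + (y \<bullet> b) * (gradient F y \<bullet> b))
     + (if norm y \<le> \<epsilon> then 0 else G' (norm y) * ((y \<bullet> b) / norm y) * ((y \<bullet> b) * F y))" for b y :: 'a
  have Gm[measurable]: "(\<lambda>y::'a. G (max (norm y) \<epsilon>)) \<in> borel_measurable borel"
    by (rule lipschitz_borel_measurable[of _ "C * \<epsilon> powr (- real DIM('a) - 1)"]) (use clipped_G(2)[OF \<epsilon>] in simp)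
  have G'm: "(\<lambda>y::'a. if y = 0 then 0 else G' (norm y)) \<in> borel_measurable borel"
    by (rule radial_measurable[OF contG'])
  have [measurable]: "F \<in> borel_measurable borel" "gradient F \<in> borel_measurable borel"
    using C1b_continuous[OF F(1)] C1b_continuous_gradient[OF F]
    by (auto intro: borel_measurable_continuous_onI)
  have Db: "integrable lborel (D b) \<and> (LINT y|lborel. D b y) = 0" if b: "b \<in> Basis" for b
  proof -
    define W where "W y = (y \<bullet> b) * F y" for y
    have Wder: "(W has_derivative (\<lambda>h. (F y *\<^sub>R b + (y \<bullet> b) *\<^sub>R gradient F y) \<bullet> h)) (at y)" for y
      unfolding W_def
      by (rule has_derivative_eq_rhs[OF has_derivative_mult[OF _ C1bD(5)[OF F(1)]]])
         (auto intro!: derivative_eq_intros simp: inner_add_left inner_commute algebra_simps)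
    have Wg: "gradient W y = F y *\<^sub>R b + (y \<bullet> b) *\<^sub>R gradient F y" for y
      by (rule gradient_eqI[OF Wder])
    have yb: "\<bar>y \<bullet> b\<bar> \<le> norm y" for y using b by (simp add: Basis_le_norm)
    have Wbd: "\<bar>W y\<bar> \<le> \<bar>R\<bar> * M" for y
    proof (cases "norm y \<le> R")
      case True
      have "\<bar>W y\<bar> \<le> norm y * M"
        unfolding W_def abs_mult using yb C1bD(2)[OF F(1)] by (intro mult_mono) auto
      also have "\<dots> \<le> \<bar>R\<bar> * M" using True M by (intro mult_right_mono) auto
      finally show ?thesis .
    qed (use supp M in \<open>simp add: W_def\<close>)
    have Wgb: "norm (gradient W y) \<le> M + \<bar>R\<bar> * M" for y
    proof (cases "norm y \<le> R")
      case True
      have "norm (F y *\<^sub>R b) \<le> M" using C1bD(2)[OF F(1)] b by simp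
      moreover have "norm ((y \<bullet> b) *\<^sub>R gradient F y) \<le> \<bar>R\<bar> * M"
        using True yb[of y] C1bD(3)[OF F(1), of y] by (auto intro!: mult_mono)
      ultimately show ?thesis unfolding Wg by (rule norm_triangle_mono)
    qed (use supp gs M Wg in simp)
    have Wlip: "\<bar>W y - W z\<bar> \<le> (M + \<bar>R\<bar> * M) * norm (y - z)" for y z
      using Wder Wgb by (intro bounded_gradient_lipschitz) (auto simp: differentiable_def)
    define V where "V y = G (max (norm y) \<epsilon>) * W y" for y
    define L where "L = C * \<epsilon> powr (- real DIM('a)) * (M + \<bar>R\<bar> * M) + C * \<epsilon> powr (- real DIM('a) - 1) * (\<bar>R\<bar> * M)"
    have Vlip: "norm (V y - V z) \<le> L * norm (y - z)" for y z
    proof -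
      have eq: "V y - V z = G (max (norm y) \<epsilon>) * (W y - W z) + (G (max (norm y) \<epsilon>) - G (max (norm z) \<epsilon>)) * W z"
        by (simp add: V_def algebra_simps)
      have "norm (G (max (norm y) \<epsilon>) * (W y - W z)) \<le> (C * \<epsilon> powr (- real DIM('a))) * ((M + \<bar>R\<bar> * M) * norm (y - z))"
        using clipped_G(1)[OF \<epsilon>, of y] Wlip[of y z] C by (auto simp: abs_mult intro!: mult_mono)
      moreover have "norm ((G (max (norm y) \<epsilon>) - G (max (norm z) \<epsilon>)) * W z)
          \<le> (C * \<epsilon> powr (- real DIM('a) - 1) * norm (y - z)) * (\<bar>R\<bar> * M)"
        using clipped_G(2)[OF \<epsilon>, of y z] Wbd[of z] C by (auto simp: abs_mult intro!: mult_mono)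
      ultimately have "norm (V y - V z) \<le> (C * \<epsilon> powr (- real DIM('a))) * ((M + \<bar>R\<bar> * M) * norm (y - z))
          + (C * \<epsilon> powr (- real DIM('a) - 1) * norm (y - z)) * (\<bar>R\<bar> * M)"
        unfolding eq by (rule norm_triangle_mono)
      then show ?thesis by (simp add: L_def algebra_simps)
    qed
    have Vder: "((\<lambda>t. (V (y + t *\<^sub>R b) - V y) /\<^sub>R t) \<longlongrightarrow> D b y) (at 0)" if "norm y \<noteq> \<epsilon>" for y
    proof -
      have bb: "b \<bullet> b = 1" using b by (simp add: inner_Basis)
      consider "norm y < \<epsilon>" | "norm y > \<epsilon>" using \<open>norm y \<noteq> \<epsilon>\<close> by linarith
      then have "(V has_derivative (\<lambda>h. G (max (norm y) \<epsilon>) * ((F y *\<^sub>R b + (y \<bullet> b) *\<^sub>R gradient F y) \<bullet> h)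
          + (if norm y \<le> \<epsilon> then 0 else G' (norm y) * ((y \<bullet> h) / norm y)) * W y)) (at y)"
      proof cases
        case 1
        have "((\<lambda>z. G \<epsilon> * W z) has_derivative (\<lambda>h. G \<epsilon> * ((F y *\<^sub>R b + (y \<bullet> b) *\<^sub>R gradient F y) \<bullet> h))) (at y)"
          by (rule has_derivative_mult_right[OF Wder])
        then have "(V has_derivative (\<lambda>h. G \<epsilon> * ((F y *\<^sub>R b + (y \<bullet> b) *\<^sub>R gradient F y) \<bullet> h))) (at y)"
          by (rule has_derivative_transform_within_open[of _ _ _ _ "ball 0 \<epsilon>"]) (use 1 in \<open>auto simp: V_def max_def\<close>)
        then show ?thesis using 1 by (simp add: max_def)
      next
        case 2
        then have "y \<noteq> 0" using \<epsilon> by auto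
        have "((\<lambda>z. G (norm z) * W z) has_derivative (\<lambda>h. G (norm y) * ((F y *\<^sub>R b + (y \<bullet> b) *\<^sub>R gradient F y) \<bullet> h)
            + (G' (norm y) * ((y \<bullet> h) / norm y)) * W y)) (at y)"
          by (rule has_derivative_mult[OF G_norm_has_derivative[OF \<open>y \<noteq> 0\<close>] Wder])
        then have "(V has_derivative (\<lambda>h. G (norm y) * ((F y *\<^sub>R b + (y \<bullet> b) *\<^sub>R gradient F y) \<bullet> h)
            + (G' (norm y) * ((y \<bullet> h) / norm y)) * W y)) (at y)"
          by (rule has_derivative_transform_within_open[of _ _ _ _ "- cball 0 \<epsilon>"]) (use 2 in \<open>auto simp: V_def max_def\<close>)
        then show ?thesis using 2 by (simp add: max_def)
      qed
      from directional_derivative_tendsto[OF this, of b] show ?thesis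
        by (cases "norm y \<le> \<epsilon>") (simp_all add: D_def W_def bb inner_add_left max_def)
    qed
    have "sphere 0 \<epsilon> \<in> null_sets (lborel :: 'a measure)"
      using negligible_sphere[of "0::'a" \<epsilon>] negligible_iff_null_sets null_sets_completion_iff by (metis sets_lborel borel_closed closed_sphere)
    then have "AE y in lborel. (y::'a) \<notin> sphere 0 \<epsilon>" by (rule AE_not_in)
    then have ae: "AE y in lborel. ((\<lambda>t. (V (y + t *\<^sub>R b) - V y) /\<^sub>R t) \<longlongrightarrow> D b y) (at 0)"
      by eventually_elim (rule Vder, simp)
    \<comment> \<open>Setting \<open>G'\<close> to 0 at the origin changes nothing, because there
      the norm is below epsilon and the term is absent; it makes the function visibly Borel.\<close>
    have "(\<lambda>y. G (max (norm y) \<epsilon>) * (F y + (y \<bullet> b) * (gradient F y \<bullet> b))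
       + (if norm y \<le> \<epsilon> then 0 else (if y = 0 then 0 else G' (norm y)) * ((y \<bullet> b) / norm y) * ((y \<bullet> b) * F y))) \<in> borel_measurable borel"
      using G'm by measurable
    then have Dm: "D b \<in> borel_measurable borel"
      by (rule measurable_cong[THEN iffD1, rotated]) (use \<epsilon> in \<open>auto simp: D_def\<close>)
    have Vs: "V y = 0" if "R < norm y" for y using supp that by (simp add: V_def W_def)
    have nb: "norm b \<le> 1" using b by simp
    show ?thesis
      using integral_directional_derivative_zero[OF Vlip Vs Dm ae nb] by blast
  qed
  have "(\<Sum>b\<in>Basis. D b y) = G (max (norm y) \<epsilon>) * (y \<bullet> gradient F y)
      + (if norm y \<le> \<epsilon> then real DIM('a) * G \<epsilon> else m y) * F y" for y
  proof -
    have s1: "(\<Sum>b\<in>Basis. (y \<bullet> b) * (gradient F y \<bullet> b)) = y \<bullet> gradient F y"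
      by (rule euclidean_inner[symmetric])
    have s2: "(\<Sum>b\<in>Basis. (y \<bullet> b) * (y \<bullet> b)) = norm y * norm y"
      using euclidean_inner[of y y] power2_norm_eq_inner[of y] by (simp only: power2_eq_square)
    have "(\<Sum>b\<in>Basis. G (max (norm y) \<epsilon>) * (F y + (y \<bullet> b) * (gradient F y \<bullet> b)))
        = G (max (norm y) \<epsilon>) * (real DIM('a) * F y + y \<bullet> gradient F y)"
      by (simp add: sum_distrib_left[symmetric] sum.distrib s1)
    moreover have "(\<Sum>b\<in>Basis. G' (norm y) * ((y \<bullet> b) / norm y) * ((y \<bullet> b) * F y)) = norm y * G' (norm y) * F y" if "y \<noteq> 0"
    proof -
      have "(\<Sum>b\<in>Basis. G' (norm y) * ((y \<bullet> b) / norm y) * ((y \<bullet> b) * F y))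
         = (\<Sum>b\<in>Basis. (G' (norm y) * F y / norm y) * ((y \<bullet> b) * (y \<bullet> b)))"
        by (rule sum.cong) auto
      also have "\<dots> = (G' (norm y) * F y / norm y) * (norm y * norm y)"
        unfolding sum_distrib_left[symmetric] s2 ..
      finally show ?thesis using that by simp
    qed
    ultimately show ?thesis
      using \<epsilon> by (auto simp: D_def sum.distrib radial_div_def max_def algebra_simps)
  qed
  then have "(LINT y|lborel. G (max (norm y) \<epsilon>) * (y \<bullet> gradient F y)
      + (if norm y \<le> \<epsilon> then real DIM('a) * G \<epsilon> else m y) * F y) = (LINT y|lborel. (\<Sum>b\<in>Basis. D b y))"
    by simp
  also have "\<dots> = (\<Sum>b\<in>Basis. LINT y|lborel. D b y)"
    using Db by (intro Bochner_Integration.integral_sum) auto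
  also have "\<dots> = 0" using Db by simp
  finally show ?thesis .
qed

text \<open>Inside the small ball the clipped field is linear, and the integral of its divergence is
  the flux of \<open>k\<close> through the sphere of radius epsilon. The flux is bounded but not
  assumed to converge, so \<open>c\<close> is a limit along a subsequence, chosen before
  \<open>f\<close> so that it serves all densities.\<close>

lemma divergence_identity:
  obtains c where "\<bar>c\<bar> \<le> C * (real DIM('a) * unit_ball_vol (real DIM('a)))"
    "\<And>\<gamma> M R f (x::'a). 0 < \<gamma> \<Longrightarrow> C1b \<gamma> M f \<Longrightarrow> (\<And>y. R < norm y \<Longrightarrow> f y = 0) \<Longrightarrow>
        (LINT y|lborel. gradient f (x - y) \<bullet> k y) = c * f x + conv f m x"
proof -
  define d where "d = real DIM('a)"
  define vol where "vol = unit_ball_vol d"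
  have vol: "0 \<le> vol" "0 < d" using DIM_positive[where 'a='a] by (auto simp: vol_def d_def)
  define \<epsilon> where "\<epsilon> n = 1 / real (Suc n)" for n
  have \<epsilon>: "0 < \<epsilon> n" for n by (simp add: \<epsilon>_def)
  have \<epsilon>0: "\<epsilon> \<longlonglongrightarrow> 0" unfolding \<epsilon>_def using LIMSEQ_inverse_real_of_nat by (simp add: inverse_eq_divide)
  have Gd: "\<bar>G r\<bar> * r ^ DIM('a) \<le> C" if "0 < r" for r
  proof -
    have "\<bar>G r\<bar> * r ^ DIM('a) \<le> (C * r powr (- d)) * r ^ DIM('a)"
      using G[OF that] that by (intro mult_right_mono) (auto simp: d_def)
    also have "\<dots> = C" using that by (simp add: d_def powr_realpow[symmetric] powr_minus)
    finally show ?thesis .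
  qed
  define a where "a n = d * vol * (G (\<epsilon> n) * \<epsilon> n ^ DIM('a))" for n
  have abd: "\<bar>a n\<bar> \<le> C * (d * vol)" for n
  proof -
    have "\<bar>a n\<bar> = d * vol * (\<bar>G (\<epsilon> n)\<bar> * \<epsilon> n ^ DIM('a))"
      using vol \<epsilon>[of n] by (simp add: a_def abs_mult)
    also have "\<dots> \<le> d * vol * C" using vol Gd[OF \<epsilon>] by (intro mult_left_mono) auto
    finally show ?thesis by (simp add: mult.commute)
  qed
  have "bounded (range a)" using abd by (auto simp: bounded_iff)
  then obtain c r where r: "strict_mono r" "(a \<circ> r) \<longlonglongrightarrow> c"
    using bounded_imp_convergent_subsequence by blast
  have "\<bar>c\<bar> \<le> C * (d * vol)"
    by (rule LIMSEQ_le_const2[OF tendsto_rabs[OF r(2)]]) (use abd in auto)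
  moreover have "(LINT y|lborel. gradient f (x - y) \<bullet> k y) = c * f x + conv f m x"
    if \<gamma>: "0 < \<gamma>" and f: "C1b \<gamma> M f" and supp: "\<And>y. R < norm y \<Longrightarrow> f y = 0" for \<gamma> M R f and x :: 'a
  proof -
    have M: "0 \<le> M" using C1b_nonneg f by blast
    define F where "F y = f (x - y)" for y
    have Fder: "(F has_derivative (\<lambda>h. (- gradient f (x - y)) \<bullet> h)) (at y)" for y
    proof -
      have "((\<lambda>y. f (x - y)) has_derivative (\<lambda>h. gradient f (x - y) \<bullet> (- h))) (at y)"
      proof (rule has_derivative_compose[where f = "\<lambda>y. x - y" and g = f])
        show "((\<lambda>y. x - y) has_derivative (\<lambda>h. - h)) (at y)" by (auto intro!: derivative_eq_intros)
      qed (rule C1bD(5)[OF f])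
      then show ?thesis by (simp add: F_def[abs_def])
    qed
    have Fg: "gradient F y = - gradient f (x - y)" for y by (rule gradient_eqI[OF Fder])
    have F: "C1b \<gamma> M F"
    proof (rule C1bI[OF Fder])
      fix y z
      show "norm (- gradient f (x - y) - - gradient f (x - z)) \<le> M * norm (y - z) powr \<gamma>"
        using C1bD(4)[OF f, of "x - z" "x - y"] by (simp add: norm_minus_commute)
    qed (use C1bD[OF f] in \<open>auto simp: F_def\<close>)
    have Fs: "F y = 0" if "norm (x - y) > R" for y using supp that by (simp add: F_def)
    have Fgs: "gradient F y = 0" if "norm (x - y) > R" for y
      using gradient_outside_support[of R f "x - y"] supp that by (simp add: Fg)
    have Fs': "F y = 0" if "norm x + R < norm y" for y
      using Fs[of y] norm_triangle_sub[of y x] that by (simp add: norm_minus_commute)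
    have F0: "F 0 = f x" by (simp add: F_def)
    have [measurable]: "F \<in> borel_measurable borel" "gradient F \<in> borel_measurable borel"
      using C1b_continuous[OF F] C1b_continuous_gradient[OF F \<gamma>]
      by (auto intro: borel_measurable_continuous_onI)
    note [measurable] = k_measurable m_measurable
    have [measurable]: "(\<lambda>y::'a. G (max (norm y) (\<epsilon> n))) \<in> borel_measurable borel" for n
      by (rule lipschitz_borel_measurable[of _ "C * \<epsilon> n powr (- real DIM('a) - 1)"]) (use clipped_G(2)[OF \<epsilon>] in simp)
    \<comment> \<open>\<open>s\<close> is the part with an integrable majorant uniform in
      \<open>n\<close>; \<open>s'\<close> lives on the shrinking ball and produces the point
      mass.\<close>
    define s where "s n y = G (max (norm y) (\<epsilon> n)) * (y \<bullet> gradient F y) + (if norm y \<le> \<epsilon> n then 0 else m y * F y)" for n y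
    define s' where "s' n y = (if norm y \<le> \<epsilon> n then d * G (\<epsilon> n) * F y else 0)" for n y
    have [measurable]: "s n \<in> borel_measurable borel" "s' n \<in> borel_measurable borel" for n
      unfolding s_def s'_def by measurable
    have ad: "0 \<le> d - 1" "d - 1 < DIM('a)" using DIM_positive[where 'a='a] by (auto simp: d_def Suc_le_eq)
    have sbd: "norm (s n y) \<le> (2 * C * M) * (indicator (cball x R) y * norm y powr (- (d - 1)))" for n y
    proof (cases "norm (x - y) \<le> R")
      case True
      have "\<bar>(G (max (norm y) (\<epsilon> n)) *\<^sub>R y) \<bullet> gradient F y\<bar> \<le> (C * norm y powr (- (d - 1))) * M"
        using Cauchy_Schwarz_ineq2[of "G (max (norm y) (\<epsilon> n)) *\<^sub>R y" "gradient F y"]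
          mult_mono[OF clipped_G(3)[OF \<epsilon>[of n], of y] C1bD(3)[OF F, of y]] C by (simp add: d_def)
      moreover have "norm (if norm y \<le> \<epsilon> n then 0 else m y * F y) \<le> (C * norm y powr (- (d - 1))) * M"
        using mult_mono[OF m_bound[of y] C1bD(2)[OF F, of y]] C M by (auto simp: abs_mult d_def)
      ultimately have "norm (s n y) \<le> (C * norm y powr (- (d - 1))) * M + (C * norm y powr (- (d - 1))) * M"
        unfolding s_def by (intro norm_triangle_mono) auto
      then show ?thesis using True by (simp add: dist_norm mult_ac)
    qed (simp add: s_def Fs Fgs dist_norm)
    have BB: "0 \<le> 2 * C * M" using C M by simp
    have w: "integrable lborel (\<lambda>y. (2 * C * M) * (indicator (cball x R) y * norm y powr (- (d - 1))))"
      by (intro integrable_mult_right ball_weight_bound(1)[OF ad])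
    have sint: "integrable lborel (s n)" for n
      by (rule weight_dominated(1)[OF ad _ BB sbd]) measurable
    have s'int: "integrable lborel (s' n)" for n
    proof (rule integrable_bounded_support(1))
      show "norm (s' n y) \<le> (\<bar>d * G (\<epsilon> n)\<bar> * M) * indicator (cball 0 (\<epsilon> n)) y" for y
        using mult_left_mono[OF C1bD(2)[OF F, of y], of "\<bar>d * G (\<epsilon> n)\<bar>"] by (auto simp: s'_def abs_mult)
    qed measurable
    define S where "S y = k y \<bullet> gradient F y + m y * F y" for y
    have [measurable]: "S \<in> borel_measurable borel" unfolding S_def by measurable
    have s_lim: "(\<lambda>n. s n y) \<longlonglongrightarrow> S y" for y
    proof (cases "y = 0")
      case True
      then show ?thesis using \<epsilon> by (simp add: s_def S_def less_imp_le radial_div_def)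
    next
      case False
      then have "\<forall>\<^sub>F n in sequentially. \<epsilon> n < norm y"
        using \<epsilon>0 by (intro order_tendstoD) auto
      then have "\<forall>\<^sub>F n in sequentially. s n y = S y"
        by eventually_elim (simp add: s_def S_def max_def)
      then show ?thesis by (rule tendsto_eventually)
    qed
    have slim: "(\<lambda>n. LINT y|lborel. s n y) \<longlonglongrightarrow> (LINT y|lborel. S y)"
      by (rule integral_dominated_convergence[OF _ _ w]) (use s_lim sbd in auto)
    \<comment> \<open>Freezing \<open>F\<close> at the origin costs only order epsilon: the volume
      epsilon^d cancels the size epsilon^(-d) of \<open>G\<close>, and the Lipschitz increment of
      \<open>F\<close> remains.\<close>
    have s'val: "\<bar>(LINT y|lborel. s' n y) - a n * F 0\<bar> \<le> d * C * M * vol * \<epsilon> n" for n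
    proof -
      have meas: "measure lborel (cball (0::'a) (\<epsilon> n)) = vol * \<epsilon> n ^ DIM('a)"
        using content_cball[of "\<epsilon> n" "0::'a"] \<epsilon>[of n] by (simp add: vol_def d_def)
      define e where "e y = s' n y - d * G (\<epsilon> n) * F 0 * indicator (cball 0 (\<epsilon> n)) y" for y
      have i: "integrable lborel (\<lambda>y. d * G (\<epsilon> n) * F 0 * indicator (cball (0::'a) (\<epsilon> n)) y)"
        using integrable_cball_indicator by (intro integrable_mult_right)
      have "(LINT y|lborel. e y) = (LINT y|lborel. s' n y) - a n * F 0"
        unfolding e_def by (subst Bochner_Integration.integral_diff[OF s'int i]) (simp add: a_def meas)
      moreover have "norm (LINT y|lborel. e y) \<le> (d * \<bar>G (\<epsilon> n)\<bar> * (M * \<epsilon> n)) * measure lborel (cball (0::'a) (\<epsilon> n))"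
      proof (rule integrable_bounded_support(2))
        show "norm (e y) \<le> (d * \<bar>G (\<epsilon> n)\<bar> * (M * \<epsilon> n)) * indicator (cball 0 (\<epsilon> n)) y" for y
        proof (cases "norm y \<le> \<epsilon> n")
          case True
          then have "e y = d * G (\<epsilon> n) * (F y - F 0)" by (simp add: e_def s'_def algebra_simps)
          moreover have "\<bar>F y - F 0\<bar> \<le> M * \<epsilon> n"
            using C1b_lipschitz[OF F, of y 0] mult_left_mono[OF True M] by simp
          ultimately show ?thesis using True vol by (simp add: abs_mult mult_left_mono)
        qed (simp add: e_def s'_def)
      next
        show "e \<in> borel_measurable borel"
          using borel_measurable_diff[OF borel_measurable_integrable[OF s'int[of n]] borel_measurable_integrable[OF i]]
          by (simp add: e_def[abs_def])
      qed
      moreover have "(d * \<bar>G (\<epsilon> n)\<bar> * (M * \<epsilon> n)) * measure lborel (cball (0::'a) (\<epsilon> n))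
         \<le> d * C * M * vol * \<epsilon> n"
      proof -
        have "(d * M * vol * \<epsilon> n) * (\<bar>G (\<epsilon> n)\<bar> * \<epsilon> n ^ DIM('a)) \<le> (d * M * vol * \<epsilon> n) * C"
          using Gd[OF \<epsilon>] vol M \<epsilon>[of n] by (intro mult_left_mono) auto
        then show ?thesis unfolding meas by (simp add: mult_ac)
      qed
      ultimately show ?thesis by simp
    qed
    have s'lim: "((\<lambda>n. LINT y|lborel. s' n y) \<circ> r) \<longlonglongrightarrow> c * F 0"
    proof -
      have "(\<lambda>n. d * C * M * vol * \<epsilon> n) \<longlonglongrightarrow> 0"
        using tendsto_mult_right_zero[OF \<epsilon>0] by simp
      then have "(\<lambda>n. (LINT y|lborel. s' n y) - a n * F 0) \<longlonglongrightarrow> 0"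
        by (rule Lim_null_comparison[rotated]) (use s'val in auto)
      then have "((\<lambda>n. (LINT y|lborel. s' n y) - a n * F 0) \<circ> r) \<longlonglongrightarrow> 0"
        using r(1) by (rule LIMSEQ_subseq_LIMSEQ)
      from tendsto_add[OF this tendsto_mult_right[OF r(2), of "F 0"]] show ?thesis
        by (simp add: comp_def)
    qed
    have zero: "(LINT y|lborel. s n y) + (LINT y|lborel. s' n y) = 0" for n
    proof -
      have "(LINT y|lborel. s n y) + (LINT y|lborel. s' n y) = (LINT y|lborel. s n y + s' n y)"
        using sint s'int by simp
      also have "\<dots> = (LINT y|lborel. G (max (norm y) (\<epsilon> n)) * (y \<bullet> gradient F y)
        + (if norm y \<le> \<epsilon> n then real DIM('a) * G (\<epsilon> n) else m y) * F y)"
        by (rule Bochner_Integration.integral_cong) (auto simp: s_def s'_def d_def)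
      also have "\<dots> = 0"
        by (rule clipped_divergence_theorem[OF F \<gamma> Fs' \<epsilon>])
      finally show ?thesis .
    qed
    have "(\<lambda>n. (LINT y|lborel. s (r n) y) + (LINT y|lborel. s' (r n) y)) \<longlonglongrightarrow> (LINT y|lborel. S y) + c * F 0"
      using tendsto_add[OF LIMSEQ_subseq_LIMSEQ[OF slim r(1)] s'lim] by (simp add: comp_def)
    then have "(LINT y|lborel. S y) + c * F 0 = 0"
      by (simp add: zero LIMSEQ_const_iff)
    moreover have "(LINT y|lborel. S y) = conv f m x - (LINT y|lborel. gradient f (x - y) \<bullet> k y)"
    proof -
      have i1: "integrable lborel (\<lambda>y. k y \<bullet> gradient F y)"
      proof (rule weight_dominated(1)[OF ad])
        show "norm (k y \<bullet> gradient F y) \<le> (C * M) * (indicator (cball x R) y * norm y powr (- (d - 1)))" for y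
        proof (cases "norm (x - y) \<le> R")
          case True
          then show ?thesis
            using Cauchy_Schwarz_ineq2[of "k y" "gradient F y"]
              mult_mono[OF k_bound[of y] C1bD(3)[OF F, of y]] C by (simp add: d_def dist_norm mult_ac)
        qed (simp add: Fgs dist_norm)
        show "(\<lambda>y. k y \<bullet> gradient F y) \<in> borel_measurable borel" by measurable
      qed (use C M in auto)
      have i2: "integrable lborel (\<lambda>y. m y * F y)"
      proof (rule weight_dominated(1)[OF ad])
        show "norm (m y * F y) \<le> (C * M) * (indicator (cball x R) y * norm y powr (- (d - 1)))" for y
        proof (cases "norm (x - y) \<le> R")
          case True
          then show ?thesis
            using mult_mono[OF m_bound[of y] C1bD(2)[OF F, of y]] C by (simp add: d_def dist_norm abs_mult mult_ac)
        qed (simp add: Fs dist_norm)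
        show "(\<lambda>y. m y * F y) \<in> borel_measurable borel" by measurable
      qed (use C M in auto)
      have "(LINT y|lborel. S y) = (LINT y|lborel. k y \<bullet> gradient F y) + (LINT y|lborel. m y * F y)"
        unfolding S_def using i1 i2 by simp
      moreover have "(LINT y|lborel. m y * F y) = conv f m x"
        by (simp add: conv_def F_def mult.commute)
      moreover have "(LINT y|lborel. k y \<bullet> gradient F y) = - (LINT y|lborel. gradient f (x - y) \<bullet> k y)"
        by (simp add: Fg inner_commute)
      ultimately show ?thesis by simp
    qed
    ultimately show ?thesis using F0 by simp
  qed
  ultimately show thesis unfolding d_def vol_def using that by blast
qed

lemma admissible:
  assumes \<beta>: "0 < \<beta>" "\<beta> < 1"
  shows "\<exists>c. admissible (C * (2 * 2 powr DIM('a) + real DIM('a) * unit_ball_vol (real DIM('a)))) \<beta> k m c"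
proof -
  let ?v = "real DIM('a) * unit_ball_vol (real DIM('a))"
  let ?C = "C * (2 * 2 powr DIM('a) + ?v)"
  have v: "0 \<le> ?v" by simp
  have "1 \<le> 2 * 2 powr real DIM('a) + ?v"
    using ge_one_powr_ge_zero[of 2 "real DIM('a)"] v by linarith
  then have C1: "C \<le> ?C" "2 * C * 2 powr DIM('a) \<le> ?C" "C * ?v \<le> ?C"
    using C v mult_left_mono[of 1 "2 * 2 powr DIM('a) + ?v" C] by (auto simp: algebra_simps)
  obtain c where c: "\<bar>c\<bar> \<le> C * ?v"
    "\<And>\<gamma> M R f (x::'a). 0 < \<gamma> \<Longrightarrow> C1b \<gamma> M f \<Longrightarrow> (\<And>y. R < norm y \<Longrightarrow> f y = 0) \<Longrightarrow>
        (LINT y|lborel. gradient f (x - y) \<bullet> k y) = c * f x + conv f m x"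
    using divergence_identity by blast
  have "admissible ?C \<beta> k m c"
    unfolding admissible_def
  proof (intro conjI allI impI k_measurable m_measurable)
    show "norm (k x) \<le> ?C * norm x powr (- (real DIM('a) - 1))" for x
      using k_bound[of x] mult_right_mono[OF C1(1), of "norm x powr (- (real DIM('a) - 1))"] by simp
    show "\<bar>m x\<bar> \<le> ?C * norm x powr (- (real DIM('a) - 1))" for x
      using m_bound[of x] mult_right_mono[OF C1(1), of "norm x powr (- (real DIM('a) - 1))"] by simp
    show "norm (k x - k y) \<le> ?C * norm (x - y) powr \<beta> *
        (norm x powr (- (real DIM('a) - 1 + \<beta>)) + norm y powr (- (real DIM('a) - 1 + \<beta>)))" for x y
      using k_holder[OF \<beta>, of x y] mult_right_mono[OF C1(2), of "norm (x - y) powr \<beta> *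
        (norm x powr (- (real DIM('a) - 1 + \<beta>)) + norm y powr (- (real DIM('a) - 1 + \<beta>)))"]
      by (simp only: mult.assoc) simp
    show "\<bar>c\<bar> \<le> ?C" using c(1) C1(3) by linarith
    show "(LINT y|lborel. gradient f (x - y) \<bullet> k y) = c * f x + conv f m x"
      if "0 < \<gamma>" "C1b \<gamma> M f" "\<forall>y. R < norm y \<longrightarrow> f y = 0" for \<gamma> M R f x
      using c(2)[of \<gamma> M f R x] that by blast
  qed
  then show ?thesis by blast
qed

end

subsection \<open>The Bessel and Newton kernels\<close>

text \<open>Substituting \<open>t = \<tau> + ln (r / \<kappa>)\<close> in the integral representation of \<open>bessel_K\<close> turns the kernel
  into a superposition of Gaussians, whose \<open>r\<close>-derivatives have the same form.\<close>

definition heat_integrand :: "real \<Rightarrow> real \<Rightarrow> real \<Rightarrow> real \<Rightarrow> real" where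
  "heat_integrand \<nu> a b \<tau> = exp (- (a * exp \<tau> + b * exp (- \<tau>)) + \<nu> * \<tau>)"

definition heat_integral :: "real \<Rightarrow> real \<Rightarrow> real \<Rightarrow> real" where
  "heat_integral \<nu> a b = (LINT \<tau>|lborel. heat_integrand \<nu> a b \<tau>)"

lemma heat_integrand_measurable [measurable]: "heat_integrand \<nu> a b \<in> borel_measurable borel"
  unfolding heat_integrand_def[abs_def] by measurable

lemma exp_abs_integrable:
  assumes "0 < c"
  shows "integrable lborel (\<lambda>\<tau>::real. exp (- c * \<bar>\<tau>\<bar>))"
proof -
  let ?g = "\<lambda>\<tau>::real. indicator {0<..} \<tau> * exp (- (\<tau> * c))"
  have g: "integrable lborel ?g"
    using integrable_I0i_exp_mscale[OF assms] by (simp add: set_integrable_def)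
  have g': "integrable lborel (\<lambda>\<tau>. ?g (0 - \<tau>))"
    by (rule lborel_integrable_reflect[OF g])
  have "integrable lborel (\<lambda>\<tau>. ?g \<tau> + ?g (0 - \<tau>))"
    using g g' by (rule Bochner_Integration.integrable_add)
  then show ?thesis
  proof (rule integrable_cong_AE_imp)
    show "AE \<tau> in lborel. ?g \<tau> + ?g (0 - \<tau>) = exp (- c * \<bar>\<tau>\<bar>)"
      using AE_lborel_singleton[of 0] by eventually_elim (auto simp: indicator_def mult.commute)
  qed simp
qed

text \<open>Since exp tau \<ge> tau^2/2, the left side is at most a quadratic in tau; completing the
  square gives the constant and leaves a linear decay.\<close>

lemma double_exponential_bound:
  fixes a :: real
  assumes "0 < a" "0 \<le> \<tau>"
  shows "- a * exp \<tau> + \<mu> * \<tau> \<le> (\<mu> + 1)\<^sup>2 / (2 * a) - \<tau>"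
proof -
  have "0 \<le> (a * \<tau> - (\<mu> + 1))\<^sup>2 / (2 * a)" using assms by simp
  also have "\<dots> = a * \<tau>\<^sup>2 / 2 - (\<mu> + 1) * \<tau> + (\<mu> + 1)\<^sup>2 / (2 * a)"
    using assms by (simp add: power2_eq_square field_simps)
  finally have "(\<mu> + 1) * \<tau> \<le> a * (\<tau>\<^sup>2 / 2) + (\<mu> + 1)\<^sup>2 / (2 * a)" by simp
  also have "a * (\<tau>\<^sup>2 / 2) \<le> a * exp \<tau>"
    using exp_lower_Taylor_quadratic[OF assms(2)] assms by (intro mult_left_mono) auto
  finally show ?thesis by (simp add: algebra_simps)
qed

text \<open>The right tail is damped by \<open>a\<close>. The left tail is damped by
  \<open>b\<close> if b > 0 and otherwise by the factor exp(nu tau); the case b = 0 supplies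
  comparison integrals independent of kappa.\<close>

lemma heat_integrand_exp_bound:
  assumes a: "0 < a" and b: "0 \<le> b" and \<nu>: "0 < b \<or> 0 < \<nu>"
  obtains K c where "0 < c" "0 \<le> K" "\<And>\<tau>. heat_integrand \<nu> a b \<tau> \<le> K * exp (- c * \<bar>\<tau>\<bar>)"
proof -
  define c where "c = (if 0 < b then 1 else min 1 \<nu>)"
  define K where "K = exp ((\<nu> + 1)\<^sup>2 / (2 * a)) + exp ((- \<nu> + 1)\<^sup>2 / (2 * b)) + 1"
  have c: "0 < c" "c \<le> 1" using \<nu> by (auto simp: c_def)
  have "heat_integrand \<nu> a b \<tau> \<le> K * exp (- c * \<bar>\<tau>\<bar>)" for \<tau>
  proof (cases "0 \<le> \<tau>")
    case True
    have "- (a * exp \<tau> + b * exp (- \<tau>)) + \<nu> * \<tau> \<le> - a * exp \<tau> + \<nu> * \<tau>" using b by simp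
    also have "\<dots> \<le> (\<nu> + 1)\<^sup>2 / (2 * a) - \<tau>" by (rule double_exponential_bound[OF a True])
    also have "\<dots> \<le> (\<nu> + 1)\<^sup>2 / (2 * a) - c * \<tau>" using c True by (simp add: mult_left_le_one_le)
    finally have "heat_integrand \<nu> a b \<tau> \<le> exp ((\<nu> + 1)\<^sup>2 / (2 * a)) * exp (- c * \<bar>\<tau>\<bar>)"
      using True by (simp add: heat_integrand_def flip: exp_add)
    also have "\<dots> \<le> K * exp (- c * \<bar>\<tau>\<bar>)" by (intro mult_right_mono) (auto simp: K_def add_nonneg_nonneg)
    finally show ?thesis .
  next
    case False
    show ?thesis
    proof (cases "0 < b")
      case True
      have "- (a * exp \<tau> + b * exp (- \<tau>)) + \<nu> * \<tau> \<le> - b * exp (- \<tau>) + (- \<nu>) * (- \<tau>)" using a by simp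
      also have "\<dots> \<le> (- \<nu> + 1)\<^sup>2 / (2 * b) - (- \<tau>)"
        by (rule double_exponential_bound) (use True False in auto)
      finally have "heat_integrand \<nu> a b \<tau> \<le> exp ((- \<nu> + 1)\<^sup>2 / (2 * b)) * exp (- c * \<bar>\<tau>\<bar>)"
        using True False by (simp add: heat_integrand_def c_def flip: exp_add)
      also have "\<dots> \<le> K * exp (- c * \<bar>\<tau>\<bar>)" by (intro mult_right_mono) (auto simp: K_def add_nonneg_nonneg)
      finally show ?thesis .
    next
      case b0: False
      then have \<nu>: "0 < \<nu>" "b = 0" using \<nu> b by auto
      have "- (a * exp \<tau> + b * exp (- \<tau>)) + \<nu> * \<tau> \<le> \<nu> * \<tau>" using a \<nu> by simp
      also have "\<dots> \<le> c * \<tau>" using False b0 by (auto simp: c_def intro!: mult_right_mono_neg)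
      finally have "heat_integrand \<nu> a b \<tau> \<le> 1 * exp (- c * \<bar>\<tau>\<bar>)"
        using False by (simp add: heat_integrand_def)
      also have "\<dots> \<le> K * exp (- c * \<bar>\<tau>\<bar>)" by (intro mult_right_mono) (auto simp: K_def add_nonneg_nonneg)
      finally show ?thesis .
    qed
  qed
  then show thesis using that[of c K] c by (simp add: K_def add_nonneg_nonneg)
qed

lemma heat_integrable:
  assumes "0 < a" "0 \<le> b" "0 < b \<or> 0 < \<nu>"
  shows "integrable lborel (heat_integrand \<nu> a b)"
proof -
  obtain K c where K: "0 < c" "0 \<le> K" "\<And>\<tau>. heat_integrand \<nu> a b \<tau> \<le> K * exp (- c * \<bar>\<tau>\<bar>)"
    using heat_integrand_exp_bound[OF assms] by metis
  have "integrable lborel (\<lambda>\<tau>::real. K * exp (- c * \<bar>\<tau>\<bar>))"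
    by (intro integrable_mult_right exp_abs_integrable K)
  then show ?thesis
  proof (rule Bochner_Integration.integrable_bound)
    have "0 \<le> heat_integrand \<nu> a b \<tau>" for \<tau> by (simp add: heat_integrand_def)
    then show "AE \<tau> in lborel. norm (heat_integrand \<nu> a b \<tau>) \<le> norm (K * exp (- c * \<bar>\<tau>\<bar>))"
      using K by (intro AE_I2) (simp add: abs_mult)
  qed simp
qed

lemma heat_integral_nonneg: "0 \<le> heat_integral \<nu> a b"
  unfolding heat_integral_def by (intro integral_nonneg_AE) (auto simp: heat_integrand_def)

text \<open>Translation by ln q. It turns (a, b) into any pair with the same product, which links
  the kernel to the symmetric pair of \<open>bessel_K\<close>; at b = 0 it shows the pure power law,
  with \<open>heat_integral \<nu> 1 0\<close> being Gamma(nu).\<close>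

lemma heat_integral_shift:
  assumes "0 < a" "0 \<le> b" "0 < b \<or> 0 < \<nu>" "0 < q"
  shows "heat_integral \<nu> a b = q powr \<nu> * heat_integral \<nu> (a * q) (b / q)"
proof -
  have eq: "heat_integrand \<nu> a b (\<tau> + ln q) = q powr \<nu> * heat_integrand \<nu> (a * q) (b / q) \<tau>" for \<tau>
    using assms by (simp add: heat_integrand_def exp_add exp_minus powr_def algebra_simps exp_diff divide_inverse)
  have "heat_integral \<nu> a b = (LINT \<tau>|lborel. heat_integrand \<nu> a b (\<tau> + ln q))"
    unfolding heat_integral_def using lborel_integral_translate(2)[OF heat_integrable[OF assms(1-3)]] by simp
  also have "\<dots> = q powr \<nu> * heat_integral \<nu> (a * q) (b / q)"
    by (simp add: eq heat_integral_def)
  finally show ?thesis .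
qed

text \<open>Dropping the \<open>b\<close> term increases the integrand, and the resulting bound is
  uniform in kappa.\<close>

lemma heat_integral_bound:
  assumes a: "0 < a" and b: "0 \<le> b" and \<nu>: "0 < \<nu>"
  shows "heat_integral \<nu> a b \<le> heat_integral \<nu> 1 0 * a powr (- \<nu>)"
proof -
  have "heat_integral \<nu> a b \<le> heat_integral \<nu> a 0"
    unfolding heat_integral_def
    by (rule integral_mono[OF heat_integrable heat_integrable]) (use a b \<nu> in \<open>auto simp: heat_integrand_def\<close>)
  also have "heat_integral \<nu> a 0 = heat_integral \<nu> 1 0 * a powr (- \<nu>)"
    using heat_integral_shift[of a 0 \<nu> "1 / a"] a \<nu> by (simp add: powr_divide powr_minus_divide)
  finally show ?thesis .
qed

text \<open>As y exp(-y^2) \<le> 1 for y^2 = b exp(-tau), the factor sqrt b is exchanged for half an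
  order in nu. This controls kappa^2 g even for nu = 0, that is in dimension 2, where the integral
  itself diverges logarithmically as \<open>b\<close> tends to 0.\<close>

lemma heat_integral_sqrt_bound:
  assumes a: "0 < a" and b: "0 < b" and \<nu>: "0 \<le> \<nu>"
  shows "sqrt b * heat_integral \<nu> a b \<le> heat_integral (\<nu> + 1/2) a 0"
proof -
  have bd: "sqrt b * heat_integrand \<nu> a b \<tau> \<le> heat_integrand (\<nu> + 1/2) a 0 \<tau>" for \<tau>
  proof -
    define y where "y = sqrt b * exp (- \<tau> / 2)"
    have y2: "y * y = b * exp (- \<tau>)"
    proof -
      have "exp (- \<tau> / 2) * exp (- \<tau> / 2) = exp (- \<tau>)" by (simp flip: exp_add)
      moreover have "sqrt b * sqrt b = b" using b by simp
      ultimately show ?thesis unfolding y_def by (metis mult.assoc mult.left_commute)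
    qed
    have "y \<le> 1 + y * y"
      using zero_le_power2[of "y - 1/2"] by (simp add: power2_eq_square algebra_simps)
    also have "\<dots> \<le> exp (y * y)" by (rule exp_ge_add_one_self)
    finally have "y * exp (- (y * y)) \<le> 1" by (simp add: exp_minus field_simps)
    then have "(y * exp (- (b * exp (- \<tau>)))) * (exp (\<tau> / 2) * exp (- a * exp \<tau> + \<nu> * \<tau>))
       \<le> 1 * (exp (\<tau> / 2) * exp (- a * exp \<tau> + \<nu> * \<tau>))"
      unfolding y2 by (intro mult_right_mono) auto
    moreover have "(y * exp (- (b * exp (- \<tau>)))) * (exp (\<tau> / 2) * exp (- a * exp \<tau> + \<nu> * \<tau>)) = sqrt b * heat_integrand \<nu> a b \<tau>"
      by (simp add: y_def heat_integrand_def mult.assoc flip: exp_add)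
    moreover have "1 * (exp (\<tau> / 2) * exp (- a * exp \<tau> + \<nu> * \<tau>)) = heat_integrand (\<nu> + 1/2) a 0 \<tau>"
      by (simp add: heat_integrand_def algebra_simps flip: exp_add)
    ultimately show ?thesis by linarith
  qed
  have "(LINT \<tau>|lborel. sqrt b * heat_integrand \<nu> a b \<tau>) \<le> (LINT \<tau>|lborel. heat_integrand (\<nu> + 1/2) a 0 \<tau>)"
    by (rule integral_mono[OF _ _ bd]) (use a b \<nu> in \<open>auto intro!: heat_integrable integrable_mult_right\<close>)
  then show ?thesis by (simp add: heat_integral_def)
qed

text \<open>The integral over the line of the \<open>\<tau>\<close>-derivative of the integrand
  vanishes. For the kernel this is the differential equation off the origin.\<close>

lemma heat_integral_recurrence:
  assumes a: "0 < a" and b: "0 < b"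
  shows "\<nu> * heat_integral \<nu> a b + b * heat_integral (\<nu> - 1) a b = a * heat_integral (\<nu> + 1) a b"
proof -
  note int = heat_integrable[OF a less_imp_le[OF b] disjI1[OF b]]
  let ?f = "\<lambda>\<tau>. \<nu> * heat_integrand \<nu> a b \<tau> + b * heat_integrand (\<nu> - 1) a b \<tau> - a * heat_integrand (\<nu> + 1) a b \<tau>"
  have der: "(heat_integrand \<nu> a b has_vector_derivative ?f \<tau>) (at \<tau>)" for \<tau>
    unfolding heat_integrand_def[abs_def] has_real_derivative_iff_has_vector_derivative[symmetric]
    by (auto intro!: derivative_eq_intros simp: algebra_simps exp_add exp_diff exp_minus divide_inverse)
  obtain K c where K: "0 < c" "0 \<le> K" "\<And>\<tau>. heat_integrand \<nu> a b \<tau> \<le> K * exp (- c * \<bar>\<tau>\<bar>)"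
    using heat_integrand_exp_bound[OF a less_imp_le[OF b] disjI1[OF b]] by metis
  have nn: "0 \<le> heat_integrand \<nu> a b \<tau>" for \<tau> by (simp add: heat_integrand_def)
  have lim: "(heat_integrand \<nu> a b \<longlongrightarrow> 0) F" if "filterlim (\<lambda>\<tau>::real. \<bar>\<tau>\<bar>) at_top F" for F
  proof -
    have "((\<lambda>x. K * exp (- c * x)) \<longlongrightarrow> 0) at_top"
      using K by real_asymp
    then have "((\<lambda>\<tau>. K * exp (- c * \<bar>\<tau>\<bar>)) \<longlongrightarrow> 0) F"
      by (rule filterlim_compose[OF _ that])
    then show ?thesis
      by (rule Lim_null_comparison[rotated]) (use nn K in auto)
  qed
  have "(LBINT \<tau>=-\<infinity>..\<infinity>. ?f \<tau>) = 0 - 0"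
  proof (rule interval_integral_FTC_integrable)
    show "(heat_integrand \<nu> a b has_vector_derivative ?f \<tau>) (at \<tau>)" for \<tau> by (rule der)
    show "isCont ?f \<tau>" for \<tau> unfolding heat_integrand_def by (intro continuous_intros)
    show "set_integrable lborel (einterval (- \<infinity>) \<infinity>) ?f"
      unfolding set_integrable_def using int by simp
    show "((heat_integrand \<nu> a b \<circ> real_of_ereal) \<longlongrightarrow> 0) (at_right (- \<infinity>))"
      "((heat_integrand \<nu> a b \<circ> real_of_ereal) \<longlongrightarrow> 0) (at_left \<infinity>)"
      unfolding ereal_tendsto_simps by (rule lim; real_asymp)+
  qed simp
  then have "(LINT \<tau>|lborel. ?f \<tau>) = 0"
    by (simp add: interval_lebesgue_integral_def set_lebesgue_integral_def)
  then show ?thesis using int by (simp add: heat_integral_def)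
qed

text \<open>Second-order expansion of exp(-t exp tau). For |t| \<le> a/2 the remainder is dominated
  by the integrand with \<open>a / 2\<close> in place of \<open>a\<close>, the factor exp(2 tau)
  raising the order by 2.\<close>

lemma heat_integral_has_derivative:
  assumes a: "0 < a" and b: "0 < b"
  shows "((\<lambda>a. heat_integral \<nu> a b) has_real_derivative (- heat_integral (\<nu> + 1) a b)) (at a)"
  unfolding has_field_derivative_def
proof (rule has_derivative_superlinear[of _ 1 "a / 2" _ _ "heat_integral (\<nu> + 2) (a / 2) b / 2"])
  fix t :: real assume t: "norm t \<le> a / 2"
  have at: "0 < a + t" using t a by (simp add: abs_le_iff)
  note int = heat_integrable[OF _ less_imp_le[OF b] disjI1[OF b]]
  let ?g = "\<lambda>\<tau>. heat_integrand \<nu> (a + t) b \<tau> - heat_integrand \<nu> a b \<tau> + t * heat_integrand (\<nu> + 1) a b \<tau>"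
  have bd: "norm (?g \<tau>) \<le> t\<^sup>2 / 2 * heat_integrand (\<nu> + 2) (a / 2) b \<tau>" for \<tau>
  proof -
    let ?x = "exp \<tau>" and ?E = "heat_integrand \<nu> a b \<tau>"
    obtain s where s: "\<bar>s\<bar> \<le> \<bar>- t * ?x\<bar>" "exp (- t * ?x) = (\<Sum>m<2. ((- t * ?x) ^ m) / fact m) + (exp s / fact 2) * (- t * ?x) ^ 2"
      using Maclaurin_exp_le[of "- t * ?x" 2] by blast
    then have ex: "exp (- t * ?x) - 1 + t * ?x = exp s / 2 * (t\<^sup>2 * ?x\<^sup>2)"
      by (simp add: numeral_2_eq_2 power_mult_distrib)
    have "s \<le> a / 2 * ?x"
    proof -
      have "\<bar>t\<bar> * ?x \<le> a / 2 * ?x" using t by (intro mult_right_mono) auto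
      moreover have "\<bar>- t * ?x\<bar> = \<bar>t\<bar> * ?x" by (simp add: abs_mult)
      ultimately show ?thesis using s(1) by linarith
    qed
    have "?g \<tau> = ?E * (exp (- t * ?x) - 1 + t * ?x)"
      by (simp add: heat_integrand_def algebra_simps flip: exp_add)
    also have "\<dots> = t\<^sup>2 / 2 * (?E * ?x\<^sup>2 * exp s)" unfolding ex by simp
    finally have g: "?g \<tau> = t\<^sup>2 / 2 * (?E * ?x\<^sup>2 * exp s)" .
    have "0 \<le> t\<^sup>2 / 2 * (?E * ?x\<^sup>2 * exp s)"
      by (intro mult_nonneg_nonneg) (auto simp: heat_integrand_def)
    then have "norm (?g \<tau>) = t\<^sup>2 / 2 * (?E * ?x\<^sup>2 * exp s)"
      unfolding g by (simp only: real_norm_def abs_of_nonneg)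
    also have "\<dots> \<le> t\<^sup>2 / 2 * (?E * ?x\<^sup>2 * exp (a / 2 * ?x))"
      using \<open>s \<le> a / 2 * ?x\<close> by (intro mult_left_mono) (auto simp: heat_integrand_def)
    also have "?E * ?x\<^sup>2 * exp (a / 2 * ?x) = heat_integrand (\<nu> + 2) (a / 2) b \<tau>"
      by (simp add: heat_integrand_def power2_eq_square algebra_simps flip: exp_add)
    finally show ?thesis .
  qed
  have eq: "heat_integral \<nu> (a + t) b - heat_integral \<nu> a b - - heat_integral (\<nu> + 1) a b * t = (LINT \<tau>|lborel. ?g \<tau>)"
    unfolding heat_integral_def using int a at by simp
  have "norm (LINT \<tau>|lborel. ?g \<tau>) \<le> (LINT \<tau>|lborel. t\<^sup>2 / 2 * heat_integrand (\<nu> + 2) (a / 2) b \<tau>)"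
    by (rule Bochner_Integration.integral_norm_bound_integral[OF _ _ bd]) (use int a at in auto)
  also have "\<dots> = heat_integral (\<nu> + 2) (a / 2) b / 2 * t\<^sup>2"
    by (simp add: heat_integral_def)
  also have "t\<^sup>2 = norm t powr (1 + 1)"
    unfolding powr_add by (simp add: power2_eq_square)
  finally show "norm (heat_integral \<nu> (a + t) b - heat_integral \<nu> a b - - heat_integral (\<nu> + 1) a b * t)
      \<le> heat_integral (\<nu> + 2) (a / 2) b / 2 * norm t powr (1 + 1)"
    unfolding eq .
qed (use a in \<open>auto intro: bounded_linear_mult_right\<close>)

text \<open>Folding the line at 0 replaces exp(nu tau) by 2 cosh(nu tau).\<close>

lemma bessel_K_heat_integral:
  assumes z: "0 < z"
  shows "bessel_K \<nu> z = heat_integral \<nu> (z / 2) (z / 2) / 2"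
proof -
  let ?E = "heat_integrand \<nu> (z / 2) (z / 2)"
  have E: "?E \<tau> = exp (- z * cosh \<tau>) * exp (\<nu> * \<tau>)" for \<tau>
    by (simp add: heat_integrand_def cosh_def algebra_simps flip: exp_add)
  have i: "integrable lborel ?E" using z by (intro heat_integrable) auto
  let ?g = "\<lambda>\<tau>. indicator {0<..} \<tau> * ?E \<tau>" and ?h = "\<lambda>\<tau>. indicator {0<..} \<tau> * ?E (0 - \<tau>)"
  have i0: "integrable lborel (\<lambda>\<tau>. ?E (0 - \<tau>))" by (rule lborel_integrable_reflect[OF i])
  have gi: "integrable lborel ?g" "integrable lborel ?h"
    using integrable_mult_indicator[OF _ i, of "{0<..}"] integrable_mult_indicator[OF _ i0, of "{0<..}"] by auto
  have hi: "integrable lborel (\<lambda>\<tau>. ?h (0 - \<tau>))" by (rule lborel_integrable_reflect[OF gi(2)])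
  have "heat_integral \<nu> (z / 2) (z / 2) = (LINT \<tau>|lborel. ?g \<tau> + ?h (0 - \<tau>))"
    unfolding heat_integral_def
  proof (rule integral_cong_AE)
    show "AE \<tau> in lborel. ?E \<tau> = ?g \<tau> + ?h (0 - \<tau>)"
      using AE_lborel_singleton[of 0] by eventually_elim (auto simp: indicator_def)
  qed (use gi hi in auto)
  also have "\<dots> = (LINT \<tau>|lborel. ?g \<tau>) + (LINT \<tau>|lborel. ?h \<tau>)"
    using gi hi lborel_integral_reflect[of ?h 0] by simp
  also have "\<dots> = (LINT \<tau>|lborel. ?g \<tau> + ?h \<tau>)" using gi by simp
  also have "\<dots> = (LINT \<tau>|lborel. 2 * (indicator {0<..} \<tau> * (exp (- z * cosh \<tau>) * cosh (\<nu> * \<tau>))))"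
    unfolding E by (intro Bochner_Integration.integral_cong) (auto simp: cosh_def algebra_simps)
  also have "\<dots> = 2 * bessel_K \<nu> z"
    by (simp add: bessel_K_def set_lebesgue_integral_def)
  finally show ?thesis by simp
qed


section \<open>The Bessel kernel and its gradient\<close>

lemma bessel_kernel_heat:
  fixes x :: "'a::euclidean_space"
  assumes \<kappa>: "0 < \<kappa>" and d: "2 \<le> DIM('a)" and x: "x \<noteq> 0"
  shows "kernel \<kappa> x = (2 * pi) powr (- real DIM('a) / 2) / 2 *
    heat_integral (real DIM('a) / 2 - 1) (x \<bullet> x / 2) (\<kappa>\<^sup>2 / 2)"
proof -
  let ?\<nu> = "real DIM('a) / 2 - 1" and ?r = "norm x"
  have r: "0 < ?r" using x by simp
  have "heat_integral ?\<nu> (x \<bullet> x / 2) (\<kappa>\<^sup>2 / 2)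
    = (\<kappa> / ?r) powr ?\<nu> * heat_integral ?\<nu> (x \<bullet> x / 2 * (\<kappa> / ?r)) (\<kappa>\<^sup>2 / 2 / (\<kappa> / ?r))"
    by (rule heat_integral_shift) (use \<kappa> r x d in auto)
  also have "x \<bullet> x / 2 * (\<kappa> / ?r) = \<kappa> * ?r / 2"
    using r by (simp add: dot_square_norm power2_eq_square)
  also have "\<kappa>\<^sup>2 / 2 / (\<kappa> / ?r) = \<kappa> * ?r / 2"
    using \<kappa> by (simp add: power2_eq_square)
  also have "heat_integral ?\<nu> (\<kappa> * ?r / 2) (\<kappa> * ?r / 2) = 2 * bessel_K ?\<nu> (\<kappa> * ?r)"
    using bessel_K_heat_integral[of "\<kappa> * ?r" ?\<nu>] \<kappa> r by simp
  finally show ?thesis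
    using \<kappa> by (simp add: kernel_def Let_def)
qed

lemma bessel_kernel_gradient:
  fixes x :: "'a::euclidean_space"
  assumes \<kappa>: "0 < \<kappa>" and d: "2 \<le> DIM('a)" and x: "x \<noteq> 0"
  shows "gradient (kernel \<kappa>) x = - ((2 * pi) powr (- real DIM('a) / 2) / 2 *
    heat_integral (real DIM('a) / 2) ((norm x)\<^sup>2 / 2) (\<kappa>\<^sup>2 / 2)) *\<^sub>R x"
proof (rule gradient_eqI)
  let ?\<nu> = "real DIM('a) / 2 - 1" and ?A = "(2 * pi) powr (- real DIM('a) / 2) / 2"
  have xx: "0 < x \<bullet> x / 2" using x by simp
  have "((\<lambda>a. heat_integral ?\<nu> a (\<kappa>\<^sup>2 / 2)) has_derivative
      (\<lambda>h. (- heat_integral (?\<nu> + 1) (x \<bullet> x / 2) (\<kappa>\<^sup>2 / 2)) * h)) (at (x \<bullet> x / 2))"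
    using heat_integral_has_derivative[OF xx, of "\<kappa>\<^sup>2 / 2" ?\<nu>] \<kappa> unfolding has_field_derivative_def by (simp add: mult_minus_left[abs_def] fun_eq_iff)
  moreover have "((\<lambda>z. z \<bullet> z / 2) has_derivative (\<lambda>h. x \<bullet> h)) (at x)"
    by (auto intro!: derivative_eq_intros simp: inner_commute)
  ultimately have "((\<lambda>z. heat_integral ?\<nu> (z \<bullet> z / 2) (\<kappa>\<^sup>2 / 2)) has_derivative
      (\<lambda>h. (- heat_integral (?\<nu> + 1) (x \<bullet> x / 2) (\<kappa>\<^sup>2 / 2)) * (x \<bullet> h))) (at x)"
    by (rule has_derivative_compose[where f = "\<lambda>z. z \<bullet> z / 2" and g = "\<lambda>a. heat_integral ?\<nu> a (\<kappa>\<^sup>2 / 2)", rotated])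
  then have "((\<lambda>z. ?A * heat_integral ?\<nu> (z \<bullet> z / 2) (\<kappa>\<^sup>2 / 2)) has_derivative
      (\<lambda>h. ?A * ((- heat_integral (?\<nu> + 1) (x \<bullet> x / 2) (\<kappa>\<^sup>2 / 2)) * (x \<bullet> h)))) (at x)"
    by (rule has_derivative_mult_right)
  then have "(kernel \<kappa> has_derivative
      (\<lambda>h. ?A * ((- heat_integral (?\<nu> + 1) (x \<bullet> x / 2) (\<kappa>\<^sup>2 / 2)) * (x \<bullet> h)))) (at x)"
    by (rule has_derivative_transform_within_open[of _ _ _ _ "- {0}"])
      (use x bessel_kernel_heat[OF \<kappa> d] in auto)
  then show "(kernel \<kappa> has_derivative (\<lambda>h. (- (?A *
    heat_integral (real DIM('a) / 2) ((norm x)\<^sup>2 / 2) (\<kappa>\<^sup>2 / 2)) *\<^sub>R x) \<bullet> h)) (at x)"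
    by (simp add: power2_norm_eq_inner mult.assoc)
qed

lemma radial_kernel_mono:
  fixes C :: real
  assumes "radial_kernel TYPE('a::euclidean_space) G G' C" "C \<le> C'"
  shows "radial_kernel TYPE('a) G G' C'"
proof -
  interpret radial_kernel G G' C "TYPE('a)" by fact
  have le: "C * r powr p \<le> C' * r powr p" for r p :: real
    using assms(2) by (simp add: mult_right_mono)
  show ?thesis
  proof
    show "0 \<le> C'" using C assms(2) by simp
    show "\<bar>G r\<bar> \<le> C' * r powr (- real DIM('a))" if "0 < r" for r
      using G[OF that] le order_trans by blast
    show "\<bar>G' r\<bar> \<le> C' * r powr (- real DIM('a) - 1)" if "0 < r" for r
      using G'[OF that] le order_trans by blast
    show "\<bar>real DIM('a) * G r + r * G' r\<bar> \<le> C' * r powr (1 - real DIM('a))" if "0 < r" for r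
      using div[OF that] le order_trans by blast
  qed (rule der contG'; assumption?)+
qed

lemma bessel_radial_kernel:
  assumes d: "2 \<le> DIM('a::euclidean_space)" and \<kappa>s: "0 < \<kappa>s"
  obtains C where "0 \<le> C"
    "\<And>\<kappa>. 0 < \<kappa> \<Longrightarrow> \<kappa> \<le> \<kappa>s \<Longrightarrow> \<exists>G'. radial_kernel TYPE('a) (\<lambda>r. (2 * pi) powr (- real DIM('a) / 2) / 2 *
        heat_integral (real DIM('a) / 2) (r\<^sup>2 / 2) (\<kappa>\<^sup>2 / 2)) G' C"
proof -
  define A where "A = (2 * pi) powr (- real DIM('a) / 2) / 2"
  have A: "0 \<le> A" by (simp add: A_def)
  define \<mu> where "\<mu> = real DIM('a) / 2"
  have \<mu>: "1 \<le> \<mu>" using d by (simp add: \<mu>_def)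
  define h where "h p = heat_integral p 1 0 * 2 powr p" for p
  have h0: "0 \<le> h p" for p by (simp add: h_def heat_integral_nonneg)
  \<comment> \<open>The three summands bound \<open>G\<close>, its derivative and the divergence, in
    this order; \<open>\<kappa>s\<close> enters through the last.\<close>
  define C where "C = A * h \<mu> + A * h (\<mu> + 1) + A * sqrt 2 * \<kappa>s * h (\<mu> - 1/2)"
  have C: "A * h \<mu> \<le> C" "A * h (\<mu> + 1) \<le> C" "A * sqrt 2 * \<kappa>s * h (\<mu> - 1/2) \<le> C" "0 \<le> C"
    using A h0 \<kappa>s by (auto simp: C_def)
  have hb: "heat_integral p (r\<^sup>2 / 2) b \<le> h p * r powr (- 2 * p)" if "0 < r" "0 \<le> b" "0 < p" for p r b
  proof -
    have "(r\<^sup>2 / 2) powr (- p) = 2 powr p * r powr (- 2 * p)"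
      using that by (simp add: powr_divide powr_minus powr_powr power2_eq_square powr_mult field_simps flip: powr_add)
    then show ?thesis using heat_integral_bound[of "r\<^sup>2 / 2" b p] that by (simp add: h_def mult.assoc)
  qed
  have "radial_kernel TYPE('a) (\<lambda>r. A * heat_integral \<mu> (r\<^sup>2 / 2) (\<kappa>\<^sup>2 / 2))
      (\<lambda>r. - A * r * heat_integral (\<mu> + 1) (r\<^sup>2 / 2) (\<kappa>\<^sup>2 / 2)) C" if \<kappa>: "0 < \<kappa>" "\<kappa> \<le> \<kappa>s" for \<kappa>
  proof
    let ?b = "\<kappa>\<^sup>2 / 2"
    have b: "0 < ?b" using \<kappa> by simp
    have hder: "((\<lambda>r. heat_integral p (r\<^sup>2 / 2) ?b) has_real_derivative (- r * heat_integral (p + 1) (r\<^sup>2 / 2) ?b)) (at r)"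
      if "0 < r" for p r
    proof -
      have "((\<lambda>r. r\<^sup>2 / 2) has_real_derivative r) (at r)"
        by (auto intro!: derivative_eq_intros)
      from DERIV_chain2[OF heat_integral_has_derivative[OF _ b] this, of p] show ?thesis
        using that by (simp add: mult.commute)
    qed
    show "((\<lambda>r. A * heat_integral \<mu> (r\<^sup>2 / 2) ?b) has_real_derivative - A * r * heat_integral (\<mu> + 1) (r\<^sup>2 / 2) ?b) (at r)"
      if "0 < r" for r
      using DERIV_cmult[OF hder[OF that, of \<mu>], of A] by (simp add: mult.assoc)
    show "continuous_on {0<..} (\<lambda>r. - A * r * heat_integral (\<mu> + 1) (r\<^sup>2 / 2) ?b)"
    proof -
      have "continuous_on {0<..} (\<lambda>r. heat_integral (\<mu> + 1) (r\<^sup>2 / 2) ?b)"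
        by (intro continuous_at_imp_continuous_on ballI DERIV_isCont[OF hder]) simp
      then show ?thesis by (intro continuous_intros)
    qed
    show "\<bar>A * heat_integral \<mu> (r\<^sup>2 / 2) ?b\<bar> \<le> C * r powr (- real DIM('a))" if r: "0 < r" for r
    proof -
      have "A * heat_integral \<mu> (r\<^sup>2 / 2) ?b \<le> A * (h \<mu> * r powr (- 2 * \<mu>))"
        using hb[OF r, of ?b \<mu>] A \<mu> by (intro mult_left_mono) auto
      also have "\<dots> \<le> C * r powr (- 2 * \<mu>)"
        using mult_right_mono[OF C(1), of "r powr (- 2 * \<mu>)"] by (simp add: mult.assoc)
      finally show ?thesis using A heat_integral_nonneg by (simp add: \<mu>_def abs_mult)
    qed
    show "\<bar>- A * r * heat_integral (\<mu> + 1) (r\<^sup>2 / 2) ?b\<bar> \<le> C * r powr (- real DIM('a) - 1)" if r: "0 < r" for r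
    proof -
      have "A * heat_integral (\<mu> + 1) (r\<^sup>2 / 2) ?b \<le> A * (h (\<mu> + 1) * r powr (- 2 * (\<mu> + 1)))"
        using hb[OF r, of ?b "\<mu> + 1"] A \<mu> by (intro mult_left_mono) auto
      also have "\<dots> \<le> C * r powr (- 2 * (\<mu> + 1))"
        using mult_right_mono[OF C(2), of "r powr (- 2 * (\<mu> + 1))"] by (simp add: mult.assoc)
      finally have "A * heat_integral (\<mu> + 1) (r\<^sup>2 / 2) ?b * r \<le> C * r powr (- 2 * (\<mu> + 1)) * r"
        using r by (intro mult_right_mono) auto
      also have "\<dots> = C * (r powr (- 2 * (\<mu> + 1)) * r powr 1)" using r by simp
      also have "\<dots> = C * r powr (- 2 * (\<mu> + 1) + 1)"
        by (simp only: powr_add)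
      also have "- 2 * (\<mu> + 1) + 1 = - real DIM('a) - 1" by (simp add: \<mu>_def)
      finally show ?thesis using A heat_integral_nonneg r by (simp add: abs_mult mult_ac)
    qed
    show "\<bar>real DIM('a) * (A * heat_integral \<mu> (r\<^sup>2 / 2) ?b) + r * (- A * r * heat_integral (\<mu> + 1) (r\<^sup>2 / 2) ?b)\<bar>
        \<le> C * r powr (1 - real DIM('a))" if r: "0 < r" for r
    proof -
      let ?a = "r\<^sup>2 / 2"
      have a: "0 < ?a" using r by simp
      \<comment> \<open>The recurrence cancels the two terms of order r^(-d) and leaves kappa^2
        times an integral of lower order.\<close>
      have rec: "\<mu> * heat_integral \<mu> ?a ?b - ?a * heat_integral (\<mu> + 1) ?a ?b = - ?b * heat_integral (\<mu> - 1) ?a ?b"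
        using heat_integral_recurrence[OF a b, of \<mu>] by simp
      have "real DIM('a) * (A * heat_integral \<mu> ?a ?b) + r * (- A * r * heat_integral (\<mu> + 1) ?a ?b)
        = 2 * A * (\<mu> * heat_integral \<mu> ?a ?b - ?a * heat_integral (\<mu> + 1) ?a ?b)"
        by (simp add: \<mu>_def algebra_simps power2_eq_square)
      also have "\<dots> = - (2 * A * ?b * heat_integral (\<mu> - 1) ?a ?b)"
        unfolding rec by simp
      finally have "\<bar>real DIM('a) * (A * heat_integral \<mu> ?a ?b) + r * (- A * r * heat_integral (\<mu> + 1) ?a ?b)\<bar>
        = 2 * A * ?b * heat_integral (\<mu> - 1) ?a ?b"
        using A heat_integral_nonneg[of "\<mu> - 1" ?a ?b] by (simp add: abs_mult)
      \<comment> \<open>One factor kappa is estimated by \<open>\<kappa>s\<close>; the other, in the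
        form sqrt b, is absorbed by \<open>heat_integral_sqrt_bound\<close>.\<close>
      also have "2 * A * ?b * heat_integral (\<mu> - 1) ?a ?b = A * sqrt 2 * \<kappa> * (sqrt ?b * heat_integral (\<mu> - 1) ?a ?b)"
        using \<kappa> by (simp add: real_sqrt_divide power2_eq_square)
      also have "\<dots> \<le> A * sqrt 2 * \<kappa>s * (h (\<mu> - 1/2) * r powr (- 2 * (\<mu> - 1/2)))"
      proof (rule mult_mono)
        show "A * sqrt 2 * \<kappa> \<le> A * sqrt 2 * \<kappa>s" using A \<kappa> by (intro mult_left_mono) auto
        have "sqrt ?b * heat_integral (\<mu> - 1) ?a ?b \<le> heat_integral (\<mu> - 1 + 1/2) ?a 0"
          using heat_integral_sqrt_bound[OF a b, of "\<mu> - 1"] \<mu> by simp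
        also have "\<mu> - 1 + 1/2 = \<mu> - 1/2" by simp
        also have "heat_integral (\<mu> - 1/2) ?a 0 \<le> h (\<mu> - 1/2) * r powr (- 2 * (\<mu> - 1/2))"
          using hb[OF r, of 0 "\<mu> - 1/2"] \<mu> by simp
        finally show "sqrt ?b * heat_integral (\<mu> - 1) ?a ?b \<le> h (\<mu> - 1/2) * r powr (- 2 * (\<mu> - 1/2))" .
      qed (use A \<kappa>s b heat_integral_nonneg in auto)
      also have "\<dots> \<le> C * r powr (- 2 * (\<mu> - 1/2))"
        using mult_right_mono[OF C(3), of "r powr (- 2 * (\<mu> - 1/2))"] by (simp add: mult.assoc)
      also have "- 2 * (\<mu> - 1/2) = 1 - real DIM('a)" by (simp add: \<mu>_def)
      finally show ?thesis .
    qed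
  qed (rule C)
  then show thesis using that[OF C(4)] unfolding A_def \<mu>_def by blast
qed

section \<open>The Newton kernel, and constants uniform in kappa\<close>

lemma newton_kernel_gradient:
  fixes x :: "'a::euclidean_space"
  assumes d: "2 \<le> DIM('a)" and x: "x \<noteq> 0"
  defines "S \<equiv> if DIM('a) = 2 then 2 * pi else sphere_area DIM('a)"
  shows "gradient (kernel 0) x = - (1 / S * norm x powr (- real DIM('a))) *\<^sub>R x"
proof (rule gradient_eqI)
  have dn: "(norm has_derivative (\<lambda>h. (x \<bullet> h) / norm x)) (at x)"
    using has_derivative_norm[OF x] by (simp add: sgn_div_norm inner_commute divide_inverse mult.commute)
  have nx: "0 < norm x" using x by simp
  define g where "g r = (if DIM('a) = 2 then - 1 / (2 * pi) * ln r + (ln 2 - euler_mascheroni) / (2 * pi)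
      else r powr (2 - real DIM('a)) / ((real DIM('a) - 2) * sphere_area DIM('a)))" for r :: real
  have k: "kernel 0 z = g (norm z)" for z :: 'a
    by (simp add: kernel_def g_def Let_def)
  have "(g has_real_derivative - (1 / S * norm x powr (- real DIM('a))) * norm x) (at (norm x))"
  proof (cases "DIM('a) = 2")
    case True
    have "norm x powr (- 2) = 1 / (norm x)\<^sup>2"
      using nx by (simp add: powr_minus inverse_eq_divide)
    then show ?thesis using nx True unfolding g_def[abs_def]
      by (auto intro!: derivative_eq_intros simp: S_def power2_eq_square)
  next
    case False
    then have d2: "real DIM('a) - 2 \<noteq> 0" using d by auto
    have p: "norm x powr (2 - real DIM('a) - 1) = norm x powr (- real DIM('a)) * norm x"
    proof -
      have "norm x powr (2 - real DIM('a) - 1) = norm x powr (- real DIM('a) + 1)" by simp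
      also have "\<dots> = norm x powr (- real DIM('a)) * norm x powr 1" by (simp only: powr_add)
      finally show ?thesis using nx by simp
    qed
    have "((\<lambda>r. r powr (2 - real DIM('a)) / ((real DIM('a) - 2) * sphere_area DIM('a))) has_real_derivative
       (2 - real DIM('a)) * norm x powr (2 - real DIM('a) - 1) / ((real DIM('a) - 2) * sphere_area DIM('a))) (at (norm x))"
      using nx by (intro DERIV_cdivide has_real_derivative_powr)
    moreover have eq: "(2 - real DIM('a)) * q / ((real DIM('a) - 2) * s) = - (1 / s * q)" for q s :: real
    proof -
      have "(2 - real DIM('a)) * q / ((real DIM('a) - 2) * s) = ((2 - real DIM('a)) / (real DIM('a) - 2)) * (q / s)"
        by simp
      also have "(2 - real DIM('a)) / (real DIM('a) - 2) = - 1"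
        using d2 by (simp add: divide_eq_eq)
      finally show ?thesis by simp
    qed
    moreover have "g = (\<lambda>r. r powr (2 - real DIM('a)) / ((real DIM('a) - 2) * sphere_area DIM('a)))"
      using False by (simp add: g_def[abs_def])
    moreover have "S = sphere_area DIM('a)" using False by (simp add: S_def)
    ultimately have "(g has_real_derivative - (1 / S * norm x powr (2 - real DIM('a) - 1))) (at (norm x))"
      by (simp only: eq)
    then show ?thesis unfolding p by simp
  qed
  then have "(g has_derivative (\<lambda>t. - (1 / S * norm x powr (- real DIM('a))) * norm x * t)) (at (norm x))"
    unfolding has_field_derivative_def .
  from has_derivative_compose[where f = norm and g = g, OF dn this]
  have "(kernel 0 has_derivative (\<lambda>h. - (1 / S * norm x powr (- real DIM('a))) * norm x * ((x \<bullet> h) / norm x))) (at x)"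
    by (simp add: k[abs_def])
  then show "(kernel 0 has_derivative (\<lambda>h. (- (1 / S * norm x powr (- real DIM('a))) *\<^sub>R x) \<bullet> h)) (at x)"
    using nx by simp
qed

text \<open>The field is the gradient of a harmonic function off the origin: d G + r G' vanishes
  identically, so its divergence is a pure point mass. The factor d in the constant comes from
  \<open>G'\<close>.\<close>

lemma newton_radial_kernel:
  fixes c :: real
  assumes c: "0 \<le> c"
  shows "radial_kernel TYPE('a::euclidean_space) (\<lambda>r. c * r powr (- real DIM('a))) (\<lambda>r. c * (- real DIM('a) * r powr (- real DIM('a) - 1)))
    (c * real DIM('a))"
proof
  have d: "1 \<le> real DIM('a)" using DIM_positive[where 'a='a] by (simp add: Suc_le_eq)
  show "((\<lambda>r. c * r powr (- real DIM('a))) has_real_derivative c * (- real DIM('a) * r powr (- real DIM('a) - 1))) (at r)"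
    if "0 < r" for r
    using that by (intro DERIV_cmult has_real_derivative_powr)
  show "continuous_on {0<..} (\<lambda>r. c * (- real DIM('a) * r powr (- real DIM('a) - 1)))"
    by (intro continuous_intros) auto
  show "\<bar>c * r powr (- real DIM('a))\<bar> \<le> c * real DIM('a) * r powr (- real DIM('a))" for r
  proof -
    have "c * 1 * r powr (- real DIM('a)) \<le> c * real DIM('a) * r powr (- real DIM('a))"
      using c d by (intro mult_right_mono mult_left_mono) auto
    then show ?thesis using c by (simp add: abs_mult)
  qed
  show "\<bar>c * (- real DIM('a) * r powr (- real DIM('a) - 1))\<bar> \<le> c * real DIM('a) * r powr (- real DIM('a) - 1)" for r
    using c by (simp add: abs_mult)
  show "\<bar>real DIM('a) * (c * r powr (- real DIM('a))) + r * (c * (- real DIM('a) * r powr (- real DIM('a) - 1)))\<bar>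
     \<le> c * real DIM('a) * r powr (1 - real DIM('a))" if r: "0 < r" for r
  proof -
    have e: "r * r powr (- real DIM('a) - 1) = r powr (- real DIM('a))"
      using r by (simp add: powr_diff)
    have "real DIM('a) * (c * r powr (- real DIM('a))) + r * (c * (- real DIM('a) * r powr (- real DIM('a) - 1)))
      = c * real DIM('a) * (r powr (- real DIM('a)) - r * r powr (- real DIM('a) - 1))"
      by (simp add: algebra_simps)
    also have "\<dots> = 0" unfolding e by simp
    finally have z: "real DIM('a) * (c * r powr (- real DIM('a))) + r * (c * (- real DIM('a) * r powr (- real DIM('a) - 1))) = 0" .
    show ?thesis unfolding z using c by simp
  qed
qed (use c in auto)

text \<open>The sum \<open>C1 + C2\<close> serves the Bessel kernels and the Newton kernel alike.
  That one constant covers the closed range of kappa makes the existence time and all bounds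
  independent of kappa.\<close>

lemma kernels_admissible:
  fixes \<beta> \<kappa>s :: real
  assumes d: "2 \<le> DIM('a)" and \<kappa>s: "0 < \<kappa>s" and \<beta>: "0 < \<beta>" "\<beta> < 1"
  obtains C where "0 \<le> C" "\<And>\<kappa>. 0 \<le> \<kappa> \<Longrightarrow> \<kappa> \<le> \<kappa>s \<Longrightarrow> \<exists>(k :: 'a::euclidean_space \<Rightarrow> 'a) m c. admissible C \<beta> k m c \<and>
      (\<forall>x. x \<noteq> 0 \<longrightarrow> k x = - gradient (kernel \<kappa>) x)"
proof -
  obtain C1 where C1: "0 \<le> C1" "\<And>\<kappa>. 0 < \<kappa> \<Longrightarrow> \<kappa> \<le> \<kappa>s \<Longrightarrow> \<exists>G'. radial_kernel TYPE('a) (\<lambda>r. (2 * pi) powr (- real DIM('a) / 2) / 2 *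
        heat_integral (real DIM('a) / 2) (r\<^sup>2 / 2) (\<kappa>\<^sup>2 / 2)) G' C1"
    using bessel_radial_kernel[OF d \<kappa>s] by metis
  define S where "S = (if DIM('a) = 2 then 2 * pi else sphere_area DIM('a))"
  have S: "0 \<le> 1 / S" by (simp add: S_def sphere_area_def)
  define C2 where "C2 = 1 / S * real DIM('a)"
  have C2: "0 \<le> C2" using S unfolding C2_def by (intro mult_nonneg_nonneg) auto
  let ?C = "(C1 + C2) * (2 * 2 powr DIM('a) + real DIM('a) * unit_ball_vol (real DIM('a)))"
  show thesis
  proof (rule that[of ?C])
    show "0 \<le> ?C" using C1(1) C2 by (intro mult_nonneg_nonneg add_nonneg_nonneg) auto
    fix \<kappa> assume \<kappa>: "0 \<le> \<kappa>" "\<kappa> \<le> \<kappa>s"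
    obtain G G' where Gk: "radial_kernel TYPE('a) G G' (C1 + C2)"
      "\<And>x::'a. x \<noteq> 0 \<Longrightarrow> gradient (kernel \<kappa>) x = - G (norm x) *\<^sub>R x"
    proof (cases "\<kappa> = 0")
      case True
      show thesis
      proof (rule that)
        show "radial_kernel TYPE('a) (\<lambda>r. 1 / S * r powr (- real DIM('a))) (\<lambda>r. 1 / S * (- real DIM('a) * r powr (- real DIM('a) - 1))) (C1 + C2)"
          by (rule radial_kernel_mono[OF newton_radial_kernel[OF S]]) (use C1(1) in \<open>simp add: C2_def\<close>)
        show "gradient (kernel \<kappa>) x = - (1 / S * norm x powr (- real DIM('a))) *\<^sub>R x" if "x \<noteq> 0" for x :: 'a
          using newton_kernel_gradient[OF d that] True by (simp add: S_def)
      qed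
    next
      case False
      then have "0 < \<kappa>" using \<kappa> by simp
      then obtain G' where G': "radial_kernel TYPE('a) (\<lambda>r. (2 * pi) powr (- real DIM('a) / 2) / 2 *
        heat_integral (real DIM('a) / 2) (r\<^sup>2 / 2) (\<kappa>\<^sup>2 / 2)) G' C1"
        using C1(2) \<kappa> by blast
      show thesis
        by (rule that[OF radial_kernel_mono[OF G'] bessel_kernel_gradient[OF \<open>0 < \<kappa>\<close> d]]) (use C2 in auto)
    qed
    interpret radial_kernel G G' "C1 + C2" "TYPE('a)" by (rule Gk)
    obtain c where "admissible ?C \<beta> k m c" using admissible[OF \<beta>] by blast
    then show "\<exists>(k :: 'a \<Rightarrow> 'a) m c. admissible ?C \<beta> k m c \<and> (\<forall>x. x \<noteq> 0 \<longrightarrow> k x = - gradient (kernel \<kappa>) x)"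
      using Gk(2) by (intro exI[of _ k] exI[of _ m] exI[of _ c]) simp
  qed
qed

subsection \<open>The explicit scheme\<close>

lemma C1b_measurable: "C1b \<beta> M f \<Longrightarrow> f \<in> borel_measurable borel"
  by (intro borel_measurable_continuous_onI C1b_continuous)

text \<open>The sum of all weights that occur in the field estimates, so that each of them is at
  most \<open>E\<close>; the summand 1 gives E \<ge> 1.\<close>

definition field_const :: "'a::euclidean_space itself \<Rightarrow> real \<Rightarrow> real \<Rightarrow> real \<Rightarrow> real" where
  "field_const T C \<beta> R = 1 + C + 2 * C * ball_weight T (real DIM('a) - 1) R
     + 2 * C * ball_weight T (real DIM('a) - 1 + \<beta>) R"

text \<open>\<open>N\<close> is a ceiling for the C^{1,beta} constants of densities and
  \<open>E\<close> bounds the linear map from densities in the ball of radius \<open>R\<close> to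
  their fields. Then \<open>L = N * E\<close> bounds the velocity, its derivative, the Hoelder
  constant of the derivative, and the divergence, for every density below the ceiling.\<close>

locale admissible_kernel =
  fixes C \<beta> R N E :: real and k :: "'a::euclidean_space \<Rightarrow> 'a" and m :: "'a \<Rightarrow> real" and c :: real
  assumes dim: "2 \<le> DIM('a)" and \<beta>: "0 < \<beta>" "\<beta> < 1" and C: "0 \<le> C" and N: "1 \<le> N"
    and adm: "admissible C \<beta> k m c"
    and E_def: "E = field_const TYPE('a) C \<beta> R"
begin

abbreviation L where "L \<equiv> N * E"
abbreviation \<gamma> where "\<gamma> \<equiv> \<beta> / (1 + \<beta>)"

text \<open>The divergence of the velocity in the form given by the kernel identity; the equality is
  the last part of \<open>velocity_derivative\<close>. In this form no derivative falls on
  \<open>f\<close>.\<close>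

definition divu :: "('a \<Rightarrow> real) \<Rightarrow> 'a \<Rightarrow> real" where
  "divu f x = c * f x + conv f m x"

text \<open>Minus the divergence of the flux, expanded by the product rule; see
  \<open>flux_divergence\<close>.\<close>

definition rate :: "('a \<Rightarrow> real) \<Rightarrow> 'a \<Rightarrow> real" where
  "rate f x = - (gradient f x \<bullet> conv f k x) - f x * divu f x"

definition supported :: "real \<Rightarrow> ('a \<Rightarrow> real) \<Rightarrow> bool" where
  "supported r f \<longleftrightarrow> (\<forall>x. r < norm x \<longrightarrow> f x = 0)"

lemma supportedD: "supported r f \<Longrightarrow> r < norm x \<Longrightarrow> f x = 0"
  by (simp add: supported_def)

lemma supported_mono: "supported r f \<Longrightarrow> r \<le> r' \<Longrightarrow> supported r' f"
  by (simp add: supported_def)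

section \<open>Bounds for the velocity field and its divergence\<close>

lemma weights:
  "0 \<le> real DIM('a) - 1" "real DIM('a) - 1 < DIM('a)"
  "0 \<le> real DIM('a) - 1 + \<beta>" "real DIM('a) - 1 + \<beta> < DIM('a)"
  using dim \<beta> by auto

lemma k: "k \<in> borel_measurable borel" "norm (k x) \<le> C * norm x powr (- (real DIM('a) - 1))"
    "norm (k x - k y) \<le> C * norm (x - y) powr \<beta> *
        (norm x powr (- (real DIM('a) - 1 + \<beta>)) + norm y powr (- (real DIM('a) - 1 + \<beta>)))"
  and m: "m \<in> borel_measurable borel" "norm (m x) \<le> C * norm x powr (- (real DIM('a) - 1))"
  and c: "\<bar>c\<bar> \<le> C"
  using adm by (auto simp: admissible_def)

lemma E:
  "1 \<le> E" "C * ball_weight TYPE('a) (real DIM('a) - 1) R \<le> E"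
  "2 * C * ball_weight TYPE('a) (real DIM('a) - 1 + \<beta>) R \<le> E"
  "C + 2 * C * ball_weight TYPE('a) (real DIM('a) - 1) R \<le> E"
proof -
  have "0 \<le> C * ball_weight TYPE('a) a R" for a
    using C ball_weight_nonneg by (rule mult_nonneg_nonneg)
  from this[of "real DIM('a) - 1"] this[of "real DIM('a) - 1 + \<beta>"]
  show "1 \<le> E" "C * ball_weight TYPE('a) (real DIM('a) - 1) R \<le> E"
    "2 * C * ball_weight TYPE('a) (real DIM('a) - 1 + \<beta>) R \<le> E"
    "C + 2 * C * ball_weight TYPE('a) (real DIM('a) - 1) R \<le> E"
    using C by (simp_all add: E_def field_const_def)
qed

lemma L: "1 \<le> L" "N \<le> L" "E \<le> L"
  using mult_mono[of 1 N 1 E] mult_mono[of N N 1 E] mult_mono[of 1 N E E] N E(1) by auto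

lemma velocity_bound:
  assumes "f \<in> borel_measurable borel" "\<And>x. \<bar>f x\<bar> \<le> M" "supported R f"
  shows "norm (conv f k x) \<le> M * E"
proof -
  have M: "0 \<le> M" using assms(2)[of 0] by simp
  have "norm (conv f k x) \<le> M * C * ball_weight TYPE('a) (real DIM('a) - 1) R"
    by (rule conv_bound(2)[OF weights(1,2) k(1,2) C assms(1,2)]) (use assms(3) supportedD in auto)
  also have "\<dots> \<le> M * E" using E(2) M by (simp add: mult.assoc mult_left_mono)
  finally show ?thesis .
qed

lemma velocity_holder:
  assumes "f \<in> borel_measurable borel" "\<And>x. \<bar>f x\<bar> \<le> M" "supported R f"
  shows "norm (conv f k x - conv f k y) \<le> M * E * norm (x - y) powr \<beta>"
proof -
  have M: "0 \<le> M" using assms(2)[of 0] by simp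
  have "norm (conv f k x - conv f k y) \<le> 2 * M * C * ball_weight TYPE('a) (real DIM('a) - 1 + \<beta>) R * norm (x - y) powr \<beta>"
    by (rule conv_holder_kernel[OF weights(3,4) weights(1,2) k(1,2) C k(3) assms(1,2)]) (use assms(3) supportedD in auto)
  also have "\<dots> = M * (2 * C * ball_weight TYPE('a) (real DIM('a) - 1 + \<beta>) R) * norm (x - y) powr \<beta>"
    by simp
  also have "\<dots> \<le> M * E * norm (x - y) powr \<beta>"
    using E(3) M by (intro mult_right_mono mult_left_mono) auto
  finally show ?thesis .
qed

lemma divu_bound:
  assumes "f \<in> borel_measurable borel" "\<And>x. \<bar>f x\<bar> \<le> M" "supported R f"
  shows "\<bar>divu f x\<bar> \<le> M * E"
proof -
  have M: "0 \<le> M" using assms(2)[of 0] by simp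
  have 1: "norm (conv f m x) \<le> M * C * ball_weight TYPE('a) (real DIM('a) - 1) R"
    by (rule conv_bound(2)[OF weights(1,2) m C assms(1,2)]) (use assms(3) supportedD in auto)
  have 2: "\<bar>c * f x\<bar> \<le> C * M" using mult_mono[OF c assms(2)[of x]] C by (simp add: abs_mult)
  have "\<bar>divu f x\<bar> \<le> M * (C + C * ball_weight TYPE('a) (real DIM('a) - 1) R)"
    using 1 2 unfolding divu_def by (simp add: algebra_simps abs_le_iff)
  also have "C + C * ball_weight TYPE('a) (real DIM('a) - 1) R \<le> E"
    using E(4) mult_nonneg_nonneg[OF C ball_weight_nonneg[where 'a='a, of "real DIM('a) - 1" R]] by linarith
  finally show ?thesis using M mult_left_mono by blast
qed

lemma conv_k_diff:
  assumes "f \<in> borel_measurable borel" "\<And>x. \<bar>f x\<bar> \<le> M" "supported R f"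
    and "g \<in> borel_measurable borel" "\<And>x. \<bar>g x\<bar> \<le> M'" "supported R g"
  shows "conv f k x - conv g k x = conv (\<lambda>x. f x - g x) k x"
    and "divu f x - divu g x = divu (\<lambda>x. f x - g x) x"
proof -
  note f = conv_bound(1)[OF weights(1,2) _ _ C assms(1,2) supportedD[OF assms(3)], of _ R]
    and g = conv_bound(1)[OF weights(1,2) _ _ C assms(4,5) supportedD[OF assms(6)], of _ R]
  show "conv f k x - conv g k x = conv (\<lambda>x. f x - g x) k x"
    unfolding conv_def scaleR_diff_left
    by (rule Bochner_Integration.integral_diff[symmetric]) (rule f g; use k in auto)+
  have "conv f m x - conv g m x = conv (\<lambda>x. f x - g x) m x"
    unfolding conv_def scaleR_diff_left
    by (rule Bochner_Integration.integral_diff[symmetric]) (rule f g; use m in auto)+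
  then show "divu f x - divu g x = divu (\<lambda>x. f x - g x) x"
    by (simp add: divu_def algebra_simps)
qed

lemma supported_diff: "supported r f \<Longrightarrow> supported r g \<Longrightarrow> supported r (\<lambda>x. f x - g x)"
  by (simp add: supported_def)

text \<open>The derivative falls on \<open>f\<close>, so each directional derivative of the velocity
  is the field of a bounded density and inherits its Hoelder bound from the kernel. The exponent
  alpha of \<open>f\<close> is separate from that of the kernel because uniqueness is run with a
  smaller one.\<close>

lemma velocity_derivative:
  assumes f: "C1b \<alpha> M f" "0 < \<alpha>" "supported R f"
  shows "(conv f k has_derivative (\<lambda>v. conv (\<lambda>z. gradient f z \<bullet> v) k x)) (at x)"
    and "norm (conv (\<lambda>z. gradient f z \<bullet> v) k x) \<le> M * E * norm v"
    and "norm (conv (\<lambda>z. gradient f z \<bullet> v) k x - conv (\<lambda>z. gradient f z \<bullet> v) k y)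
      \<le> M * E * norm (x - y) powr \<beta> * norm v"
    and "(\<Sum>b\<in>Basis. conv (\<lambda>z. gradient f z \<bullet> b) k x \<bullet> b) = divu f x"
proof -
  show "(conv f k has_derivative (\<lambda>v. conv (\<lambda>z. gradient f z \<bullet> v) k x)) (at x)"
    by (rule conv_has_derivative[OF weights(1,2) k(1,2) C f(1) _ f(2)]) (use f(3) supportedD in auto)
  have gm[measurable]: "gradient f \<in> borel_measurable borel"
    by (intro borel_measurable_continuous_onI C1b_continuous_gradient[OF f(1,2)])
  have bd: "\<bar>gradient f z \<bullet> v\<bar> \<le> M * norm v" for z v
    using Cauchy_Schwarz_ineq2[of "gradient f z" v] C1bD(3)[OF f(1), of z]
    by (meson mult_right_mono norm_ge_zero order_trans)
  have s: "supported R (\<lambda>z. gradient f z \<bullet> v)" for v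
    using gradient_outside_support[of R f] supportedD[OF f(3)] by (simp add: supported_def)
  have meas: "(\<lambda>z. gradient f z \<bullet> v) \<in> borel_measurable borel" for v by measurable
  show "norm (conv (\<lambda>z. gradient f z \<bullet> v) k x) \<le> M * E * norm v"
    using velocity_bound[OF meas bd s, of v x] by (simp add: mult_ac)
  show "norm (conv (\<lambda>z. gradient f z \<bullet> v) k x - conv (\<lambda>z. gradient f z \<bullet> v) k y)
      \<le> M * E * norm (x - y) powr \<beta> * norm v"
    using velocity_holder[OF meas bd s, of v x y] by (simp add: mult_ac)
  have int: "integrable lborel (\<lambda>y. (gradient f (x - y) \<bullet> b) *\<^sub>R k y)" for b x
    by (rule conv_bound(1)[OF weights(1,2) k(1,2) C meas bd supportedD[OF s]])
  have "(\<Sum>b\<in>Basis. conv (\<lambda>z. gradient f z \<bullet> b) k x \<bullet> b)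
     = (\<Sum>b\<in>Basis. LINT y|lborel. (gradient f (x - y) \<bullet> b) * (k y \<bullet> b))"
    unfolding conv_def
    by (intro sum.cong refl) (use int in \<open>simp flip: integral_inner_left\<close>)
  also have "\<dots> = (LINT y|lborel. (\<Sum>b\<in>Basis. (gradient f (x - y) \<bullet> b) * (k y \<bullet> b)))"
  proof (rule Bochner_Integration.integral_sum[symmetric])
    show "integrable lborel (\<lambda>y. (gradient f (x - y) \<bullet> b) * (k y \<bullet> b))" for b
      using integrable_inner_left[OF int[of x b], of b] by simp
  qed
  also have "\<dots> = (LINT y|lborel. gradient f (x - y) \<bullet> k y)"
    by (simp only: euclidean_inner[symmetric])
  also have "\<dots> = divu f x"
    using adm f supportedD[OF f(3)] unfolding admissible_def divu_def by blast
  finally show "(\<Sum>b\<in>Basis. conv (\<lambda>z. gradient f z \<bullet> b) k x \<bullet> b) = divu f x" .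
qed

text \<open>Both the derivative and the Hoelder increment fall on \<open>f\<close>. The kernel
  \<open>m\<close> enters through its size, so the divergence is as smooth as \<open>f\<close>
  although nothing is assumed about the continuity of \<open>m\<close>.\<close>

lemma divu_C1b:
  assumes f: "C1b \<beta> M f" "supported R f"
  shows "C1b \<beta> (M * E) (divu f)"
proof -
  have M: "0 \<le> M" using C1b_nonneg f by blast
  let ?w = "ball_weight TYPE('a) (real DIM('a) - 1) R"
  have w: "0 \<le> ?w" by (rule ball_weight_nonneg)
  have gm[measurable]: "gradient f \<in> borel_measurable borel"
    by (intro borel_measurable_continuous_onI C1b_continuous_gradient[OF f(1) \<beta>(1)])
  have meas: "(\<lambda>z. gradient f z \<bullet> v) \<in> borel_measurable borel" for v by measurable
  have bd: "\<bar>gradient f z \<bullet> v\<bar> \<le> M * norm v" for z v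
    using Cauchy_Schwarz_ineq2[of "gradient f z" v] C1bD(3)[OF f(1), of z]
    by (meson mult_right_mono norm_ge_zero order_trans)
  have hol: "\<bar>gradient f y \<bullet> v - gradient f z \<bullet> v\<bar> \<le> M * norm v * norm (y - z) powr \<beta>" for y z v
  proof -
    have "\<bar>(gradient f y - gradient f z) \<bullet> v\<bar> \<le> norm (gradient f y - gradient f z) * norm v"
      by (rule Cauchy_Schwarz_ineq2)
    also have "\<dots> \<le> (M * norm (y - z) powr \<beta>) * norm v"
      using C1bD(4)[OF f(1)] by (intro mult_right_mono) auto
    finally show ?thesis by (simp add: inner_diff_left mult_ac)
  qed
  have s: "gradient f z \<bullet> v = 0" if "R < norm z" for z v
    using gradient_outside_support[of R f] supportedD[OF f(2)] that by simp
  have der: "(conv f m has_derivative (\<lambda>v. conv (\<lambda>z. gradient f z \<bullet> v) m x)) (at x)" for x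
    by (rule conv_has_derivative[OF weights(1,2) m C f(1) supportedD[OF f(2)] \<beta>(1)])
  have g: "gradient (conv f m) x \<bullet> v = conv (\<lambda>z. gradient f z \<bullet> v) m x" for x v
    by (rule gradient_inner[OF der])
  have "C1b \<beta> (M * (2 * C * ?w)) (conv f m)"
    unfolding C1b_def
  proof (intro conjI allI)
    show "conv f m differentiable at x" for x using der by (auto simp: differentiable_def)
    have le: "M * C * ?w \<le> M * (2 * C * ?w)" using M C w by simp
    have "norm (conv f m x) \<le> M * C * ?w" for x
      by (rule conv_bound(2)[OF weights(1,2) m C C1b_measurable[OF f(1)] C1bD(2)[OF f(1)] supportedD[OF f(2)]])
    then show "\<bar>conv f m x\<bar> \<le> M * (2 * C * ?w)" for x using le by (metis order_trans real_norm_def)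
    show "norm (gradient (conv f m) x) \<le> M * (2 * C * ?w)" for x
    proof (rule norm_le_by_inner)
      fix v :: 'a assume v: "norm v = 1"
      have "norm (conv (\<lambda>z. gradient f z \<bullet> v) m x) \<le> M * norm v * C * ?w"
        by (rule conv_bound(2)[OF weights(1,2) m C meas bd s])
      then show "gradient (conv f m) x \<bullet> v \<le> M * (2 * C * ?w)" using le v by (simp add: g)
    qed (use M C w in auto)
    show "norm (gradient (conv f m) x - gradient (conv f m) y) \<le> M * (2 * C * ?w) * norm (x - y) powr \<beta>" for x y
    proof (rule norm_le_by_inner)
      fix v :: 'a assume v: "norm v = 1"
      have "norm (conv (\<lambda>z. gradient f z \<bullet> v) m x - conv (\<lambda>z. gradient f z \<bullet> v) m y)
        \<le> 2 * (M * norm v) * C * ?w * norm (x - y) powr \<beta>"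
        by (rule conv_holder_density[OF weights(1,2) m C meas bd s hol]) (use M in auto)
      then show "(gradient (conv f m) x - gradient (conv f m) y) \<bullet> v \<le> M * (2 * C * ?w) * norm (x - y) powr \<beta>"
        using v by (simp add: g inner_diff_left mult_ac)
    qed (use M C w in auto)
  qed
  from C1b_add[OF C1b_cmult[OF f(1), of c] this]
  have "C1b \<beta> (\<bar>c\<bar> * M + M * (2 * C * ?w)) (divu f)"
    by (simp add: divu_def[abs_def])
  moreover have "\<bar>c\<bar> * M + M * (2 * C * ?w) \<le> M * E"
  proof -
    have "\<bar>c\<bar> * M \<le> C * M" using c M by (rule mult_right_mono)
    moreover have "M * (C + 2 * C * ?w) \<le> M * E" using E(4) M by (rule mult_left_mono)
    ultimately show ?thesis by (simp add: algebra_simps)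
  qed
  ultimately show ?thesis by (rule C1b_mono)
qed

lemma rate_outside: "supported r f \<Longrightarrow> r < norm x \<Longrightarrow> rate f x = 0"
  using gradient_outside_support[of r f x] by (simp add: rate_def supported_def)

text \<open>The rate contains the gradient of the density, which a uniform distance delta controls
  only to the power gamma. The factor 8N absorbs the coefficients 2 + 2N and 3, as N \<ge>
  1.\<close>

lemma rate_diff:
  assumes f: "C1b \<beta> N f" "supported R f" and g: "C1b \<beta> N g" "supported R g"
    and \<delta>: "0 < \<delta>" "\<And>x. \<bar>f x - g x\<bar> \<le> \<delta>"
  shows "\<bar>rate f x - rate g x\<bar> \<le> 8 * N * L * (\<delta> + \<delta> powr \<gamma>)"
proof -
  note fm = C1b_measurable[OF f(1)] and gm = C1b_measurable[OF g(1)]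
  have [measurable]: "f \<in> borel_measurable borel" "g \<in> borel_measurable borel" by (fact fm gm)+
  have dm: "(\<lambda>x. f x - g x) \<in> borel_measurable borel" by measurable
  have n1: "norm (gradient f x - gradient g x) \<le> (2 + 2 * N) * \<delta> powr \<gamma>"
    by (rule gradient_diff_interpolation[OF f(1) g(1) \<beta>(1) \<delta>])
  have u1: "norm (conv f k x) \<le> L" by (rule velocity_bound[OF fm C1bD(2)[OF f(1)] f(2)])
  have u2: "norm (conv f k x - conv g k x) \<le> \<delta> * E"
    unfolding conv_k_diff(1)[OF fm C1bD(2)[OF f(1)] f(2) gm C1bD(2)[OF g(1)] g(2)]
    by (rule velocity_bound[OF dm \<delta>(2) supported_diff[OF f(2) g(2)]])
  have d1: "\<bar>divu f x\<bar> \<le> L" by (rule divu_bound[OF fm C1bD(2)[OF f(1)] f(2)])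
  have d2: "\<bar>divu f x - divu g x\<bar> \<le> \<delta> * E"
    unfolding conv_k_diff(2)[OF fm C1bD(2)[OF f(1)] f(2) gm C1bD(2)[OF g(1)] g(2)]
    by (rule divu_bound[OF dm \<delta>(2) supported_diff[OF f(2) g(2)]])
  have N0: "0 \<le> N" "0 \<le> L" "0 \<le> E" using N L E by auto
  have "norm ((gradient f x - gradient g x) \<bullet> conv f k x) \<le> ((2 + 2 * N) * \<delta> powr \<gamma>) * L"
    by (rule order_trans[OF Cauchy_Schwarz_ineq2[THEN order_trans[OF eq_refl[OF real_norm_def]]] mult_mono[OF n1 u1]])
      (use N0 in auto)
  moreover have "norm (gradient g x \<bullet> (conv f k x - conv g k x)) \<le> N * (\<delta> * E)"
    by (rule order_trans[OF Cauchy_Schwarz_ineq2[THEN order_trans[OF eq_refl[OF real_norm_def]]] mult_mono[OF C1bD(3)[OF g(1)] u2]])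
      (use N0 in auto)
  moreover have "norm ((f x - g x) * divu f x) \<le> \<delta> * L"
    using mult_mono[OF \<delta>(2)[of x] d1] \<delta> by (simp add: abs_mult)
  moreover have "norm (g x * (divu f x - divu g x)) \<le> N * (\<delta> * E)"
    using mult_mono[OF C1bD(2)[OF g(1), of x] d2] N0 by (simp add: abs_mult)
  moreover have "rate f x - rate g x = - ((gradient f x - gradient g x) \<bullet> conv f k x)
     - gradient g x \<bullet> (conv f k x - conv g k x) - (f x - g x) * divu f x - g x * (divu f x - divu g x)"
    by (simp add: rate_def algebra_simps inner_diff_left inner_diff_right)
  ultimately have "\<bar>rate f x - rate g x\<bar> \<le> ((2 + 2 * N) * \<delta> powr \<gamma>) * L + N * (\<delta> * E) + \<delta> * L + N * (\<delta> * E)"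
    unfolding real_norm_def by linarith
  also have "\<dots> = (2 + 2 * N) * L * \<delta> powr \<gamma> + 3 * L * \<delta>" by (simp add: algebra_simps)
  also have "\<dots> \<le> 8 * N * L * \<delta> powr \<gamma> + 8 * N * L * \<delta>"
    using N N0 \<delta> by (intro add_mono mult_right_mono) auto
  finally show ?thesis by (simp add: algebra_simps)
qed


text \<open>The product form of the source term, rather than an additive one, keeps the scheme
  nonnegative.\<close>

definition step :: "real \<Rightarrow> ('a \<Rightarrow> real) \<Rightarrow> 'a \<Rightarrow> real" where
  "step h f x = (\<lambda>z. f z - h * (f z * divu f z)) (x - h *\<^sub>R conv f k x)"

text \<open>\<open>K\<close> is the growth of the C^{1,beta} constant per unit of time, with 6NL
  from the source term and the rest from the transport; \<open>L1\<close> is the Lipschitz constant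
  in time; \<open>K2\<close> is the coefficient of h^(1+beta) in the consistency error.
  \<open>N + 6 * N * L\<close> bounds the density once the source factor is applied.\<close>

abbreviation K where "K \<equiv> 6 * N * L + (N + 6 * N * L) * (3 * L + L\<^sup>2)"
abbreviation L1 where "L1 \<equiv> (N + 6 * N * L) * L + N * L"
abbreviation K2 where "K2 \<equiv> (N + 6 * N * L) * L powr (1 + \<beta>) + 6 * N * L\<^sup>2"

context
  fixes f :: "'a \<Rightarrow> real" and M h :: real
  assumes f: "C1b \<beta> M f" "supported R f" and M: "M \<le> N" and h: "0 \<le> h" "h \<le> 1"
begin

lemma M0: "0 \<le> M"
  using C1b_nonneg f by blast

lemma ME: "M * E \<le> L"
  using M E(1) by (simp add: mult_right_mono)

lemma product_C1b: "C1b \<beta> (6 * N * L) (\<lambda>z. f z * divu f z)"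
proof (rule C1b_mono[OF C1b_mult[OF f(1) divu_C1b[OF f] \<beta>(1) less_imp_le[OF \<beta>(2)]]])
  show "6 * M * (M * E) \<le> 6 * N * L"
    using M0 M ME N E(1) by (intro mult_mono) auto
qed

lemma premult_C1b: "C1b \<beta> (M + h * (6 * N * L)) (\<lambda>z. f z - h * (f z * divu f z))"
  using C1b_diff[OF f(1) C1b_cmult[OF product_C1b, of h]] h by simp

lemma premult_const: "M + h * (6 * N * L) \<le> N + 6 * N * L"
proof -
  have "h * (6 * N * L) \<le> 1 * (6 * N * L)" using h L N by (intro mult_right_mono) auto
  then show ?thesis using M by simp
qed

text \<open>The increment is \<open>h * K\<close> with \<open>K\<close> computed at the ceiling
  \<open>N\<close>, not at \<open>M\<close>, so that repeated steps add up linearly instead of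
  compounding.\<close>

lemma step_C1b: "C1b \<beta> (M + h * K) (step h f)"
proof -
  have "norm (conv (\<lambda>z. gradient f z \<bullet> v) k x) \<le> L * norm v" for x v
    using velocity_derivative(2)[OF f(1) \<beta>(1) f(2), of v x] mult_right_mono[OF ME, of "norm v"] by simp
  moreover have "norm (conv (\<lambda>z. gradient f z \<bullet> v) k x - conv (\<lambda>z. gradient f z \<bullet> v) k y)
      \<le> L * norm (x - y) powr \<beta> * norm v" for x y v
    using velocity_derivative(3)[OF f(1) \<beta>(1) f(2), of v x y]
      mult_right_mono[OF ME, of "norm (x - y) powr \<beta> * norm v"] by (simp add: mult.assoc)
  ultimately have "C1b \<beta> ((M + h * (6 * N * L)) + h * ((M + h * (6 * N * L)) * (3 * L + L\<^sup>2))) (step h f)"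
    unfolding step_def[abs_def] using \<beta> h L
    by (intro C1b_compose_flow[OF premult_C1b, where Du = "\<lambda>x v. conv (\<lambda>z. gradient f z \<bullet> v) k x"]
        velocity_derivative(1)[OF f(1) \<beta>(1) f(2)]) auto
  moreover have "h * ((M + h * (6 * N * L)) * (3 * L + L\<^sup>2)) \<le> h * ((N + 6 * N * L) * (3 * L + L\<^sup>2))"
    using premult_const h L by (intro mult_left_mono mult_right_mono) auto
  ultimately show ?thesis by (elim C1b_mono) (simp add: algebra_simps)
qed

lemma velocity_L: "norm (conv f k x) \<le> L"
  using velocity_bound[OF C1b_measurable[OF f(1)] C1bD(2)[OF f(1)] f(2)] ME by (rule order_trans)

lemma divu_L: "\<bar>divu f x\<bar> \<le> L"
  using divu_bound[OF C1b_measurable[OF f(1)] C1bD(2)[OF f(1)] f(2)] ME by (rule order_trans)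

lemma step_supported:
  assumes "supported r f"
  shows "supported (r + h * L) (step h f)"
  unfolding supported_def
proof (intro allI impI)
  fix x :: 'a assume x: "r + h * L < norm x"
  have "norm (h *\<^sub>R conv f k x) \<le> h * L" using velocity_L[of x] h by (simp add: mult_left_mono)
  then have "r < norm (x - h *\<^sub>R conv f k x)"
    using x norm_triangle_ineq2[of x "h *\<^sub>R conv f k x"] by linarith
  then show "step h f x = 0" using assms by (simp add: step_def supported_def)
qed

lemma step_nonneg:
  assumes "\<And>x. 0 \<le> f x" "h * L \<le> 1"
  shows "0 \<le> step h f x"
proof -
  let ?z = "x - h *\<^sub>R conv f k x"
  have "h * divu f ?z \<le> h * L" using divu_L[of ?z] h by (intro mult_left_mono) auto
  then have "0 \<le> f ?z * (1 - h * divu f ?z)" using assms by (intro mult_nonneg_nonneg) auto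
  then show ?thesis by (simp add: step_def algebra_simps)
qed

lemma step_close: "\<bar>step h f x - f x\<bar> \<le> h * L1"
proof -
  let ?p = "\<lambda>z. f z - h * (f z * divu f z)" and ?v = "h *\<^sub>R conv f k x"
  have "\<bar>?p (x - ?v) - ?p x\<bar> \<le> (M + h * (6 * N * L)) * norm ?v"
    using C1b_lipschitz[OF premult_C1b, of "x - ?v" x] by simp
  also have "\<dots> \<le> (N + 6 * N * L) * (h * L)"
    using premult_const velocity_L[of x] h N L M0 by (intro mult_mono) (auto intro: mult_left_mono)
  finally have 1: "\<bar>?p (x - ?v) - ?p x\<bar> \<le> h * ((N + 6 * N * L) * L)" by (simp add: mult_ac)
  have "\<bar>f x * divu f x\<bar> \<le> N * L"
    using mult_mono[OF order_trans[OF C1bD(2)[OF f(1), of x] M] divu_L[of x]] N by (simp add: abs_mult)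
  then have 2: "\<bar>?p x - f x\<bar> \<le> h * (N * L)" using h by (simp add: abs_mult mult_left_mono)
  have "\<bar>step h f x - f x\<bar> \<le> \<bar>?p (x - ?v) - ?p x\<bar> + \<bar>?p x - f x\<bar>"
    unfolding step_def by linarith
  then show ?thesis using 1 2 unfolding distrib_left by linarith
qed

text \<open>Taylor expansion along the displacement -hu has an error of order h^(1+beta). The
  gradient of the premultiplied density differs from that of \<open>f\<close> by h times the
  gradient of f div u, which contributes a term of order h^2, of no larger order since h \<le>
  1.\<close>

lemma step_consistent: "\<bar>step h f x - f x - h * rate f x\<bar> \<le> K2 * h powr (1 + \<beta>)"
proof (cases "h = 0")
  case True
  then show ?thesis by (simp add: step_def)
next
  case False
  then have h0: "0 < h" using h by simp
  let ?p = "\<lambda>z. f z - h * (f z * divu f z)" and ?u = "conv f k x"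
  have "\<bar>?p (x + (- h *\<^sub>R ?u)) - ?p x - gradient ?p x \<bullet> (- h *\<^sub>R ?u)\<bar>
     \<le> (M + h * (6 * N * L)) * norm (- h *\<^sub>R ?u) powr (1 + \<beta>)"
    by (rule C1b_taylor[OF premult_C1b \<beta>(1)])
  also have "\<dots> \<le> (N + 6 * N * L) * (h * L) powr (1 + \<beta>)"
    using premult_const velocity_L[of x] h N L M0 \<beta> by (intro mult_mono powr_mono2) (auto intro: mult_left_mono)
  also have "\<dots> = (N + 6 * N * L) * L powr (1 + \<beta>) * h powr (1 + \<beta>)"
    by (simp add: powr_mult mult_ac)
  finally have 1: "\<bar>?p (x - h *\<^sub>R ?u) - ?p x + h * (gradient ?p x \<bullet> ?u)\<bar>
     \<le> (N + 6 * N * L) * L powr (1 + \<beta>) * h powr (1 + \<beta>)" by simp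
  have gp: "gradient ?p x = gradient f x - h *\<^sub>R gradient (\<lambda>z. f z * divu f z) x"
  proof (rule gradient_eqI)
    show "(?p has_derivative (\<lambda>v. (gradient f x - h *\<^sub>R gradient (\<lambda>z. f z * divu f z) x) \<bullet> v)) (at x)"
      using has_derivative_diff[OF C1bD(5)[OF f(1), of x] has_derivative_mult_right[OF C1bD(5)[OF product_C1b, of x], of h]]
      by (simp add: inner_diff_left)
  qed
  have "\<bar>gradient (\<lambda>z. f z * divu f z) x \<bullet> ?u\<bar> \<le> 6 * N * L * L"
    by (rule order_trans[OF Cauchy_Schwarz_ineq2 mult_mono[OF C1bD(3)[OF product_C1b] velocity_L]]) (use N L in auto)
  then have "h * h * \<bar>gradient (\<lambda>z. f z * divu f z) x \<bullet> ?u\<bar> \<le> h * h * (6 * N * L\<^sup>2)"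
    using h by (intro mult_left_mono) (auto simp: power2_eq_square mult_ac)
  also have "\<dots> \<le> h powr (1 + \<beta>) * (6 * N * L\<^sup>2)"
  proof (rule mult_right_mono)
    have "h * h = h powr 1 * h powr 1" using h0 by simp
    also have "\<dots> = h powr (1 + 1)" by (simp only: powr_add)
    also have "\<dots> \<le> h powr (1 + \<beta>)" using h h0 \<beta> by (intro powr_mono') auto
    finally show "h * h \<le> h powr (1 + \<beta>)" .
  qed (use N in simp)
  finally have 2: "\<bar>h * h * (gradient (\<lambda>z. f z * divu f z) x \<bullet> ?u)\<bar> \<le> 6 * N * L\<^sup>2 * h powr (1 + \<beta>)"
    using h by (simp add: abs_mult mult_ac)
  have "step h f x - f x - h * rate f x = (?p (x - h *\<^sub>R ?u) - ?p x + h * (gradient ?p x \<bullet> ?u))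
     + h * h * (gradient (\<lambda>z. f z * divu f z) x \<bullet> ?u)"
    unfolding gp by (simp add: step_def rate_def algebra_simps inner_diff_left)
  then have "\<bar>step h f x - f x - h * rate f x\<bar> \<le> (N + 6 * N * L) * L powr (1 + \<beta>) * h powr (1 + \<beta>)
     + 6 * N * L\<^sup>2 * h powr (1 + \<beta>)"
    using 1 2 by linarith
  then show ?thesis by (simp only: distrib_right)
qed

end

end

subsection \<open>Convergence of the scheme\<close>

lemma Min_image_close:
  fixes a b :: "nat \<Rightarrow> real"
  assumes A: "finite A" "A \<noteq> {}" and ab: "\<And>n. n \<in> A \<Longrightarrow> \<bar>a n - b n\<bar> \<le> e"
  shows "\<bar>Min (a ` A) - Min (b ` A)\<bar> \<le> e"
proof -
  have *: "Min (a ` A) \<le> Min (b ` A) + e" if ab: "\<And>n. n \<in> A \<Longrightarrow> \<bar>a n - b n\<bar> \<le> e" for a b :: "nat \<Rightarrow> real"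
  proof -
    have "Min (b ` A) \<in> b ` A" using A by (intro Min_in) auto
    then obtain n where n: "n \<in> A" "Min (b ` A) = b n" by auto
    have "Min (a ` A) \<le> a n" using A n by (intro Min_le) auto
    then show ?thesis using ab[OF n(1)] n(2) by linarith
  qed
  have "Min (a ` A) \<le> Min (b ` A) + e" by (rule *) (rule ab)
  moreover have "Min (b ` A) \<le> Min (a ` A) + e"
    by (rule *) (use ab in \<open>simp add: abs_minus_commute\<close>)
  ultimately show ?thesis by linarith
qed

text \<open>The margins of 1 between \<open>M0\<close> and \<open>N\<close> and between
  \<open>R0\<close> and \<open>R\<close> are spent at the rates \<open>K\<close> and
  \<open>L\<close>; the conditions on \<open>Ts\<close> say that they are not exhausted. The last
  one also keeps the factor 1 - h div u nonnegative for h \<le> \<open>Ts\<close>.\<close>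

locale euler_scheme = admissible_kernel C \<beta> R N E k m c
  for C \<beta> R N E :: real and k :: "'a::euclidean_space \<Rightarrow> 'a" and m c +
  fixes f0 :: "'a \<Rightarrow> real" and M0 R0 Ts :: real
  assumes f0: "C1b \<beta> M0 f0" "supported R0 f0" "\<And>x. 0 \<le> f0 x"
    and M0N: "M0 + 1 \<le> N" and R0R: "R0 + 1 \<le> R"
    and Ts: "0 < Ts" "Ts * K \<le> 1" "Ts * L \<le> 1"
begin

definition iter :: "real \<Rightarrow> nat \<Rightarrow> 'a \<Rightarrow> real" where
  "iter h n = (step h ^^ n) f0"

text \<open>The bound of \<open>rate_diff\<close> at the distance \<open>L1 * \<tau>\<close> that
  the scheme can travel in time tau.\<close>

definition modulus :: "real \<Rightarrow> real" where
  "modulus \<tau> = 8 * N * L * (L1 * \<tau> + (L1 * \<tau>) powr \<gamma>)"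

lemma constants_pos: "0 \<le> K" "0 < L1" "0 \<le> K2" "0 < L" "0 < N"
  using N L by (auto intro!: add_nonneg_nonneg mult_nonneg_nonneg add_nonneg_pos)

lemma Ts1: "Ts \<le> 1"
  using Ts mult_left_mono[OF L(1), of Ts] by linarith

lemma modulus_mono: "0 \<le> s \<Longrightarrow> s \<le> t \<Longrightarrow> modulus s \<le> modulus t"
  unfolding modulus_def using constants_pos \<beta>
  by (intro mult_left_mono add_mono powr_mono2) auto

lemma modulus_nonneg: "0 \<le> s \<Longrightarrow> 0 \<le> modulus s"
  unfolding modulus_def using constants_pos by (auto intro!: mult_nonneg_nonneg add_nonneg_nonneg)

context
  fixes h :: real
  assumes h: "0 < h" "h \<le> Ts"
begin

lemma h1: "h \<le> 1" "h * L \<le> 1"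
proof -
  show "h \<le> 1" using h Ts1 by simp
  have "h * L \<le> Ts * L" using h constants_pos by (intro mult_right_mono) auto
  then show "h * L \<le> 1" using Ts by linarith
qed

text \<open>The induction is a bootstrap: the linear bound up to step n keeps the iterate below the
  ceiling, and this allows the next step to use the same \<open>K\<close> and
  \<open>L\<close>.\<close>

lemma iter_class:
  assumes "real n * h \<le> Ts"
  shows "C1b \<beta> (M0 + real n * h * K) (iter h n)" "supported (R0 + real n * h * L) (iter h n)" "0 \<le> iter h n x"
proof -
  have "C1b \<beta> (M0 + real n * h * K) (iter h n) \<and> supported (R0 + real n * h * L) (iter h n) \<and> (\<forall>x. 0 \<le> iter h n x)"
    using assms
  proof (induction n)
    case 0
    then show ?case using f0 by (simp add: iter_def)
  next
    case (Suc n)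
    then have n: "real n * h \<le> Ts" using h by (simp add: algebra_simps)
    then have IH: "C1b \<beta> (M0 + real n * h * K) (iter h n)" "supported (R0 + real n * h * L) (iter h n)" "\<And>x. 0 \<le> iter h n x"
      using Suc.IH by auto
    have "real n * h * K \<le> 1" using mult_right_mono[OF n, of K] constants_pos Ts by linarith
    then have MN: "M0 + real n * h * K \<le> N" using M0N by linarith
    have "real n * h * L \<le> 1" using mult_right_mono[OF n, of L] constants_pos Ts by linarith
    then have sR: "supported R (iter h n)" using IH(2) R0R by (elim supported_mono) simp
    note step = IH(1) sR MN less_imp_le[OF h(1)] h1(1)
    have eq: "iter h (Suc n) = step h (iter h n)" by (simp add: iter_def)
    have "C1b \<beta> (M0 + real n * h * K + h * K) (iter h (Suc n))"
      unfolding eq by (rule step_C1b[OF step])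
    moreover have "supported (R0 + real n * h * L + h * L) (iter h (Suc n))"
      unfolding eq by (rule step_supported[OF step IH(2)])
    moreover have "0 \<le> iter h (Suc n) x" for x
      unfolding eq by (rule step_nonneg[OF step IH(3) h1(2)])
    ultimately show ?case by (simp add: algebra_simps)
  qed
  then show "C1b \<beta> (M0 + real n * h * K) (iter h n)" "supported (R0 + real n * h * L) (iter h n)" "0 \<le> iter h n x"
    by auto
qed

lemma iter_N:
  assumes "real n * h \<le> Ts"
  shows "C1b \<beta> N (iter h n)" "supported R (iter h n)"
proof -
  have "real n * h * K \<le> 1" using mult_right_mono[OF assms, of K] constants_pos Ts by linarith
  then show "C1b \<beta> N (iter h n)" using iter_class(1)[OF assms] M0N by (elim C1b_mono) simp
  have "real n * h * L \<le> 1" using mult_right_mono[OF assms, of L] constants_pos Ts by linarith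
  then show "supported R (iter h n)" using iter_class(2)[OF assms] R0R by (elim supported_mono) simp
qed

lemma iter_Suc_close:
  assumes "real n * h \<le> Ts"
  shows "\<bar>iter h (Suc n) x - iter h n x\<bar> \<le> h * L1"
    "\<bar>iter h (Suc n) x - iter h n x - h * rate (iter h n) x\<bar> \<le> K2 * h powr (1 + \<beta>)"
  using step_close[OF iter_N[OF assms] order_refl less_imp_le[OF h(1)] h1(1), of x]
    step_consistent[OF iter_N[OF assms] order_refl less_imp_le[OF h(1)] h1(1), of x]
  by (simp_all add: iter_def)

lemma iter_lipschitz:
  assumes "i \<le> n" "real n * h \<le> Ts"
  shows "\<bar>iter h n x - iter h i x\<bar> \<le> (real n - real i) * h * L1"
  using assms
proof (induction n rule: dec_induct)
  case (step n)
  then have "real n * h \<le> Ts" using h by (simp add: algebra_simps)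
  then show ?case using step.IH iter_Suc_close(1)[of n x] by (simp add: algebra_simps)
qed simp

lemma iter_lipschitz':
  assumes "real i * h \<le> Ts" "real n * h \<le> Ts"
  shows "\<bar>iter h n x - iter h i x\<bar> \<le> \<bar>real n * h - real i * h\<bar> * L1"
proof (cases "i \<le> n")
  case True
  then show ?thesis using iter_lipschitz[OF True assms(2), of x] h
    by (simp add: left_diff_distrib[symmetric] abs_mult)
next
  case False
  then have "n \<le> i" by simp
  then show ?thesis using iter_lipschitz[OF _ assms(1), of n x] h
    by (simp add: left_diff_distrib[symmetric] abs_mult abs_minus_commute)
qed

text \<open>The n - i one-step errors add up, and the rate at each intermediate iterate is replaced
  by the rate at iterate i at the cost of the modulus of the elapsed time.\<close>

lemma iter_consistent:
  assumes "i \<le> n" "real n * h \<le> Ts"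
  shows "\<bar>iter h n x - iter h i x - (real n - real i) * h * rate (iter h i) x\<bar>
    \<le> (real n - real i) * h * (K2 * h powr \<beta> + modulus ((real n - real i) * h))"
  using assms
proof (induction n rule: dec_induct)
  case (step n)
  let ?D = "\<lambda>n. real n - real i"
  have n: "real n * h \<le> Ts" using step.prems h by (simp add: algebra_simps)
  have "real i * h \<le> real n * h" using step(1) h by (intro mult_right_mono) auto
  then have i: "real i * h \<le> Ts" using n by simp
  have D: "0 \<le> ?D n" using step by simp
  have mm: "modulus (?D n * h) \<le> modulus (?D (Suc n) * h)"
    using D h by (intro modulus_mono) (auto simp: algebra_simps)
  have r: "\<bar>rate (iter h n) x - rate (iter h i) x\<bar> \<le> modulus (?D (Suc n) * h)"
  proof -
    \<comment> \<open>The elapsed time is counted to \<open>Suc n\<close>: counted to n it would be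
      zero for n = i, and \<open>rate_diff\<close> requires a positive distance.\<close>
    let ?\<delta> = "L1 * (?D (Suc n) * h)"
    have "\<bar>iter h n x - iter h i x\<bar> \<le> ?\<delta>" for x
    proof -
      have "?D n * h * L1 \<le> ?D (Suc n) * h * L1" using h constants_pos by (intro mult_right_mono) auto
      then show ?thesis using iter_lipschitz[OF step(1) n, of x] by (simp add: mult_ac)
    qed
    moreover have "0 < ?\<delta>" using h constants_pos D by (intro mult_pos_pos) auto
    ultimately show ?thesis
      unfolding modulus_def by (intro rate_diff iter_N n i)
  qed
  have hh: "K2 * h powr (1 + \<beta>) = h * (K2 * h powr \<beta>)" using h by (simp add: powr_add)
  have "\<bar>h * (rate (iter h n) x - rate (iter h i) x)\<bar> \<le> h * modulus (?D (Suc n) * h)"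
    using r h by (simp add: abs_mult mult_left_mono)
  moreover have "\<bar>iter h (Suc n) x - iter h n x - h * rate (iter h n) x\<bar> \<le> h * (K2 * h powr \<beta>)"
    using iter_Suc_close(2)[OF n, of x] by (simp only: hh)
  moreover have "?D n * h * (K2 * h powr \<beta> + modulus (?D n * h)) \<le> ?D n * h * (K2 * h powr \<beta> + modulus (?D (Suc n) * h))"
    using D h mm by (intro mult_left_mono) auto
  moreover have "iter h (Suc n) x - iter h i x - ?D (Suc n) * h * rate (iter h i) x
    = (iter h n x - iter h i x - ?D n * h * rate (iter h i) x)
      + (iter h (Suc n) x - iter h n x - h * rate (iter h n) x)
      + h * (rate (iter h n) x - rate (iter h i) x)"
    by (simp add: algebra_simps)
  moreover have "?D (Suc n) * h * (K2 * h powr \<beta> + modulus (?D (Suc n) * h))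
    = ?D n * h * (K2 * h powr \<beta> + modulus (?D (Suc n) * h)) + h * (K2 * h powr \<beta>) + h * modulus (?D (Suc n) * h)"
    by (simp add: algebra_simps)
  ultimately show ?case using step.IH[OF n] by linarith
qed simp

end

text \<open>The infimal convolution in time turns the piecewise constant interpolation into a Lipschitz
  one, to which the Arzela--Ascoli theorem applies.\<close>

definition hs :: "nat \<Rightarrow> real" where "hs j = Ts / real (Suc j)"

definition smoothed :: "nat \<Rightarrow> real \<times> 'a \<Rightarrow> real" where
  "smoothed j p = Min ((\<lambda>n. iter (hs j) n (snd p) + L1 * \<bar>fst p - real n * hs j\<bar>) ` {..Suc j})"

definition slot :: "nat \<Rightarrow> real \<Rightarrow> nat" where
  "slot j t = nat \<lfloor>t / hs j\<rfloor>"

lemma hs: "0 < hs j" "hs j \<le> Ts" "n \<le> Suc j \<Longrightarrow> real n * hs j \<le> Ts"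
proof -
  show "0 < hs j" using Ts by (simp add: hs_def)
  show "hs j \<le> Ts" using Ts by (simp add: hs_def divide_le_eq)
  assume "n \<le> Suc j"
  then have "real n * hs j \<le> real (Suc j) * hs j" using \<open>0 < hs j\<close> by (intro mult_right_mono) auto
  then show "real n * hs j \<le> Ts" by (simp add: hs_def)
qed

lemma hs_lim: "hs \<longlonglongrightarrow> 0"
proof -
  have "(\<lambda>n. Ts * inverse (real (Suc n))) \<longlonglongrightarrow> Ts * 0"
    by (intro tendsto_mult tendsto_const LIMSEQ_inverse_real_of_nat)
  then show ?thesis by (simp add: hs_def[abs_def] divide_inverse)
qed

lemma slot:
  assumes "0 \<le> t" "t \<le> Ts"
  shows "real (slot j t) * hs j \<le> t" "t \<le> real (slot j t) * hs j + hs j" "slot j t \<le> Suc j"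
proof -
  have fl: "of_int \<lfloor>t / hs j\<rfloor> \<le> t / hs j" "t / hs j \<le> of_int \<lfloor>t / hs j\<rfloor> + 1" "0 \<le> \<lfloor>t / hs j\<rfloor>"
    using assms hs(1)[of j] by (auto simp: le_floor_iff intro: less_imp_le)
  have s: "real (slot j t) = of_int \<lfloor>t / hs j\<rfloor>" using fl(3) by (simp add: slot_def)
  show 1: "real (slot j t) * hs j \<le> t" unfolding s by (rule pos_le_divide_eq[THEN iffD1, OF hs(1) fl(1)])
  show "t \<le> real (slot j t) * hs j + hs j" using pos_divide_le_eq[THEN iffD1, OF hs(1) fl(2)] unfolding s by (simp add: algebra_simps)
  have "real (slot j t) * hs j \<le> real (Suc j) * hs j" using 1 assms by (simp add: hs_def)
  then show "slot j t \<le> Suc j" using hs(1)[of j] by simp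
qed

lemma slot_lim:
  assumes "0 \<le> t" "t \<le> Ts"
  shows "(\<lambda>j. real (slot j t) * hs j) \<longlonglongrightarrow> t"
proof -
  have "(\<lambda>j. real (slot j t) * hs j - t) \<longlonglongrightarrow> 0"
  proof (rule Lim_null_comparison[OF _ hs_lim])
    show "\<forall>\<^sub>F j in sequentially. norm (real (slot j t) * hs j - t) \<le> hs j"
      using slot[OF assms] by (intro always_eventually allI) (auto simp: abs_le_iff algebra_simps)
  qed
  then show ?thesis by (simp add: LIM_zero_iff)
qed

lemma slot_N:
  assumes "0 \<le> t" "t \<le> Ts"
  shows "C1b \<beta> N (iter (hs j) (slot j t))" "supported R (iter (hs j) (slot j t))"
    "0 \<le> iter (hs j) (slot j t) x"
  using iter_N[OF hs(1,2) hs(3)] iter_class(3)[OF hs(1,2) hs(3)] slot(3)[OF assms] by auto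

text \<open>The penalty slope equals the Lipschitz constant of the iterates in time, so no index can
  undercut the current slot by more than the change over one time step.\<close>

lemma smoothed_close:
  assumes "0 \<le> t" "t \<le> Ts"
  shows "\<bar>smoothed j (t, x) - iter (hs j) (slot j t) x\<bar> \<le> L1 * hs j"
proof -
  let ?g = "\<lambda>n. iter (hs j) n x + L1 * \<bar>t - real n * hs j\<bar>"
  note s = slot[OF assms, of j]
  have "L1 * \<bar>t - real (slot j t) * hs j\<bar> \<le> L1 * hs j"
    using s constants_pos by (intro mult_left_mono) auto
  moreover have "Min (?g ` {..Suc j}) \<le> ?g (slot j t)"
    by (intro Min_le finite_imageI imageI) (use s in auto)
  moreover have "iter (hs j) (slot j t) x - L1 * hs j \<le> Min (?g ` {..Suc j})"
  proof -
    have "iter (hs j) (slot j t) x - L1 * hs j \<le> ?g n" if n: "n \<le> Suc j" for n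
    proof -
      have "\<bar>iter (hs j) n x - iter (hs j) (slot j t) x\<bar> \<le> \<bar>real n * hs j - real (slot j t) * hs j\<bar> * L1"
        by (rule iter_lipschitz'[OF hs(1,2) hs(3)[OF s(3)] hs(3)[OF n]])
      also have "\<dots> \<le> (\<bar>t - real n * hs j\<bar> + hs j) * L1"
        using s constants_pos by (intro mult_right_mono) auto
      finally show ?thesis by (simp add: algebra_simps abs_le_iff)
    qed
    then show ?thesis by (intro Min.boundedI) auto
  qed
  moreover have "smoothed j (t, x) = Min (?g ` {..Suc j})" by (simp add: smoothed_def)
  ultimately show ?thesis by linarith
qed

lemma smoothed_lipschitz:
  "\<bar>smoothed j p - smoothed j q\<bar> \<le> (L1 + N) * norm (p - q)"
  unfolding smoothed_def
proof (rule Min_image_close)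
  fix n assume "n \<in> {..Suc j}"
  then have "C1b \<beta> N (iter (hs j) n)" using iter_N(1)[OF hs(1,2) hs(3)] by auto
  then have "\<bar>iter (hs j) n (snd p) - iter (hs j) n (snd q)\<bar> \<le> N * norm (snd (p - q))"
    using C1b_lipschitz by fastforce
  also have "\<dots> \<le> N * norm (p - q)"
    using N norm_snd_le[of "snd (p - q)" "fst (p - q)"] unfolding prod.collapse by (intro mult_left_mono) auto
  finally have 1: "\<bar>iter (hs j) n (snd p) - iter (hs j) n (snd q)\<bar> \<le> N * norm (p - q)" .
  have "\<bar>\<bar>fst p - real n * hs j\<bar> - \<bar>fst q - real n * hs j\<bar>\<bar> \<le> norm (fst (p - q))" by simp
  also have "\<dots> \<le> norm (p - q)"
    using norm_fst_le[of "fst (p - q)" "snd (p - q)"] unfolding prod.collapse .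
  finally have "L1 * \<bar>\<bar>fst p - real n * hs j\<bar> - \<bar>fst q - real n * hs j\<bar>\<bar> \<le> L1 * norm (p - q)"
    using constants_pos by (intro mult_left_mono) auto
  then have "\<bar>L1 * \<bar>fst p - real n * hs j\<bar> - L1 * \<bar>fst q - real n * hs j\<bar>\<bar> \<le> L1 * norm (p - q)"
    using constants_pos(2) by (simp only: right_diff_distrib[symmetric] abs_mult abs_of_pos)
  with 1 show "\<bar>(iter (hs j) n (snd p) + L1 * \<bar>fst p - real n * hs j\<bar>)
     - (iter (hs j) n (snd q) + L1 * \<bar>fst q - real n * hs j\<bar>)\<bar> \<le> (L1 + N) * norm (p - q)"
    unfolding distrib_right[of L1 N] by linarith
qed auto

lemma limit_exists:
  obtains \<rho> r where "strict_mono (r :: nat \<Rightarrow> nat)"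
    "\<And>e. 0 < e \<Longrightarrow> \<exists>J. \<forall>j\<ge>J. \<forall>t\<in>{0..Ts}. \<forall>x. \<bar>iter (hs (r j)) (slot (r j) t) x - \<rho> t x\<bar> \<le> e"
proof -
  let ?S = "{0..Ts} \<times> cball (0::'a) R"
  have "compact ?S" by (intro compact_Times compact_Icc compact_cball)
  moreover have "norm (smoothed j p) \<le> N + L1 * Ts" if "p \<in> ?S" for j p
  proof -
    obtain t x where p: "p = (t, x)" by (cases p)
    have t: "0 \<le> t" "t \<le> Ts" using that p by auto
    have "\<bar>iter (hs j) (slot j t) x\<bar> \<le> N" by (rule C1bD(2)[OF slot_N(1)[OF t]])
    moreover have "L1 * hs j \<le> L1 * Ts" using hs(2) constants_pos by (intro mult_left_mono) auto
    ultimately show ?thesis using smoothed_close[OF t, of j x] p by (simp add: abs_le_iff)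
  qed
  moreover have "\<exists>d. 0 < d \<and> (\<forall>n y. y \<in> ?S \<and> norm (p - y) < d \<longrightarrow> norm (smoothed n p - smoothed n y) < e)"
    if "p \<in> ?S" "0 < e" for p e
  proof (intro exI conjI allI impI)
    have pos: "0 < L1 + N" using constants_pos by simp
    show "0 < e / (L1 + N)" using that pos by simp
    fix n y assume "y \<in> ?S \<and> norm (p - y) < e / (L1 + N)"
    then have "(L1 + N) * norm (p - y) < e" using pos by (simp add: pos_less_divide_eq mult.commute)
    then show "norm (smoothed n p - smoothed n y) < e"
      using smoothed_lipschitz[of n p y] by simp
  qed
  ultimately obtain g r where gr: "continuous_on ?S g" "strict_mono (r :: nat \<Rightarrow> nat)"
     "\<And>e. 0 < e \<Longrightarrow> \<exists>J. \<forall>n x. n \<ge> J \<and> x \<in> ?S \<longrightarrow> norm (smoothed (r n) x - g x) < e"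
    using Arzela_Ascoli[of ?S smoothed "N + L1 * Ts"] by blast
  \<comment> \<open>All iterates vanish outside the ball, so extension by 0 turns uniform
    convergence on the compact set into uniform convergence on the whole space.\<close>
  define \<rho> where "\<rho> t x = (if norm x \<le> R then g (t, x) else 0)" for t x
  show thesis
  proof (rule that[OF gr(2)])
    fix e :: real assume e: "0 < e"
    obtain J1 where J1: "\<forall>n x. n \<ge> J1 \<and> x \<in> ?S \<longrightarrow> norm (smoothed (r n) x - g x) < e / 2"
      using gr(3)[of "e / 2"] e half_gt_zero by blast
    have "(\<lambda>j. L1 * hs (r j)) \<longlonglongrightarrow> L1 * 0"
      by (intro tendsto_mult tendsto_const) (use LIMSEQ_subseq_LIMSEQ[OF hs_lim gr(2)] in \<open>simp add: comp_def\<close>)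
    then have "\<forall>\<^sub>F j in sequentially. L1 * hs (r j) < e / 2"
      using e by (intro order_tendstoD) auto
    then obtain J2 where J2: "\<And>j. j \<ge> J2 \<Longrightarrow> L1 * hs (r j) < e / 2"
      by (auto simp: eventually_sequentially)
    have "\<bar>iter (hs (r j)) (slot (r j) t) x - \<rho> t x\<bar> \<le> e" if j: "j \<ge> max J1 J2" and t: "t \<in> {0..Ts}" for j t x
    proof (cases "norm x \<le> R")
      case True
      then have "(t, x) \<in> ?S" using t by auto
      then have "norm (smoothed (r j) (t, x) - g (t, x)) < e / 2" using J1 j by auto
      moreover have "\<bar>smoothed (r j) (t, x) - iter (hs (r j)) (slot (r j) t) x\<bar> < e / 2"
        using smoothed_close[of t "r j" x] J2[of j] j t by auto
      moreover have "\<rho> t x = g (t, x)" using True by (simp add: \<rho>_def)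
      ultimately show ?thesis unfolding real_norm_def by linarith
    next
      case False
      then show ?thesis using supportedD[OF slot_N(2)] t e by (auto simp: \<rho>_def)
    qed
    then show "\<exists>J. \<forall>j\<ge>J. \<forall>t\<in>{0..Ts}. \<forall>x. \<bar>iter (hs (r j)) (slot (r j) t) x - \<rho> t x\<bar> \<le> e"
      by blast
  qed
qed

text \<open>The bounds are closed under uniform limits. In the consistency estimate the scheme error
  \<open>K2 * hs j powr \<beta>\<close> disappears, and the rates converge because
  \<open>rate_diff\<close> makes the rate continuous for uniform convergence under a common
  C^{1,beta} bound.\<close>

theorem euler_limit:
  obtains \<rho> where "\<rho> 0 = f0" "\<And>t. 0 \<le> t \<Longrightarrow> t \<le> Ts \<Longrightarrow> C1b \<beta> N (\<rho> t)"
    "\<And>t. 0 \<le> t \<Longrightarrow> t \<le> Ts \<Longrightarrow> supported R (\<rho> t)" "\<And>t x. 0 \<le> t \<Longrightarrow> t \<le> Ts \<Longrightarrow> 0 \<le> \<rho> t x"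
    "\<And>s t x. 0 \<le> s \<Longrightarrow> s \<le> t \<Longrightarrow> t \<le> Ts \<Longrightarrow> \<bar>\<rho> t x - \<rho> s x\<bar> \<le> L1 * (t - s)"
    "\<And>s t x. 0 \<le> s \<Longrightarrow> s \<le> t \<Longrightarrow> t \<le> Ts \<Longrightarrow> \<bar>\<rho> t x - \<rho> s x - (t - s) * rate (\<rho> s) x\<bar> \<le> (t - s) * modulus (t - s)"
proof -
  obtain \<rho> r where r: "strict_mono (r :: nat \<Rightarrow> nat)"
    and unif: "\<And>e. 0 < e \<Longrightarrow> \<exists>J. \<forall>j\<ge>J. \<forall>t\<in>{0..Ts}. \<forall>x. \<bar>iter (hs (r j)) (slot (r j) t) x - \<rho> t x\<bar> \<le> e"
    using limit_exists by metis
  define a where "a j t = iter (hs (r j)) (slot (r j) t)" for j t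
  have lim: "(\<lambda>j. a j t x) \<longlonglongrightarrow> \<rho> t x" if t: "0 \<le> t" "t \<le> Ts" for t x
    unfolding lim_sequentially dist_real_def a_def
  proof (intro allI impI)
    fix e :: real assume "0 < e"
    then obtain J where J: "\<forall>j\<ge>J. \<forall>t\<in>{0..Ts}. \<forall>x. \<bar>iter (hs (r j)) (slot (r j) t) x - \<rho> t x\<bar> \<le> e / 2"
      using unif[of "e / 2"] by auto
    then show "\<exists>no. \<forall>n\<ge>no. \<bar>iter (hs (r n)) (slot (r n) t) x - \<rho> t x\<bar> < e"
      using t \<open>0 < e\<close> by (intro exI[of _ J] allI impI) (smt (verit) atLeastAtMost_iff field_sum_of_halves)
  qed
  have aN: "C1b \<beta> N (a j t)" "supported R (a j t)" "0 \<le> a j t x" if "0 \<le> t" "t \<le> Ts" for j t x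
    using slot_N[OF that] by (auto simp: a_def)
  have hr: "(\<lambda>j. hs (r j)) \<longlonglongrightarrow> 0"
    using LIMSEQ_subseq_LIMSEQ[OF hs_lim r] by (simp add: comp_def)
  have sr: "(\<lambda>j. real (slot (r j) t) * hs (r j)) \<longlonglongrightarrow> t" if "0 \<le> t" "t \<le> Ts" for t
    using LIMSEQ_subseq_LIMSEQ[OF slot_lim[OF that] r] by (simp add: comp_def)
  have \<rho>N: "C1b \<beta> N (\<rho> t)" if t: "0 \<le> t" "t \<le> Ts" for t
  proof (rule C1b_uniform_limit[OF aN(1)[OF t] \<beta>(1)])
    show "uniform_limit UNIV (\<lambda>j. a j t) (\<rho> t) sequentially"
    proof (rule uniform_limitI)
      fix e :: real assume "0 < e"
      then obtain J where J: "\<forall>j\<ge>J. \<forall>t\<in>{0..Ts}. \<forall>x. \<bar>iter (hs (r j)) (slot (r j) t) x - \<rho> t x\<bar> \<le> e / 2"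
        using unif[of "e / 2"] by auto
      show "\<forall>\<^sub>F j in sequentially. \<forall>x\<in>UNIV. dist (a j t x) (\<rho> t x) < e"
        using eventually_ge_at_top[of J]
      proof eventually_elim
        case (elim j)
        have "\<bar>a j t x - \<rho> t x\<bar> < e" for x
        proof -
          have "\<bar>a j t x - \<rho> t x\<bar> \<le> e / 2" using J elim t unfolding a_def by auto
          then show ?thesis using \<open>0 < e\<close> by linarith
        qed
        then show ?case by (simp add: dist_real_def)
      qed
    qed
  qed
  have \<rho>R: "supported R (\<rho> t)" if t: "0 \<le> t" "t \<le> Ts" for t
    unfolding supported_def
  proof (intro allI impI)
    fix x :: 'a assume "R < norm x"
    then have "(\<lambda>j. a j t x) = (\<lambda>_. 0)" using supportedD[OF aN(2)[OF t]] by auto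
    then show "\<rho> t x = 0" using lim[OF t, of x] by (simp add: LIMSEQ_const_iff)
  qed
  have a0: "a j 0 = f0" for j
    by (simp add: a_def slot_def iter_def)
  have "\<rho> 0 x = f0 x" for x
    using lim[of 0 x] Ts by (simp add: a0 LIMSEQ_const_iff)
  then have "\<rho> 0 = f0" by auto
  moreover have "0 \<le> \<rho> t x" if t: "0 \<le> t" "t \<le> Ts" for t x
    by (rule LIMSEQ_le_const[OF lim[OF t]]) (use aN(3)[OF t] in auto)
  moreover have "\<bar>\<rho> t x - \<rho> s x\<bar> \<le> L1 * (t - s)" if st: "0 \<le> s" "s \<le> t" "t \<le> Ts" for s t x
  proof (rule LIMSEQ_le[of "\<lambda>j. \<bar>a j t x - a j s x\<bar>" _ "\<lambda>j. \<bar>real (slot (r j) t) * hs (r j) - real (slot (r j) s) * hs (r j)\<bar> * L1"])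
    have s': "s \<le> Ts" and t': "0 \<le> t" using st by auto
    show "(\<lambda>j. \<bar>a j t x - a j s x\<bar>) \<longlonglongrightarrow> \<bar>\<rho> t x - \<rho> s x\<bar>"
      using lim st s' t' by (intro tendsto_intros) auto
    have "(\<lambda>j. \<bar>real (slot (r j) t) * hs (r j) - real (slot (r j) s) * hs (r j)\<bar> * L1) \<longlonglongrightarrow> \<bar>t - s\<bar> * L1"
      using sr st s' t' by (intro tendsto_intros) auto
    then show "(\<lambda>j. \<bar>real (slot (r j) t) * hs (r j) - real (slot (r j) s) * hs (r j)\<bar> * L1) \<longlonglongrightarrow> L1 * (t - s)"
      using st by (simp add: mult.commute)
    show "\<exists>J. \<forall>j\<ge>J. \<bar>a j t x - a j s x\<bar> \<le> \<bar>real (slot (r j) t) * hs (r j) - real (slot (r j) s) * hs (r j)\<bar> * L1"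
      unfolding a_def
      by (intro exI[of _ 0] allI impI
          iter_lipschitz'[OF hs(1,2) hs(3)[OF slot(3)[OF st(1) s']] hs(3)[OF slot(3)[OF t' st(3)]]])
  qed
  moreover have "\<bar>\<rho> t x - \<rho> s x - (t - s) * rate (\<rho> s) x\<bar> \<le> (t - s) * modulus (t - s)"
    if st: "0 \<le> s" "s \<le> t" "t \<le> Ts" for s t x
  proof -
    have s': "s \<le> Ts" and t': "0 \<le> t" using st by auto
    define \<tau> where "\<tau> j = (real (slot (r j) t) - real (slot (r j) s)) * hs (r j)" for j
    have \<tau>: "\<tau> \<longlonglongrightarrow> t - s"
      unfolding \<tau>_def left_diff_distrib using sr st s' t' by (intro tendsto_intros) auto
    have rl: "(\<lambda>j. rate (a j s) x) \<longlonglongrightarrow> rate (\<rho> s) x"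
      unfolding lim_sequentially
    proof (intro allI impI)
      fix e :: real assume e: "0 < e"
      have "((\<lambda>\<delta>. 8 * N * L * (\<delta> + \<delta> powr \<gamma>)) \<longlongrightarrow> 8 * N * L * (0 + 0)) (at_right 0)"
      proof -
        have "\<forall>\<^sub>F x in at_right 0. 0 \<le> (x::real)"
          using eventually_at_right_less[of "0::real"] by (rule eventually_mono) simp
        then have "((\<lambda>\<delta>::real. \<delta> powr \<gamma>) \<longlongrightarrow> 0 powr \<gamma>) (at_right 0)"
          using \<beta> by (intro tendsto_powr' tendsto_ident_at tendsto_const) auto
        then show ?thesis by (intro tendsto_intros) simp_all
      qed
      then have "\<forall>\<^sub>F \<delta> in at_right 0. 8 * N * L * (\<delta> + \<delta> powr \<gamma>) < e"
        using e by (intro order_tendstoD(2)) auto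
      then obtain b where b: "b > 0" "\<forall>y>0. y < b \<longrightarrow> 8 * N * L * (y + y powr \<gamma>) < e"
        unfolding eventually_at_right_field by auto
      then have "8 * N * L * (b / 2 + (b / 2) powr \<gamma>) < e" by simp
      then obtain \<delta> where \<delta>: "0 < \<delta>" "8 * N * L * (\<delta> + \<delta> powr \<gamma>) < e" using b(1) half_gt_zero by blast
      obtain J where J: "\<forall>j\<ge>J. \<forall>t\<in>{0..Ts}. \<forall>x. \<bar>iter (hs (r j)) (slot (r j) t) x - \<rho> t x\<bar> \<le> \<delta>"
        using unif[OF \<delta>(1)] by blast
      have "dist (rate (a j s) x) (rate (\<rho> s) x) < e" if "j \<ge> J" for j
      proof -
        have "\<bar>a j s y - \<rho> s y\<bar> \<le> \<delta>" for y using J that st s' by (auto simp: a_def)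
        then have "\<bar>rate (a j s) x - rate (\<rho> s) x\<bar> \<le> 8 * N * L * (\<delta> + \<delta> powr \<gamma>)"
          using aN st s' \<rho>N \<rho>R \<delta> by (intro rate_diff) auto
        then show ?thesis using \<delta>(2) by (simp add: dist_real_def)
      qed
      then show "\<exists>no. \<forall>n\<ge>no. dist (rate (a n s) x) (rate (\<rho> s) x) < e" by blast
    qed
    have slots: "slot (r j) s \<le> slot (r j) t" for j
    proof -
      have "s / hs (r j) \<le> t / hs (r j)" using st hs(1) by (intro divide_right_mono) (auto intro: less_imp_le)
      then show ?thesis unfolding slot_def by (intro nat_mono floor_mono)
    qed
    show ?thesis
    proof (rule LIMSEQ_le[of "\<lambda>j. \<bar>a j t x - a j s x - \<tau> j * rate (a j s) x\<bar>" _ "\<lambda>j. \<tau> j * (K2 * hs (r j) powr \<beta> + modulus (\<tau> j))"])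
      show "(\<lambda>j. \<bar>a j t x - a j s x - \<tau> j * rate (a j s) x\<bar>) \<longlonglongrightarrow> \<bar>\<rho> t x - \<rho> s x - (t - s) * rate (\<rho> s) x\<bar>"
        using lim \<tau> rl st s' t' by (intro tendsto_intros) auto
      have \<tau>0: "0 \<le> \<tau> j" for j unfolding \<tau>_def using slots[of j] hs(1)[of "r j"] by (intro mult_nonneg_nonneg) auto
      have h0: "\<forall>\<^sub>F j in sequentially. 0 \<le> hs (r j)" using hs(1) by (intro always_eventually allI) (auto intro: less_imp_le)
      have A: "(\<lambda>j. hs (r j) powr \<beta>) \<longlonglongrightarrow> 0 powr \<beta>"
        by (rule tendsto_powr'[OF hr tendsto_const]) (use h0 \<beta> in auto)
      have B: "(\<lambda>j. (L1 * \<tau> j) powr \<gamma>) \<longlonglongrightarrow> (L1 * (t - s)) powr \<gamma>"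
        by (rule tendsto_powr'[OF tendsto_mult[OF tendsto_const \<tau>] tendsto_const])
          (use \<tau>0 constants_pos \<beta> in \<open>auto intro!: always_eventually\<close>)
      have "(\<lambda>j. \<tau> j * (K2 * hs (r j) powr \<beta> + 8 * N * L * (L1 * \<tau> j + (L1 * \<tau> j) powr \<gamma>)))
         \<longlonglongrightarrow> (t - s) * (K2 * 0 powr \<beta> + 8 * N * L * (L1 * (t - s) + (L1 * (t - s)) powr \<gamma>))"
        by (rule tendsto_mult[OF \<tau> tendsto_add[OF tendsto_mult[OF tendsto_const A]
              tendsto_mult[OF tendsto_const tendsto_add[OF tendsto_mult[OF tendsto_const \<tau>] B]]]])
      then show "(\<lambda>j. \<tau> j * (K2 * hs (r j) powr \<beta> + modulus (\<tau> j))) \<longlonglongrightarrow> (t - s) * modulus (t - s)"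
        by (simp add: modulus_def)
      show "\<exists>J. \<forall>j\<ge>J. \<bar>a j t x - a j s x - \<tau> j * rate (a j s) x\<bar> \<le> \<tau> j * (K2 * hs (r j) powr \<beta> + modulus (\<tau> j))"
        unfolding a_def \<tau>_def
        by (intro exI[of _ 0] allI impI iter_consistent[OF hs(1,2) slots hs(3)[OF slot(3)[OF t' st(3)]]])
    qed
  qed
  ultimately show thesis using that[of \<rho>] \<rho>N \<rho>R by blast
qed

end

subsection \<open>Norms\<close>

lemma sup_norm_le: "(\<And>x. norm (f x) \<le> M) \<Longrightarrow> sup_norm f \<le> ennreal M"
  unfolding sup_norm_def by (intro SUP_least ennreal_leI) auto

lemma sup_normD: "sup_norm f \<le> ennreal M \<Longrightarrow> 0 \<le> M \<Longrightarrow> norm (f x) \<le> M"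
  unfolding sup_norm_def by (meson SUP_upper UNIV_I ennreal_le_iff order_trans)

lemma holder_seminorm_le:
  assumes "\<And>x y. norm (f x - f y) \<le> M * dist x y powr \<beta>" "0 \<le> M"
  shows "holder_seminorm \<beta> f \<le> ennreal M"
  unfolding holder_seminorm_def
proof (intro SUP_least ennreal_leI)
  fix x y
  show "norm (f x - f y) / dist x y powr \<beta> \<le> M"
    using assms(1)[of x y] assms(2) by (cases "x = y") (auto simp: divide_le_eq)
qed

lemma holder_seminormD:
  assumes "holder_seminorm \<beta> f \<le> ennreal M" "0 \<le> M"
  shows "norm (f x - f y) \<le> M * dist x y powr \<beta>"
proof (cases "x = y")
  case False
  have "ennreal (norm (f x - f y) / dist x y powr \<beta>) \<le> holder_seminorm \<beta> f"
    unfolding holder_seminorm_def by (meson SUP_upper UNIV_I order_trans)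
  then have "norm (f x - f y) / dist x y powr \<beta> \<le> M"
    using assms ennreal_le_iff order_trans by blast
  then show ?thesis using False by (simp add: divide_le_eq)
qed simp

lemma C1b_C1_norm:
  assumes "C1b \<beta> M f"
  shows "C1_norm \<beta> f \<le> ennreal (3 * M)" "f \<in> C1_space \<beta>"
proof -
  have M: "0 \<le> M" using C1b_nonneg assms by blast
  have "C1_norm \<beta> f \<le> ennreal M + ennreal M + ennreal M"
    unfolding C1_norm_def using C1bD[OF assms] M
    by (intro add_mono sup_norm_le holder_seminorm_le) (auto simp: dist_norm)
  also have "\<dots> = ennreal (3 * M)" using M by (simp flip: ennreal_plus)
  finally show n: "C1_norm \<beta> f \<le> ennreal (3 * M)" .
  show "f \<in> C1_space \<beta>"
    using C1bD(1)[OF assms] le_less_trans[OF n ennreal_less_top] by (simp add: C1_space_def)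
qed

lemma C1_norm_C1b:
  assumes "\<And>x. f differentiable (at x)" "C1_norm \<beta> f \<le> ennreal M" "0 \<le> M"
  shows "C1b \<beta> M f"
proof -
  have "sup_norm f \<le> C1_norm \<beta> f" "sup_norm (gradient f) \<le> C1_norm \<beta> f" "holder_seminorm \<beta> (gradient f) \<le> C1_norm \<beta> f"
    unfolding C1_norm_def by (simp_all add: add_increasing add_increasing2)
  then have "sup_norm f \<le> ennreal M" "sup_norm (gradient f) \<le> ennreal M" "holder_seminorm \<beta> (gradient f) \<le> ennreal M"
    using assms(2) order_trans by blast+
  then show ?thesis
    unfolding C1b_def using assms sup_normD[of f M] sup_normD[of "gradient f" M] holder_seminormD[of \<beta> "gradient f" M]
    by (auto simp: dist_norm)
qed

lemma C1_space_C1b: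
  assumes "f \<in> C1_space \<beta>"
  obtains M where "C1b \<beta> M f"
proof -
  have "C1_norm \<beta> f = ennreal (enn2real (C1_norm \<beta> f))"
    using assms by (simp add: C1_space_def less_top)
  then show thesis using that[OF C1_norm_C1b[of f \<beta> "enn2real (C1_norm \<beta> f)"]] assms
    by (auto simp: C1_space_def)
qed

lemma supp_subset_cball:
  assumes "\<And>x. R < norm x \<Longrightarrow> f x = 0"
  shows "supp f \<subseteq> cball 0 R"
  unfolding supp_def
proof (rule closure_minimal)
  show "{x. f x \<noteq> 0} \<subseteq> cball 0 R"
  proof
    fix x assume "x \<in> {x. f x \<noteq> 0}"
    then have "\<not> R < norm x" using assms by auto
    then show "x \<in> cball 0 R" by simp
  qed
qed simp

lemma zero_outside_supp:
  assumes "supp f \<subseteq> cball 0 R" "R < norm x"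
  shows "f x = 0"
proof (rule ccontr)
  assume "f x \<noteq> 0"
  then have "x \<in> supp f" unfolding supp_def by (intro subsetD[OF closure_subset]) simp
  then have "x \<in> cball 0 R" by (rule subsetD[OF assms(1)])
  then show False using assms(2) by simp
qed

lemma C0_norm_interpolation:
  assumes "\<And>x. norm (f x) \<le> e" "\<And>x y. norm (f x - f y) \<le> H * dist x y powr \<beta>" "0 < \<beta>'" "\<beta>' < \<beta>" "0 \<le> H"
  shows "C0_norm \<beta>' f \<le> ennreal (e + (2 * e) powr (1 - \<beta>' / \<beta>) * H powr (\<beta>' / \<beta>))"
proof -
  have e: "0 \<le> e" using assms(1) norm_ge_zero order_trans by blast
  have "holder_seminorm \<beta>' f \<le> ennreal ((2 * e) powr (1 - \<beta>' / \<beta>) * H powr (\<beta>' / \<beta>))"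
  proof (rule holder_seminorm_le)
    fix x y
    have "norm (f x - f y) \<le> 2 * e"
      using norm_triangle_ineq4[of "f x" "f y"] assms(1)[of x] assms(1)[of y] by linarith
    then show "norm (f x - f y) \<le> (2 * e) powr (1 - \<beta>' / \<beta>) * H powr (\<beta>' / \<beta>) * dist x y powr \<beta>'"
      using assms by (intro powr_interpolation) auto
  qed simp
  then have "C0_norm \<beta>' f \<le> ennreal e + ennreal ((2 * e) powr (1 - \<beta>' / \<beta>) * H powr (\<beta>' / \<beta>))"
    unfolding C0_norm_def using assms(1) by (intro add_mono sup_norm_le) auto
  then show ?thesis using e by (simp add: ennreal_plus)
qed

lemma ennreal_tendsto_zero:
  fixes F :: "real \<Rightarrow> ennreal"
  assumes "\<And>s. s \<in> S \<Longrightarrow> s \<noteq> t \<Longrightarrow> F s \<le> ennreal (b s)" "(b \<longlongrightarrow> 0) (at t within S)"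
  shows "(F \<longlongrightarrow> 0) (at t within S)"
proof (rule tendsto_sandwich[of "\<lambda>_. 0" F _ "\<lambda>s. ennreal (b s)"])
  show "((\<lambda>s. ennreal (b s)) \<longlongrightarrow> 0) (at t within S)"
    using tendsto_ennrealI[OF assms(2)] by simp
  show "\<forall>\<^sub>F s in at t within S. F s \<le> ennreal (b s)"
    using assms(1) by (auto simp: eventually_at_filter)
qed auto

text \<open>Uniform smallness together with a merely bounded beta-seminorm gives convergence in
  every weaker Hoelder norm. This is where continuity in time is restricted to exponents beta' <
  beta.\<close>

lemma C0_norm_tendsto_zero:
  fixes F :: "real \<Rightarrow> 'a::metric_space \<Rightarrow> 'b::real_normed_vector"
  assumes "\<And>s x. s \<in> S \<Longrightarrow> s \<noteq> t \<Longrightarrow> norm (F s x) \<le> e s"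
    and "\<And>s x y. s \<in> S \<Longrightarrow> s \<noteq> t \<Longrightarrow> norm (F s x - F s y) \<le> H * dist x y powr \<beta>"
    and "0 < \<beta>'" "\<beta>' < \<beta>" "0 \<le> H" and e: "(e \<longlongrightarrow> 0) (at t within S)"
  shows "((\<lambda>s. C0_norm \<beta>' (F s)) \<longlongrightarrow> 0) (at t within S)"
proof (rule ennreal_tendsto_zero)
  show "C0_norm \<beta>' (F s) \<le> ennreal (e s + (2 * e s) powr (1 - \<beta>' / \<beta>) * H powr (\<beta>' / \<beta>))" if "s \<in> S" "s \<noteq> t" for s
    by (rule C0_norm_interpolation[OF assms(1)[OF that] assms(2)[OF that] assms(3-5)])
  have "\<forall>\<^sub>F s in at t within S. 0 \<le> 2 * e s"
    unfolding eventually_at_filter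
  proof (intro always_eventually allI impI)
    fix s assume "s \<noteq> t" "s \<in> S"
    then show "0 \<le> 2 * e s" using assms(1)[of s undefined] norm_ge_zero order_trans by (metis mult_nonneg_nonneg zero_le_numeral)
  qed
  then have "((\<lambda>s. (2 * e s) powr (1 - \<beta>' / \<beta>)) \<longlongrightarrow> (2 * 0) powr (1 - \<beta>' / \<beta>)) (at t within S)"
    using assms by (intro tendsto_powr' tendsto_intros e) auto
  from tendsto_add[OF e tendsto_mult[OF this tendsto_const[of "H powr (\<beta>' / \<beta>)"]]]
  show "((\<lambda>s. e s + (2 * e s) powr (1 - \<beta>' / \<beta>) * H powr (\<beta>' / \<beta>)) \<longlongrightarrow> 0) (at t within S)"
    by simp
qed

subsection \<open>The velocity field\<close>

lemma velocity_eq_conv: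
  fixes f :: "'a::euclidean_space \<Rightarrow> real"
  assumes k: "k \<in> borel_measurable borel" "\<And>x. x \<noteq> 0 \<Longrightarrow> k x = - gradient (kernel \<kappa>) x"
    and [measurable]: "f \<in> borel_measurable borel"
  shows "velocity \<kappa> f x = conv f k x"
proof -
  note [measurable] = k(1)
  \<comment> \<open>The gradient of the kernel at the origin is an arbitrary value; measurability
    follows since it is a one-point modification of \<open>- k\<close>, and under the integral that
    point is a null set.\<close>
  have "(\<lambda>z. if z = 0 then gradient (kernel \<kappa>) 0 else - k z) \<in> borel_measurable borel"
    by measurable
  moreover have "(\<lambda>z. if z = 0 then gradient (kernel \<kappa>) 0 else - k z) = gradient (kernel \<kappa>)"
    using k(2) by auto
  ultimately have [measurable]: "gradient (kernel \<kappa>) \<in> borel_measurable (borel :: 'a measure)" by simp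
  have "(LINT y|lborel. f y *\<^sub>R gradient (kernel \<kappa>) (x - y)) = (LINT y|lborel. - (f y *\<^sub>R k (x - y)))"
  proof (rule integral_cong_AE)
    show "AE y in lborel. f y *\<^sub>R gradient (kernel \<kappa>) (x - y) = - (f y *\<^sub>R k (x - y))"
      using AE_lborel_singleton[of x] by eventually_elim (simp add: k(2))
  qed measurable
  then show ?thesis by (simp add: velocity_def conv_commute)
qed

context admissible_kernel
begin

lemma flux_derivative:
  assumes f: "C1b \<alpha> M f" "0 < \<alpha>" "supported R f"
  shows "((\<lambda>y. f y *\<^sub>R conv f k y) has_derivative
      (\<lambda>v. f x *\<^sub>R conv (\<lambda>z. gradient f z \<bullet> v) k x + (gradient f x \<bullet> v) *\<^sub>R conv f k x)) (at x)"
  by (rule has_derivative_scaleR[OF C1bD(5)[OF f(1)] velocity_derivative(1)[OF f]])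

lemma flux_divergence:
  assumes f: "C1b \<alpha> M f" "0 < \<alpha>" "supported R f"
  shows "divergence (\<lambda>y. f y *\<^sub>R conv f k y) x = - rate f x"
proof -
  let ?D = "\<lambda>v. f x *\<^sub>R conv (\<lambda>z. gradient f z \<bullet> v) k x + (gradient f x \<bullet> v) *\<^sub>R conv f k x"
  have "frechet_derivative (\<lambda>y. f y *\<^sub>R conv f k y) (at x) = ?D"
    using frechet_derivative_at[OF flux_derivative[OF f]] by simp
  then have "divergence (\<lambda>y. f y *\<^sub>R conv f k y) x
    = f x * (\<Sum>b\<in>Basis. conv (\<lambda>z. gradient f z \<bullet> b) k x \<bullet> b) + (\<Sum>b\<in>Basis. (gradient f x \<bullet> b) * (conv f k x \<bullet> b))"
    by (simp add: divergence_def inner_add_left sum.distrib sum_distrib_left)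
  also have "(\<Sum>b\<in>Basis. (gradient f x \<bullet> b) * (conv f k x \<bullet> b)) = gradient f x \<bullet> conv f k x"
    by (rule euclidean_inner[symmetric])
  finally show ?thesis by (simp add: velocity_derivative(4)[OF f] rate_def)
qed

lemma velocity_lipschitz:
  assumes f: "C1b \<alpha> M f" "0 < \<alpha>" "supported R f"
  shows "norm (conv f k x - conv f k y) \<le> M * E * norm (x - y)"
proof (rule differentiable_bound[of UNIV])
  show "(conv f k has_derivative (\<lambda>v. conv (\<lambda>z. gradient f z \<bullet> v) k x)) (at x within UNIV)" for x
    using velocity_derivative(1)[OF f] by simp
  show "onorm (\<lambda>v. conv (\<lambda>z. gradient f z \<bullet> v) k x) \<le> M * E" for x
    by (intro onorm_le velocity_derivative(2)[OF f])
qed auto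

text \<open>The rate is minus the divergence of a Lipschitz field with compact support, each partial
  derivative of which integrates to 0. This is the source of mass conservation.\<close>

lemma rate_integral_zero:
  assumes f: "C1b \<beta> M f" "supported R f"
  shows "(LINT x|lborel. rate f x) = 0"
proof -
  note f' = f(1) \<beta>(1) f(2)
  have M: "0 \<le> M" "0 \<le> E" using C1b_nonneg[OF f(1)] E by auto
  let ?D = "\<lambda>b x. f x *\<^sub>R conv (\<lambda>z. gradient f z \<bullet> b) k x + (gradient f x \<bullet> b) *\<^sub>R conv f k x"
  note u = velocity_bound[OF C1b_measurable[OF f(1)] C1bD(2)[OF f(1)] f(2)]
  have int: "integrable lborel (?D b) \<and> (LINT x|lborel. ?D b x) = 0" if b: "b \<in> Basis" for b
  proof -
    let ?V = "\<lambda>x. f x *\<^sub>R conv f k x"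
    have lip: "norm (?V x - ?V y) \<le> (2 * M * (M * E)) * norm (x - y)" for x y
    proof -
      have "?V x - ?V y = f x *\<^sub>R (conv f k x - conv f k y) + (f x - f y) *\<^sub>R conv f k y"
        by (simp add: algebra_simps)
      moreover have "norm (f x *\<^sub>R (conv f k x - conv f k y)) \<le> M * (M * E * norm (x - y))"
        using mult_mono[OF C1bD(2)[OF f(1), of x] velocity_lipschitz[OF f', of x y]] M by simp
      moreover have "norm ((f x - f y) *\<^sub>R conv f k y) \<le> (M * norm (x - y)) * (M * E)"
        using mult_mono[OF C1b_lipschitz[OF f(1), of x y] u[of y]] M by simp
      ultimately have "norm (?V x - ?V y) \<le> M * (M * E * norm (x - y)) + (M * norm (x - y)) * (M * E)"
        by (metis norm_triangle_mono)
      then show ?thesis by (simp add: algebra_simps)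
    qed
    have cD: "continuous_on UNIV (?D b)"
    proof (intro continuous_on_add continuous_on_scaleR continuous_on_inner continuous_on_const)
      show "continuous_on UNIV f" by (rule C1b_continuous[OF f(1)])
      show "continuous_on UNIV (gradient f)" by (rule C1b_continuous_gradient[OF f(1) \<beta>(1)])
      show "continuous_on UNIV (conv f k)"
        by (rule holder_imp_continuous[of _ "M * E" 1]) (use velocity_lipschitz[OF f'] in auto)
      show "continuous_on UNIV (conv (\<lambda>z. gradient f z \<bullet> b) k)"
        by (rule holder_imp_continuous[of _ "M * E" \<beta>]) (use velocity_derivative(3)[OF f', of b] b \<beta> in auto)
    qed
    have "?V x = 0" if "R < norm x" for x using supportedD[OF f(2) that] by simp
    then show ?thesis
      using integral_directional_derivative_zero[OF lip, of R "?D b" b]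
        directional_derivative_tendsto[OF flux_derivative[OF f'], of _ b]
        borel_measurable_continuous_onI[OF cD] b by auto
  qed
  have "rate f x = - (\<Sum>b\<in>Basis. ?D b x \<bullet> b)" for x
  proof -
    have "(\<Sum>b\<in>Basis. ?D b x \<bullet> b) = divergence (\<lambda>y. f y *\<^sub>R conv f k y) x"
      unfolding divergence_def frechet_derivative_at[OF flux_derivative[OF f', of x], symmetric] ..
    then show ?thesis using flux_divergence[OF f'] by simp
  qed
  then have "(LINT x|lborel. rate f x) = - (LINT x|lborel. (\<Sum>b\<in>Basis. ?D b x \<bullet> b))" by simp
  also have "(LINT x|lborel. (\<Sum>b\<in>Basis. ?D b x \<bullet> b)) = (\<Sum>b\<in>Basis. LINT x|lborel. ?D b x \<bullet> b)"
    using int by (intro Bochner_Integration.integral_sum integrable_inner_left) auto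
  also have "\<dots> = (\<Sum>b\<in>Basis. (LINT x|lborel. ?D b x) \<bullet> b)"
    using int by (intro sum.cong refl integral_inner_left) auto
  also have "\<dots> = 0" using int by simp
  finally show ?thesis by simp
qed

lemma rate_bound:
  assumes f: "C1b \<beta> N f" "supported R f"
  shows "\<bar>rate f x\<bar> \<le> 2 * N * L"
proof -
  note fm = C1b_measurable[OF f(1)] C1bD(2)[OF f(1)] f(2)
  have "\<bar>gradient f x \<bullet> conv f k x\<bar> \<le> N * L"
    by (rule order_trans[OF Cauchy_Schwarz_ineq2 mult_mono[OF C1bD(3)[OF f(1)] velocity_bound[OF fm]]]) (use N in auto)
  moreover have "\<bar>f x * divu f x\<bar> \<le> N * L"
    unfolding abs_mult by (rule mult_mono[OF C1bD(2)[OF f(1)] divu_bound[OF fm]]) (use N in auto)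
  ultimately show ?thesis unfolding rate_def by linarith
qed

text \<open>The constant is 1 + 1 + 2 + 2, from the four differences in the two products; the
  factors 2 come from \<open>C1b_holder\<close>.\<close>

lemma rate_holder:
  assumes f: "C1b \<beta> N f" "supported R f"
  shows "\<bar>rate f x - rate f y\<bar> \<le> 6 * N * L * norm (x - y) powr \<beta>"
proof -
  note fm = C1b_measurable[OF f(1)] C1bD(2)[OF f(1)] f(2)
  let ?d = "norm (x - y) powr \<beta>"
  have N0: "0 \<le> N" "0 \<le> L" using N L by auto
  have "\<bar>(gradient f x - gradient f y) \<bullet> conv f k x\<bar> \<le> (N * ?d) * L"
    by (rule order_trans[OF Cauchy_Schwarz_ineq2 mult_mono[OF C1bD(4)[OF f(1)] velocity_bound[OF fm]]]) (use N0 in auto)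
  moreover have "\<bar>gradient f y \<bullet> (conv f k x - conv f k y)\<bar> \<le> N * (L * ?d)"
    by (rule order_trans[OF Cauchy_Schwarz_ineq2 mult_mono[OF C1bD(3)[OF f(1)] velocity_holder[OF fm]]]) (use N0 in auto)
  moreover have "\<bar>(f x - f y) * divu f x\<bar> \<le> (2 * N * ?d) * L"
    unfolding abs_mult by (rule mult_mono[OF C1b_holder[OF f(1) \<beta>(1) less_imp_le[OF \<beta>(2)]] divu_bound[OF fm]]) (use N0 in auto)
  moreover have "\<bar>f y * (divu f x - divu f y)\<bar> \<le> N * (2 * L * ?d)"
    unfolding abs_mult
    by (rule mult_mono[OF C1bD(2)[OF f(1)] C1b_holder[OF divu_C1b[OF f] \<beta>(1) less_imp_le[OF \<beta>(2)]]]) (use N0 in auto)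
  moreover have "rate f x - rate f y = - ((gradient f x - gradient f y) \<bullet> conv f k x)
    - gradient f y \<bullet> (conv f k x - conv f k y) - (f x - f y) * divu f x - f y * (divu f x - divu f y)"
    by (simp add: rate_def algebra_simps inner_diff_left inner_diff_right)
  ultimately have "\<bar>rate f x - rate f y\<bar> \<le> (N * ?d) * L + N * (L * ?d) + (2 * N * ?d) * L + N * (2 * L * ?d)"
    by linarith
  then show ?thesis by (simp add: algebra_simps)
qed

end

subsection \<open>The limit is a classical solution\<close>

lemma C0_spaceI:
  assumes "\<And>x. norm (f x) \<le> e" "\<And>x y. norm (f x - f y) \<le> H * dist x y powr \<beta>" "0 < \<beta>'" "\<beta>' < \<beta>" "0 \<le> H"
  shows "f \<in> C0_space \<beta>'"
  using C0_norm_interpolation[OF assms] le_less_trans[OF _ ennreal_less_top] by (auto simp: C0_space_def)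

locale limit_solution = euler_scheme C \<beta> R N E k m c f0 M0 R0 Ts
  for C \<beta> R N E :: real and k :: "'a::euclidean_space \<Rightarrow> 'a" and m c f0 M0 R0 Ts +
  fixes \<rho> :: "real \<Rightarrow> 'a \<Rightarrow> real" and \<kappa> :: real
  assumes init: "\<rho> 0 = f0"
    and \<rho>C: "\<And>t. 0 \<le> t \<Longrightarrow> t \<le> Ts \<Longrightarrow> C1b \<beta> N (\<rho> t)"
    and \<rho>R: "\<And>t. 0 \<le> t \<Longrightarrow> t \<le> Ts \<Longrightarrow> supported R (\<rho> t)"
    and \<rho>nn: "\<And>t x. 0 \<le> t \<Longrightarrow> t \<le> Ts \<Longrightarrow> 0 \<le> \<rho> t x"
    and \<rho>lip: "\<And>s t x. 0 \<le> s \<Longrightarrow> s \<le> t \<Longrightarrow> t \<le> Ts \<Longrightarrow> \<bar>\<rho> t x - \<rho> s x\<bar> \<le> L1 * (t - s)"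
    and \<rho>cons: "\<And>s t x. 0 \<le> s \<Longrightarrow> s \<le> t \<Longrightarrow> t \<le> Ts \<Longrightarrow>
        \<bar>\<rho> t x - \<rho> s x - (t - s) * rate (\<rho> s) x\<bar> \<le> (t - s) * modulus (t - s)"
    and k\<kappa>: "\<And>x. x \<noteq> 0 \<Longrightarrow> k x = - gradient (kernel \<kappa>) x"
    and mass0: "(LINT x|lborel. f0 x) = 1"
begin

section \<open>Regularity in time\<close>

lemma lipschitz_time:
  assumes "s \<in> {0..Ts}" "t \<in> {0..Ts}"
  shows "\<bar>\<rho> s x - \<rho> t x\<bar> \<le> L1 * \<bar>s - t\<bar>"
  using \<rho>lip[of s t x] \<rho>lip[of t s x] assms by (cases "s \<le> t") (auto simp: abs_minus_commute)

lemma gap_pos: "s \<noteq> t \<Longrightarrow> 0 < L1 * \<bar>s - t\<bar>"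
  using constants_pos by (intro mult_pos_pos) auto

lemma gradient_time:
  assumes "s \<in> {0..Ts}" "t \<in> {0..Ts}" "s \<noteq> t"
  shows "norm (gradient (\<rho> s) x - gradient (\<rho> t) x) \<le> (2 + 2 * N) * (L1 * \<bar>s - t\<bar>) powr \<gamma>"
  by (rule gradient_diff_interpolation[OF \<rho>C \<rho>C \<beta>(1) gap_pos lipschitz_time]) (use assms in auto)

lemma rate_time:
  assumes "s \<in> {0..Ts}" "t \<in> {0..Ts}" "s \<noteq> t"
  shows "\<bar>rate (\<rho> s) x - rate (\<rho> t) x\<bar> \<le> modulus \<bar>s - t\<bar>"
  unfolding modulus_def
  by (rule rate_diff[OF \<rho>C \<rho>R \<rho>C \<rho>R gap_pos lipschitz_time]) (use assms in auto)

text \<open>The estimate for the limit looks forward from the earlier time. Looking backward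
  exchanges the two times and pays one more modulus for the change of rate, hence the factor
  2.\<close>

lemma consistent_time:
  assumes "s \<in> {0..Ts}" "t \<in> {0..Ts}"
  shows "\<bar>\<rho> s x - \<rho> t x - (s - t) * rate (\<rho> t) x\<bar> \<le> \<bar>s - t\<bar> * (2 * modulus \<bar>s - t\<bar>)"
proof (cases "t \<le> s")
  case True
  have "0 \<le> (s - t) * modulus (s - t)" using True modulus_nonneg by (intro mult_nonneg_nonneg) auto
  then show ?thesis using \<rho>cons[of t s x] assms True by simp
next
  case False
  have "\<bar>(s - t) * (rate (\<rho> t) x - rate (\<rho> s) x)\<bar> \<le> \<bar>s - t\<bar> * modulus \<bar>s - t\<bar>"
    unfolding abs_mult using rate_time[of t s x] assms False
    by (intro mult_left_mono) (auto simp: abs_minus_commute)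
  moreover have "\<bar>\<rho> t x - \<rho> s x - (t - s) * rate (\<rho> s) x\<bar> \<le> \<bar>s - t\<bar> * modulus \<bar>s - t\<bar>"
    using \<rho>cons[of s t x] assms False by simp
  moreover have "\<rho> s x - \<rho> t x - (s - t) * rate (\<rho> t) x
     = - (\<rho> t x - \<rho> s x - (t - s) * rate (\<rho> s) x) - (s - t) * (rate (\<rho> t) x - rate (\<rho> s) x)"
    by (simp add: algebra_simps)
  ultimately show ?thesis by linarith
qed

lemma gap_lim: "((\<lambda>s. L1 * \<bar>s - t\<bar>) \<longlongrightarrow> 0) (at t within S)"
  by (auto intro!: tendsto_eq_intros)

lemma gap_powr_lim: "0 < p \<Longrightarrow> ((\<lambda>s. (L1 * \<bar>s - t\<bar>) powr p) \<longlongrightarrow> 0) (at t within S)"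
proof -
  assume p: "0 < p"
  have "((\<lambda>s. (L1 * \<bar>s - t\<bar>) powr p) \<longlongrightarrow> 0 powr p) (at t within S)"
    by (rule tendsto_powr'[OF gap_lim tendsto_const]) (use p constants_pos in \<open>auto intro!: always_eventually mult_nonneg_nonneg\<close>)
  then show ?thesis by simp
qed

lemma \<gamma>_pos: "0 < \<gamma>"
  using \<beta> by simp

lemma modulus_lim: "((\<lambda>s. modulus \<bar>s - t\<bar>) \<longlongrightarrow> 0) (at t within S)"
proof -
  have "((\<lambda>s. modulus \<bar>s - t\<bar>) \<longlongrightarrow> 8 * N * L * (0 + 0)) (at t within S)"
    unfolding modulus_def by (intro tendsto_mult tendsto_const tendsto_add gap_lim gap_powr_lim \<gamma>_pos)
  then show ?thesis by simp
qed

lemma quotient_close: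
  assumes "s \<in> {0..Ts}" "t \<in> {0..Ts}" "s \<noteq> t"
  shows "\<bar>(\<rho> s x - \<rho> t x) / (s - t) - rate (\<rho> t) x\<bar> \<le> 2 * modulus \<bar>s - t\<bar>"
proof -
  have "(\<rho> s x - \<rho> t x) / (s - t) - rate (\<rho> t) x = (\<rho> s x - \<rho> t x - (s - t) * rate (\<rho> t) x) / (s - t)"
    using assms(3) by (simp add: diff_divide_distrib)
  also have "\<bar>(\<rho> s x - \<rho> t x - (s - t) * rate (\<rho> t) x) / (s - t)\<bar> \<le> 2 * modulus \<bar>s - t\<bar>"
    using consistent_time[OF assms(1,2), of x] assms(3) by (simp add: divide_le_eq mult.commute)
  finally show ?thesis .
qed

lemma time_derivative:
  assumes "t \<in> {0..Ts}"
  shows "((\<lambda>s. \<rho> s x) has_real_derivative rate (\<rho> t) x) (at t within {0..Ts})"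
  unfolding has_field_derivative_iff
proof (rule LIM_zero_cancel, rule Lim_null_comparison)
  show "((\<lambda>s. 2 * modulus \<bar>s - t\<bar>) \<longlongrightarrow> 0) (at t within {0..Ts})"
    using tendsto_mult[OF tendsto_const modulus_lim] by simp
  show "\<forall>\<^sub>F s in at t within {0..Ts}. norm ((\<rho> s x - \<rho> t x) / (s - t) - rate (\<rho> t) x) \<le> 2 * modulus \<bar>s - t\<bar>"
    using quotient_close assms by (auto simp: eventually_at_filter)
qed

text \<open>The mean value inequality in time, applied to the difference of the values at two
  points, whose time derivative is a difference of rates. It bounds the quotients in C^{0,beta}
  uniformly in s, as \<open>C0_norm_tendsto_zero\<close> requires.\<close>

lemma quotient_holder:
  assumes "s \<in> {0..Ts}" "t \<in> {0..Ts}" "s \<noteq> t"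
  shows "\<bar>(\<rho> s x - \<rho> t x) / (s - t) - (\<rho> s y - \<rho> t y) / (s - t)\<bar> \<le> 6 * N * L * norm (x - y) powr \<beta>"
proof -
  have "norm ((\<rho> s x - \<rho> s y) - (\<rho> t x - \<rho> t y)) \<le> 6 * N * L * norm (x - y) powr \<beta> * norm (s - t)"
  proof (rule field_differentiable_bound[of "{0..Ts}"])
    show "((\<lambda>r. \<rho> r x - \<rho> r y) has_field_derivative rate (\<rho> r) x - rate (\<rho> r) y) (at r within {0..Ts})"
      if "r \<in> {0..Ts}" for r
      by (intro DERIV_diff time_derivative that)
    show "norm (rate (\<rho> r) x - rate (\<rho> r) y) \<le> 6 * N * L * norm (x - y) powr \<beta>" if "r \<in> {0..Ts}" for r
      using rate_holder[OF \<rho>C \<rho>R, of r x y] that by simp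
  qed (use assms in auto)
  then have "\<bar>((\<rho> s x - \<rho> s y) - (\<rho> t x - \<rho> t y)) / (s - t)\<bar> \<le> 6 * N * L * norm (x - y) powr \<beta>"
    using assms(3) by (simp add: divide_le_eq)
  then show ?thesis by (simp add: diff_divide_distrib)
qed

lemma solution_cont_C1:
  assumes \<beta>': "0 < \<beta>'" "\<beta>' < \<beta>"
  shows "cont_C1 \<beta>' Ts \<rho>"
  unfolding cont_C1_def
proof (intro ballI conjI)
  fix t assume t: "t \<in> {0..<Ts}"
  have NN: "0 \<le> N" using N by simp
  \<comment> \<open>The constant is doubled for distances above 1, where the power beta' is the
    smaller one and the bound of the gradient itself has to be used.\<close>
  have "C1b \<beta>' (2 * N) (\<rho> t)"
  proof (rule C1bI)
    fix x y
    have "norm (gradient (\<rho> t) x - gradient (\<rho> t) y) \<le> 2 * N * norm (x - y) powr \<beta>'"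
    proof (cases "norm (x - y) \<le> 1")
      case True
      have "norm (x - y) powr \<beta> \<le> norm (x - y) powr \<beta>'"
        using \<beta>' True by (cases "x = y") (auto intro: powr_mono')
      then have "N * norm (x - y) powr \<beta> \<le> 2 * N * norm (x - y) powr \<beta>'"
        using NN by (intro mult_mono) auto
      then show ?thesis using C1bD(4)[OF \<rho>C, of t x y] t by auto
    next
      case False
      then have "1 \<le> norm (x - y) powr \<beta>'" using \<beta>' by (simp add: ge_one_powr_ge_zero)
      then have "2 * N * 1 \<le> 2 * N * norm (x - y) powr \<beta>'" using NN by (intro mult_left_mono) auto
      moreover have "norm (gradient (\<rho> t) x - gradient (\<rho> t) y) \<le> N + N"
        using norm_triangle_ineq4[of "gradient (\<rho> t) x" "gradient (\<rho> t) y"]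
          C1bD(3)[OF \<rho>C, of t x] C1bD(3)[OF \<rho>C, of t y] t by auto
      ultimately show ?thesis by simp
    qed
    then show "norm (gradient (\<rho> t) x - gradient (\<rho> t) y) \<le> 2 * N * norm (x - y) powr \<beta>'" .
    have "N \<le> 2 * N" using NN by simp
    then show "\<bar>\<rho> t x\<bar> \<le> 2 * N" "norm (gradient (\<rho> t) x) \<le> 2 * N"
      using C1bD(2,3)[OF \<rho>C, of t x] t by auto
    show "(\<rho> t has_derivative (\<lambda>v. gradient (\<rho> t) x \<bullet> v)) (at x)"
      using C1bD(5)[OF \<rho>C, of t x] t by auto
  qed
  then show "\<rho> t \<in> C1_space \<beta>'" by (rule C1b_C1_norm)
  have diffb: "\<rho> s differentiable (at x)" if "s \<in> {0..<Ts}" for s x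
    using C1bD(1)[OF \<rho>C] that by auto
  have A: "((\<lambda>s. sup_norm (\<lambda>x. \<rho> s x - \<rho> t x)) \<longlongrightarrow> 0) (at t within {0..<Ts})"
  proof (rule ennreal_tendsto_zero[OF _ gap_lim])
    show "sup_norm (\<lambda>x. \<rho> s x - \<rho> t x) \<le> ennreal (L1 * \<bar>s - t\<bar>)" if "s \<in> {0..<Ts}" for s
      by (rule sup_norm_le) (use lipschitz_time[of s t] that t in auto)
  qed
  have B: "((\<lambda>s. C0_norm \<beta>' (\<lambda>x. gradient (\<rho> s) x - gradient (\<rho> t) x)) \<longlongrightarrow> 0) (at t within {0..<Ts})"
  proof (rule C0_norm_tendsto_zero[OF _ _ \<beta>'])
    show "norm (gradient (\<rho> s) x - gradient (\<rho> t) x) \<le> (2 + 2 * N) * (L1 * \<bar>s - t\<bar>) powr \<gamma>"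
      if "s \<in> {0..<Ts}" "s \<noteq> t" for s x
      by (rule gradient_time) (use that t in auto)
    show "norm (gradient (\<rho> s) x - gradient (\<rho> t) x - (gradient (\<rho> s) y - gradient (\<rho> t) y)) \<le> 2 * N * dist x y powr \<beta>"
      if "s \<in> {0..<Ts}" "s \<noteq> t" for s x y
    proof -
      have "norm ((gradient (\<rho> s) x - gradient (\<rho> s) y) - (gradient (\<rho> t) x - gradient (\<rho> t) y))
        \<le> N * norm (x - y) powr \<beta> + N * norm (x - y) powr \<beta>"
        by (rule order_trans[OF norm_triangle_ineq4 add_mono[OF C1bD(4)[OF \<rho>C] C1bD(4)[OF \<rho>C]]]) (use that t in auto)
      then show ?thesis by (simp add: dist_norm algebra_simps)
    qed
    show "((\<lambda>s. (2 + 2 * N) * (L1 * \<bar>s - t\<bar>) powr \<gamma>) \<longlongrightarrow> 0) (at t within {0..<Ts})"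
      using tendsto_mult[OF tendsto_const gap_powr_lim[OF \<gamma>_pos]] by simp
  qed (use NN in auto)
  have eq: "C1_norm \<beta>' (\<lambda>x. \<rho> s x - \<rho> t x) = sup_norm (\<lambda>x. \<rho> s x - \<rho> t x) + C0_norm \<beta>' (\<lambda>x. gradient (\<rho> s) x - gradient (\<rho> t) x)"
    if "s \<in> {0..<Ts}" for s
  proof -
    have "gradient (\<lambda>x. \<rho> s x - \<rho> t x) = (\<lambda>x. gradient (\<rho> s) x - gradient (\<rho> t) x)"
      using gradient_diff diffb that t by blast
    then show ?thesis by (simp add: C1_norm_def C0_norm_def add.assoc)
  qed
  have "((\<lambda>s. sup_norm (\<lambda>x. \<rho> s x - \<rho> t x) + C0_norm \<beta>' (\<lambda>x. gradient (\<rho> s) x - gradient (\<rho> t) x)) \<longlongrightarrow> 0) (at t within {0..<Ts})"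
    using tendsto_add[OF A B] by simp
  then show "((\<lambda>s. C1_norm \<beta>' (\<lambda>x. \<rho> s x - \<rho> t x)) \<longlongrightarrow> 0) (at t within {0..<Ts})"
    by (rule Lim_transform_eventually) (auto simp: eventually_at_filter eq)
qed

lemma solution_cont_diff_C0:
  assumes \<beta>': "0 < \<beta>'" "\<beta>' < \<beta>"
  shows "cont_diff_C0 \<beta>' Ts \<rho>"
proof -
  have N0: "0 \<le> N" "0 \<le> 6 * N * L" using N L by auto
  have rh: "norm (rate (\<rho> t) x - rate (\<rho> t) y) \<le> 6 * N * L * dist x y powr \<beta>" if "t \<in> {0..<Ts}" for t x y
    using rate_holder[OF \<rho>C \<rho>R, of t x y] that by (simp add: dist_norm)
  have "cont_C0 \<beta>' Ts (\<lambda>t. rate (\<rho> t))"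
    unfolding cont_C0_def
  proof (intro ballI conjI)
    fix t assume t: "t \<in> {0..<Ts}"
    show "rate (\<rho> t) \<in> C0_space \<beta>'"
      by (rule C0_spaceI[where e = "2 * N * L", OF _ rh[OF t] \<beta>']) (use rate_bound[OF \<rho>C \<rho>R] t N0 in auto)
    show "((\<lambda>s. C0_norm \<beta>' (\<lambda>x. rate (\<rho> s) x - rate (\<rho> t) x)) \<longlongrightarrow> 0) (at t within {0..<Ts})"
    proof (rule C0_norm_tendsto_zero[OF _ _ \<beta>' _ modulus_lim])
      show "norm (rate (\<rho> s) x - rate (\<rho> t) x) \<le> modulus \<bar>s - t\<bar>" if "s \<in> {0..<Ts}" "s \<noteq> t" for s x
        using rate_time[of s t x] that t by auto
      show "norm (rate (\<rho> s) x - rate (\<rho> t) x - (rate (\<rho> s) y - rate (\<rho> t) y)) \<le> (2 * (6 * N * L)) * dist x y powr \<beta>"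
        if "s \<in> {0..<Ts}" "s \<noteq> t" for s x y
        using norm_triangle_ineq4[of "rate (\<rho> s) x - rate (\<rho> s) y" "rate (\<rho> t) x - rate (\<rho> t) y"]
          rh[OF that(1), of x y] rh[OF t, of x y] by (simp add: algebra_simps)
    qed (use N0 in auto)
  qed
  moreover have "((\<lambda>s. C0_norm \<beta>' (\<lambda>x. (\<rho> s x - \<rho> t x) / (s - t) - rate (\<rho> t) x)) \<longlongrightarrow> 0) (at t within {0..<Ts})"
    if t: "t \<in> {0..<Ts}" for t
  proof (rule C0_norm_tendsto_zero[OF _ _ \<beta>'])
    show "norm ((\<rho> s x - \<rho> t x) / (s - t) - rate (\<rho> t) x) \<le> 2 * modulus \<bar>s - t\<bar>" if "s \<in> {0..<Ts}" "s \<noteq> t" for s x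
      using quotient_close[of s t x] that t by auto
    show "norm ((\<rho> s x - \<rho> t x) / (s - t) - rate (\<rho> t) x - ((\<rho> s y - \<rho> t y) / (s - t) - rate (\<rho> t) y))
        \<le> (2 * (6 * N * L)) * dist x y powr \<beta>" if "s \<in> {0..<Ts}" "s \<noteq> t" for s x y
      using norm_triangle_ineq4[of "(\<rho> s x - \<rho> t x) / (s - t) - (\<rho> s y - \<rho> t y) / (s - t)" "rate (\<rho> t) x - rate (\<rho> t) y"]
        quotient_holder[of s t x y] rh[OF t, of x y] that t by (simp add: dist_norm algebra_simps)
    show "((\<lambda>s. 2 * modulus \<bar>s - t\<bar>) \<longlongrightarrow> 0) (at t within {0..<Ts})"
      using tendsto_mult[OF tendsto_const modulus_lim] by simp
  qed (use N0 in auto)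
  moreover have "\<rho> t \<in> C0_space \<beta>'" if t: "t \<in> {0..<Ts}" for t
    by (rule C0_spaceI[where e = N and H = "2 * N", OF _ _ \<beta>'])
      (use C1bD(2)[OF \<rho>C] C1b_holder[OF \<rho>C \<beta>(1) less_imp_le[OF \<beta>(2)]] t N0 in \<open>auto simp: dist_norm\<close>)
  ultimately show ?thesis unfolding cont_diff_C0_def by blast
qed

section \<open>Conservation of mass\<close>

lemma density_integrable:
  assumes "t \<in> {0..Ts}"
  shows "integrable lborel (\<rho> t)"
  by (rule integrable_bounded_support[of _ N 0 R])
    (use C1b_measurable[OF \<rho>C] C1bD(2)[OF \<rho>C] supportedD[OF \<rho>R] assms in \<open>auto simp: indicator_def not_le\<close>)

text \<open>The difference quotients converge to the rate uniformly on a fixed ball outside which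
  everything vanishes, and the rate has integral 0, so the mass has time derivative 0.\<close>

lemma mass_one:
  assumes "t \<in> {0..Ts}"
  shows "(LINT x|lborel. \<rho> t x) = 1"
proof -
  let ?I = "\<lambda>t. LINT x|lborel. \<rho> t x" and ?v = "measure lborel (cball (0::'a) R)"
  have "(?I has_real_derivative 0) (at t within {0..Ts})" if t: "t \<in> {0..Ts}" for t
    unfolding has_field_derivative_iff
  proof (rule Lim_null_comparison)
    show "((\<lambda>s. 2 * modulus \<bar>s - t\<bar> * ?v) \<longlongrightarrow> 0) (at t within {0..Ts})"
      using tendsto_mult[OF tendsto_mult[OF tendsto_const[of 2] modulus_lim] tendsto_const[of ?v]] by simp
    have "norm ((?I s - ?I t) / (s - t)) \<le> 2 * modulus \<bar>s - t\<bar> * ?v" if s: "s \<in> {0..Ts}" "s \<noteq> t" for s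
    proof -
      let ?q = "\<lambda>x. (\<rho> s x - \<rho> t x) / (s - t) - rate (\<rho> t) x"
      have rm: "continuous_on UNIV (rate (\<rho> t))"
        by (rule holder_imp_continuous[of _ "6 * N * L" \<beta>]) (use rate_holder[OF \<rho>C \<rho>R, of t] t \<beta> in auto)
      have [measurable]: "rate (\<rho> t) \<in> borel_measurable borel" "\<rho> s \<in> borel_measurable borel" "\<rho> t \<in> borel_measurable borel"
        using borel_measurable_continuous_onI[OF rm] C1b_measurable[OF \<rho>C] s t by auto
      have out: "R < norm x \<Longrightarrow> \<rho> s x = 0 \<and> \<rho> t x = 0 \<and> rate (\<rho> t) x = 0" for x
        using supportedD[OF \<rho>R] rate_outside[OF \<rho>R] s t by auto
      have ri: "integrable lborel (rate (\<rho> t))"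
        by (rule integrable_bounded_support[of _ "2 * N * L" 0 R])
          (use rate_bound[OF \<rho>C \<rho>R, of t] t out in \<open>auto simp: indicator_def not_le\<close>)
      have "(LINT x|lborel. ?q x) = (?I s - ?I t) / (s - t) - (LINT x|lborel. rate (\<rho> t) x)"
        using ri density_integrable[OF s(1)] density_integrable[OF t] by simp
      also have "(LINT x|lborel. rate (\<rho> t) x) = 0"
        using rate_integral_zero[OF \<rho>C \<rho>R] t by auto
      finally have eq: "(?I s - ?I t) / (s - t) = (LINT x|lborel. ?q x)" by simp
      show ?thesis unfolding eq
      proof (rule integrable_bounded_support(2))
        show "norm (?q y) \<le> 2 * modulus \<bar>s - t\<bar> * indicator (cball 0 R) y" for y
          using quotient_close[OF s(1) t s(2), of y] out[of y] by (cases "norm y \<le> R") auto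
      qed measurable
    qed
    then show "\<forall>\<^sub>F s in at t within {0..Ts}. norm ((?I s - ?I t) / (s - t)) \<le> 2 * modulus \<bar>s - t\<bar> * ?v"
      by (auto simp: eventually_at_filter)
  qed
  then have "\<And>t. t \<in> {0..Ts} \<Longrightarrow> (?I has_derivative (\<lambda>h. 0)) (at t within {0..Ts})"
    by (simp add: has_field_derivative_def lambda_zero)
  then obtain c where "\<And>t. t \<in> {0..Ts} \<Longrightarrow> ?I t = c"
    using has_derivative_zero_constant[of "{0..Ts}" ?I] by auto
  moreover have "?I 0 = 1" using init mass0 by simp
  ultimately show ?thesis using assms Ts(1) by (metis atLeastAtMost_iff less_imp_le order_refl)
qed

lemma velocity_eq: "t \<in> {0..Ts} \<Longrightarrow> velocity \<kappa> (\<rho> t) = conv (\<rho> t) k"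
  using velocity_eq_conv[OF k(1) k\<kappa> C1b_measurable[OF \<rho>C]] by auto

lemma in_solution_class: "\<rho> \<in> solution_class \<beta> \<kappa> f0 Ts"
  unfolding solution_class_def classical_solution_def mem_Collect_eq
proof (intro conjI allI impI ballI)
  show "Linf_loc_C1 \<beta> Ts \<rho>"
    unfolding Linf_loc_C1_def
  proof (intro allI impI exI[of _ "ennreal (3 * N)"] conjI AE_I2)
    show "\<rho> t \<in> C1_space \<beta>" "C1_norm \<beta> (\<rho> t) \<le> ennreal (3 * N)" if "0 < T \<and> T < Ts" "t \<in> {0..T}" for T t
      using C1b_C1_norm[OF \<rho>C] that by auto
  qed simp
  show "cont_C1 \<beta>' Ts \<rho>" "cont_diff_C0 \<beta>' Ts \<rho>" if "0 < \<beta>' \<and> \<beta>' < \<beta>" for \<beta>'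
    using solution_cont_C1 solution_cont_diff_C0 that by auto
  show "\<rho> 0 = f0" by (rule init)
  show "\<exists>K. compact K \<and> (\<forall>t\<in>{0..T}. supp (\<rho> t) \<subseteq> K)" if "0 < T \<and> T < Ts" for T
    by (intro exI[of _ "cball 0 R"] conjI compact_cball ballI supp_subset_cball)
      (use supportedD[OF \<rho>R] that in auto)
  fix t assume t: "t \<in> {0..<Ts}"
  then have t': "t \<in> {0..Ts}" by auto
  show "prob_density (\<rho> t)"
    using mass_one[OF t'] \<rho>nn t by (auto simp: prob_density_def)
  fix x
  have Ct: "C1b \<beta> N (\<rho> t)" "supported R (\<rho> t)" using \<rho>C \<rho>R t by auto
  show "(\<lambda>y. \<rho> t y *\<^sub>R velocity \<kappa> (\<rho> t) y) differentiable at x"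
    unfolding velocity_eq[OF t'] using flux_derivative[OF Ct(1) \<beta>(1) Ct(2)] by (auto simp: differentiable_def)
  have "((\<lambda>s. \<rho> s x) has_real_derivative rate (\<rho> t) x) (at t within {0..<Ts})"
    by (rule has_field_derivative_subset[OF time_derivative[OF t']]) auto
  then show "\<exists>D. ((\<lambda>s. \<rho> s x) has_real_derivative D) (at t within {0..<Ts}) \<and>
      D + divergence (\<lambda>y. \<rho> t y *\<^sub>R velocity \<kappa> (\<rho> t) y) x = 0"
    unfolding velocity_eq[OF t'] flux_divergence[OF Ct(1) \<beta>(1) Ct(2)] by auto
qed

end

subsection \<open>Sobolev norm of the velocity\<close>

lemma Linf_norm_le:
  assumes "f \<in> borel_measurable borel" "\<And>x. norm (f x) \<le> M"
  shows "Linf_norm f \<le> ennreal M"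
  unfolding Linf_norm_def using assms by (intro esssup_I AE_I2 ennreal_leI) auto

lemma continuous_locally_integrable:
  fixes f :: "'a::euclidean_space \<Rightarrow> 'b::euclidean_space"
  assumes "continuous_on UNIV f"
  shows "locally_integrable f"
  unfolding locally_integrable_def set_integrable_def
  using borel_integrable_compact continuous_on_subset[OF assms] by blast

lemma test_function_bounded:
  fixes \<phi> :: "'a::euclidean_space \<Rightarrow> real"
  assumes "test_function \<phi>"
  obtains P R where "\<And>x. \<phi> differentiable (at x)" "continuous_on UNIV (gradient \<phi>)"
    "\<And>x. \<bar>\<phi> x\<bar> \<le> P" "\<And>x. norm (gradient \<phi> x) \<le> P" "\<And>x. R < norm x \<Longrightarrow> \<phi> x = 0" "0 \<le> P"
proof -
  have ck: "Ck (Suc 0) \<phi>" and cs: "compact (supp \<phi>)" using assms by (auto simp: test_function_def)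
  then have diff: "\<And>x. \<phi> differentiable (at x)"
    and cont: "\<And>b. b \<in> Basis \<Longrightarrow> continuous_on UNIV (\<lambda>x. frechet_derivative \<phi> (at x) b)" by auto
  have cg: "continuous_on UNIV (gradient \<phi>)"
    unfolding gradient_def[abs_def] by (intro continuous_intros cont)
  have c\<phi>: "continuous_on UNIV \<phi>"
    by (meson continuous_at_imp_continuous_on diff differentiable_imp_continuous_within)
  obtain R where "\<forall>x\<in>supp \<phi>. norm x \<le> R"
    using compact_imp_bounded[OF cs] unfolding bounded_iff by blast
  then have R: "supp \<phi> \<subseteq> cball 0 R" by auto
  note z = zero_outside_supp[OF R]
  have "bounded (\<phi> ` cball 0 R)" "bounded (gradient \<phi> ` cball 0 R)"
    using continuous_on_subset[OF c\<phi>] continuous_on_subset[OF cg]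
    by (auto intro!: compact_imp_bounded compact_continuous_image)
  then obtain P1 P2 where P: "\<forall>x\<in>cball 0 R. norm (\<phi> x) \<le> P1" "\<forall>x\<in>cball 0 R. norm (gradient \<phi> x) \<le> P2"
    unfolding bounded_iff by auto
  define P where "P = \<bar>P1\<bar> + \<bar>P2\<bar>"
  show thesis
  proof (rule that[OF diff cg, of P R])
    show "\<bar>\<phi> x\<bar> \<le> P" for x
    proof (cases "norm x \<le> R")
      case True
      then have "\<bar>\<phi> x\<bar> \<le> P1" using P(1) by auto
      then show ?thesis unfolding P_def by linarith
    qed (use z[of x] in \<open>simp add: P_def\<close>)
    show "norm (gradient \<phi> x) \<le> P" for x
    proof (cases "norm x \<le> R")
      case True
      then have "norm (gradient \<phi> x) \<le> P2" using P(2) by auto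
      then show ?thesis unfolding P_def by linarith
    next
      case False
      then show ?thesis using gradient_outside_support[of R \<phi> x] z unfolding P_def by simp
    qed
    show "\<phi> x = 0" if "R < norm x" for x using z that by blast
    show "0 \<le> P" by (simp add: P_def)
  qed
qed

text \<open>Integration by parts is the vanishing of the integrated directional derivative of the
  compactly supported field phi u.\<close>

lemma weak_partial_classical:
  fixes u :: "'a::euclidean_space \<Rightarrow> 'b::euclidean_space"
  assumes der: "\<And>x. (u has_derivative D x) (at x)" and cont: "continuous_on UNIV (\<lambda>x. D x b)"
    and bd: "\<And>x. norm (u x) \<le> L" and lip: "\<And>x y. norm (u x - u y) \<le> L * norm (x - y)" and b: "norm b \<le> 1"
  shows "weak_partial b u (\<lambda>x. D x b)"
  unfolding weak_partial_def
proof (intro conjI allI impI)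
  have L: "0 \<le> L" using bd[of 0] norm_ge_zero order_trans by blast
  have cu: "continuous_on UNIV u"
    by (meson continuous_at_imp_continuous_on der has_derivative_continuous)
  show "locally_integrable u" "locally_integrable (\<lambda>x. D x b)"
    using cu cont by (auto intro: continuous_locally_integrable)
  fix \<phi> :: "'a \<Rightarrow> real" assume "test_function \<phi>"
  then obtain P R where \<phi>: "\<And>x. \<phi> differentiable (at x)" "continuous_on UNIV (gradient \<phi>)"
    "\<And>x. \<bar>\<phi> x\<bar> \<le> P" "\<And>x. norm (gradient \<phi> x) \<le> P" "\<And>x. R < norm x \<Longrightarrow> \<phi> x = 0" and P: "0 \<le> P"
    using test_function_bounded by metis
  have fd: "frechet_derivative \<phi> (at x) b = gradient \<phi> x \<bullet> b" for x
    using frechet_derivative_at[OF has_derivative_gradient[OF \<phi>(1)], symmetric] by (simp add: fun_eq_iff)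
  let ?V = "\<lambda>x. \<phi> x *\<^sub>R u x" and ?G = "\<lambda>x. (gradient \<phi> x \<bullet> b) *\<^sub>R u x" and ?H = "\<lambda>x. \<phi> x *\<^sub>R D x b"
  have c\<phi>: "continuous_on UNIV \<phi>"
    by (meson continuous_at_imp_continuous_on \<phi>(1) differentiable_imp_continuous_within)
  have cG: "continuous_on UNIV ?G" and cH: "continuous_on UNIV ?H"
    by (intro continuous_intros \<phi>(2) cu c\<phi> cont)+
  have lipV: "norm (?V x - ?V y) \<le> (2 * P * L) * norm (x - y)" for x y
  proof -
    have "?V x - ?V y = \<phi> x *\<^sub>R (u x - u y) + (\<phi> x - \<phi> y) *\<^sub>R u y"
      by (simp add: algebra_simps)
    moreover have "norm (\<phi> x *\<^sub>R (u x - u y)) \<le> P * (L * norm (x - y))"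
      using mult_mono[OF \<phi>(3)[of x] lip[of x y]] P by simp
    moreover have "norm ((\<phi> x - \<phi> y) *\<^sub>R u y) \<le> (P * norm (x - y)) * L"
      using mult_mono[OF bounded_gradient_lipschitz[OF \<phi>(1,4), of x y] bd[of y]] P by simp
    ultimately have "norm (?V x - ?V y) \<le> P * (L * norm (x - y)) + (P * norm (x - y)) * L"
      by (metis norm_triangle_mono)
    then show ?thesis by (simp add: algebra_simps)
  qed
  have derV: "(?V has_derivative (\<lambda>v. \<phi> x *\<^sub>R D x v + (gradient \<phi> x \<bullet> v) *\<^sub>R u x)) (at x)" for x
    by (rule has_derivative_scaleR[OF has_derivative_gradient[OF \<phi>(1)] der])
  have zero: "(LINT x|lborel. ?H x + ?G x) = 0"
  proof (rule integral_directional_derivative_zero(2)[OF lipV])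
    show "?V x = 0" if "R < norm x" for x using \<phi>(5) that by simp
    show "(\<lambda>x. ?H x + ?G x) \<in> borel_measurable borel"
      by (intro borel_measurable_continuous_onI continuous_on_add cG cH)
    show "AE x in lborel. ((\<lambda>t. (?V (x + t *\<^sub>R b) - ?V x) /\<^sub>R t) \<longlongrightarrow> ?H x + ?G x) (at 0)"
      by (intro AE_I2 directional_derivative_tendsto[OF derV])
  qed (rule b)
  have "compact (cball (0::'a) R)" by simp
  then have ib: "integrable lborel F" if F: "continuous_on UNIV F" "\<And>x. R < norm x \<Longrightarrow> F x = 0" for F :: "'a \<Rightarrow> 'b"
  proof -
    have "integrable lborel (\<lambda>x. indicator (cball 0 R) x *\<^sub>R F x)"
      by (rule borel_integrable_compact) (use continuous_on_subset[OF F(1)] in auto)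
    moreover have "(\<lambda>x. indicator (cball 0 R) x *\<^sub>R F x) = F"
      using F(2) by (auto simp: indicator_def fun_eq_iff)
    ultimately show ?thesis by simp
  qed
  have "integrable lborel ?G" "integrable lborel ?H"
    using ib[OF cG] ib[OF cH] \<phi>(5) gradient_outside_support[of R \<phi>] by auto
  then have "(LINT x|lborel. ?G x) = - (LINT x|lborel. ?H x)"
    using zero by (simp add: eq_neg_iff_add_eq_0 add.commute)
  then show "(LINT x|lborel. frechet_derivative \<phi> (at x) b *\<^sub>R u x) = - (LINT x|lborel. \<phi> x *\<^sub>R D x b)"
    by (simp add: fd)
qed

text \<open>One contribution \<open>L\<close> comes from the field and one from each partial
  derivative; these are classical and continuous, hence weak.\<close>

lemma (in admissible_kernel) velocity_W1inf:
  assumes f: "C1b \<beta> N f" "supported R f"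
  shows "W1inf_norm (conv f k) \<le> ennreal ((1 + real DIM('a)) * L)"
proof -
  note f' = f(1) \<beta>(1) f(2)
  have L0: "0 \<le> L" using L by simp
  note bd = velocity_bound[OF C1b_measurable[OF f(1)] C1bD(2)[OF f(1)] f(2)]
  let ?D = "\<lambda>x v. conv (\<lambda>z. gradient f z \<bullet> v) k x"
  have cD: "continuous_on UNIV (\<lambda>x. ?D x b)" if "b \<in> Basis" for b
    by (rule holder_imp_continuous[of _ L \<beta>]) (use velocity_derivative(3)[OF f', of b] \<beta> that in auto)
  have cu: "continuous_on UNIV (conv f k)"
    by (rule holder_imp_continuous[of _ L 1]) (use velocity_lipschitz[OF f'] in auto)
  have "Linf_norm (conv f k) \<le> ennreal L"
    by (rule Linf_norm_le[OF borel_measurable_continuous_onI[OF cu] bd])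
  moreover have "(INF h\<in>{h. weak_partial b (conv f k) h}. Linf_norm h) \<le> ennreal L" if b: "b \<in> Basis" for b
  proof (rule INF_lower2[of "\<lambda>x. ?D x b"])
    show "(\<lambda>x. ?D x b) \<in> {h. weak_partial b (conv f k) h}"
      using weak_partial_classical[OF velocity_derivative(1)[OF f'] cD[OF b] bd velocity_lipschitz[OF f']] b by simp
    show "Linf_norm (\<lambda>x. ?D x b) \<le> ennreal L"
      by (rule Linf_norm_le[OF borel_measurable_continuous_onI[OF cD[OF b]]])
        (use velocity_derivative(2)[OF f', of b] b in simp)
  qed
  ultimately have "W1inf_norm (conv f k) \<le> ennreal L + (\<Sum>b\<in>(Basis::'a set). ennreal L)"
    unfolding W1inf_norm_def by (intro add_mono sum_mono)
  also have "(\<Sum>b\<in>(Basis::'a set). ennreal L) = ennreal (\<Sum>b\<in>(Basis::'a set). L)"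
    using L0 by (intro sum_ennreal)
  also have "ennreal L + \<dots> = ennreal (L + (\<Sum>b\<in>(Basis::'a set). L))"
    using L0 by (intro ennreal_plus[symmetric] sum_nonneg)
  also have "L + (\<Sum>b\<in>(Basis::'a set). L) = (1 + real DIM('a)) * L" by (simp add: algebra_simps)
  finally show ?thesis .
qed

subsection \<open>Wasserstein distance of two densities\<close>

lemma emeasure_density_le_integral:
  assumes "f \<in> borel_measurable lborel" "(\<integral>\<^sup>+x. f x \<partial>lborel) = \<alpha>"
  shows "emeasure (density lborel f) A \<le> \<alpha>"
proof (cases "A \<in> sets lborel")
  case True
  have "(\<integral>\<^sup>+x. f x * indicator A x \<partial>lborel) \<le> (\<integral>\<^sup>+x. f x \<partial>lborel)"
    by (intro nn_integral_mono) (simp add: indicator_def)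
  then show ?thesis using True assms by (simp add: emeasure_density)
qed (simp add: emeasure_notin_sets)

text \<open>The common part of the two densities stays in place and the surplus is coupled
  independently.\<close>

lemma W2_densities:
  fixes f g :: "'a::euclidean_space \<Rightarrow> real"
  assumes [measurable]: "f \<in> borel_measurable borel" "g \<in> borel_measurable borel"
    and nn: "\<And>x. 0 \<le> f x" "\<And>x. 0 \<le> g x"
    and one: "(\<integral>\<^sup>+x. ennreal (f x) \<partial>lborel) = 1" "(\<integral>\<^sup>+x. ennreal (g x) \<partial>lborel) = 1"
    and out: "\<And>x. R < norm x \<Longrightarrow> f x = 0" "\<And>x. R < norm x \<Longrightarrow> g x = 0"
    and e: "0 \<le> e" "\<And>x. \<bar>f x - g x\<bar> \<le> e"
  shows "W2 (density lborel (\<lambda>x. ennreal (f x))) (density lborel (\<lambda>x. ennreal (g x)))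
    \<le> ennreal (sqrt (4 * R\<^sup>2 * (e * measure lborel (cball (0::'a) R))))"
proof -
  let ?B = "borel \<Otimes>\<^sub>M borel :: ('a \<times> 'a) measure"
  define q where "q x = min (f x) (g x)" for x
  define a where "a x = ennreal (f x - q x)" for x
  define b where "b x = ennreal (g x - q x)" for x
  have [measurable]: "q \<in> borel_measurable borel" "a \<in> borel_measurable borel" "b \<in> borel_measurable borel"
    unfolding q_def a_def b_def by measurable
  have q0: "0 \<le> q x" "q x \<le> f x" "q x \<le> g x" for x using nn by (auto simp: q_def)
  have fq: "ennreal (f x) = ennreal (q x) + a x" and gq: "ennreal (g x) = ennreal (q x) + b x" for x
    using q0[of x] by (simp_all add: a_def b_def flip: ennreal_plus)
  let ?Q = "\<integral>\<^sup>+x. ennreal (q x) \<partial>lborel"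
  define \<alpha> where "\<alpha> = (\<integral>\<^sup>+x. a x \<partial>lborel)"
  have s: "?Q + \<alpha> = 1" "?Q + (\<integral>\<^sup>+x. b x \<partial>lborel) = 1"
    using one unfolding \<alpha>_def by (simp_all add: fq gq nn_integral_add)
  have "?Q \<le> 1" "\<alpha> \<le> 1" using s(1) by (metis add_increasing2 order_refl zero_le) (metis add_increasing order_refl s(1) zero_le)
  then have fin: "?Q \<noteq> \<infinity>" "\<alpha> \<noteq> \<infinity>" by (auto simp: top_unique)
  have b\<alpha>: "(\<integral>\<^sup>+x. b x \<partial>lborel) = \<alpha>"
    using s fin by (metis ennreal_add_left_cancel infinity_ennreal_def)
  define P1 where "P1 = distr (density lborel (\<lambda>x. ennreal (q x))) ?B (\<lambda>x. (x, x))"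
  define Ma where "Ma = density lborel a"
  define Mb where "Mb = density lborel b"
  have setsM: "sets Ma = sets borel" "sets Mb = sets borel" "space Ma = UNIV" "space Mb = UNIV"
    by (auto simp: Ma_def Mb_def)
  have Ma1: "emeasure Ma UNIV = \<alpha>" and Mb1: "emeasure Mb UNIV = \<alpha>"
    by (simp_all add: Ma_def Mb_def emeasure_density \<alpha>_def b\<alpha>)
  interpret Mb: finite_measure Mb
    by (rule finite_measureI) (use Mb1 fin setsM in auto)
  have setsP: "sets (Ma \<Otimes>\<^sub>M Mb) = sets ?B" by (intro sets_pair_measure_cong setsM)
  have setsP1: "sets P1 = sets ?B" by (simp add: P1_def)
  \<comment> \<open>The product of the surpluses has total mass alpha^2, so it is divided by alpha.
    If alpha = 0 it is the zero measure, and 0 / 0 = 0 in \<open>ennreal\<close> keeps the formula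
    valid.\<close>
  define \<mu> where "\<mu> S = emeasure P1 S + emeasure (Ma \<Otimes>\<^sub>M Mb) S / \<alpha>" for S
  define \<pi> where "\<pi> = measure_of UNIV (sets ?B) \<mu>"
  have spB: "space ?B = UNIV" by (simp add: space_pair_measure)
  have sa: "sigma_algebra UNIV (sets ?B)" using sets.sigma_algebra_axioms[of ?B] by (simp add: spB)
  have sets\<pi>: "sets \<pi> = sets ?B" "space \<pi> = UNIV"
    unfolding \<pi>_def using sigma_algebra.sets_measure_of_eq[OF sa] by (auto simp: space_measure_of_conv)
  have em: "emeasure \<pi> S = \<mu> S" if "S \<in> sets ?B" for S
    unfolding \<pi>_def
  proof (rule emeasure_measure_of_sigma[OF sa _ _ that])
    show "positive (sets ?B) \<mu>" by (simp add: positive_def \<mu>_def)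
    show "countably_additive (sets ?B) \<mu>"
    proof (rule countably_additiveI)
      fix A :: "nat \<Rightarrow> ('a \<times> 'a) set" assume A: "range A \<subseteq> sets ?B" "disjoint_family A" "\<Union> (range A) \<in> sets ?B"
      have "(\<Sum>i. \<mu> (A i)) = (\<Sum>i. emeasure P1 (A i)) + (\<Sum>i. emeasure (Ma \<Otimes>\<^sub>M Mb) (A i) / \<alpha>)"
        unfolding \<mu>_def by (rule suminf_add[symmetric]) auto
      also have "(\<Sum>i. emeasure (Ma \<Otimes>\<^sub>M Mb) (A i) / \<alpha>) = (\<Sum>i. emeasure (Ma \<Otimes>\<^sub>M Mb) (A i)) / \<alpha>"
        by (simp add: divide_ennreal_def)
      also have "(\<Sum>i. emeasure P1 (A i)) = emeasure P1 (\<Union> (range A))"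
        by (rule suminf_emeasure) (use A setsP1 in auto)
      also have "(\<Sum>i. emeasure (Ma \<Otimes>\<^sub>M Mb) (A i)) = emeasure (Ma \<Otimes>\<^sub>M Mb) (\<Union> (range A))"
        by (rule suminf_emeasure) (use A setsP in auto)
      finally show "(\<Sum>i. \<mu> (A i)) = \<mu> (\<Union> (range A))" by (simp add: \<mu>_def)
    qed
  qed
  have cancel: "(x * \<alpha>) / \<alpha> = x" if "x \<le> \<alpha>" for x :: ennreal
  proof (cases "\<alpha> = 0")
    case True
    with that show ?thesis by simp
  next
    case False
    then show ?thesis using fin(2) mult_divide_eq_ennreal[of \<alpha> x] by (simp add: infinity_ennreal_def)
  qed
  have sum_density: "emeasure (density lborel (\<lambda>x. ennreal (q x))) A + emeasure (density lborel h) A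
      = emeasure (density lborel (\<lambda>x. ennreal (q x) + h x)) A"
    if "A \<in> sets borel" "h \<in> borel_measurable borel" for A h
    using that by (simp add: emeasure_density distrib_right nn_integral_add)
  have m1: "distr \<pi> borel fst = density lborel (\<lambda>x. ennreal (f x))"
  proof (rule measure_eqI)
    fix A assume "A \<in> sets (distr \<pi> borel fst)"
    then have A: "A \<in> sets borel" by simp
    have "A \<times> UNIV \<in> sets ?B" using A by (intro pair_measureI) auto
    then have "emeasure (distr \<pi> borel fst) A = \<mu> (A \<times> UNIV)"
      using A by (subst emeasure_distr) (auto simp: sets\<pi> em vimage_fst measurable_cong_sets[OF sets\<pi>(1) refl])
    also have "\<mu> (A \<times> UNIV) = emeasure (density lborel (\<lambda>x. ennreal (q x))) A + (emeasure Ma A * \<alpha>) / \<alpha>"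
    proof -
      have "emeasure P1 (A \<times> UNIV) = emeasure (density lborel (\<lambda>x. ennreal (q x))) A"
        unfolding P1_def using \<open>A \<times> UNIV \<in> sets ?B\<close> by (subst emeasure_distr) (auto simp: vimage_def)
      moreover have "emeasure (Ma \<Otimes>\<^sub>M Mb) (A \<times> UNIV) = emeasure Ma A * \<alpha>"
        using A setsM Mb1 by (subst Mb.emeasure_pair_measure_Times) auto
      ultimately show ?thesis by (simp add: \<mu>_def)
    qed
    also have "(emeasure Ma A * \<alpha>) / \<alpha> = emeasure Ma A"
      by (rule cancel) (unfold Ma_def, rule emeasure_density_le_integral, simp_all add: \<alpha>_def)
    also have "emeasure (density lborel (\<lambda>x. ennreal (q x))) A + emeasure Ma A = emeasure (density lborel (\<lambda>x. ennreal (f x))) A"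
      unfolding Ma_def fq by (rule sum_density[OF A]) measurable
    finally show "emeasure (distr \<pi> borel fst) A = emeasure (density lborel (\<lambda>x. ennreal (f x))) A" .
  qed simp
  have m2: "distr \<pi> borel snd = density lborel (\<lambda>x. ennreal (g x))"
  proof (rule measure_eqI)
    fix A assume "A \<in> sets (distr \<pi> borel snd)"
    then have A: "A \<in> sets borel" by simp
    have "UNIV \<times> A \<in> sets ?B" using A by (intro pair_measureI) auto
    then have "emeasure (distr \<pi> borel snd) A = \<mu> (UNIV \<times> A)"
      using A by (subst emeasure_distr) (auto simp: sets\<pi> em vimage_snd measurable_cong_sets[OF sets\<pi>(1) refl])
    also have "\<mu> (UNIV \<times> A) = emeasure (density lborel (\<lambda>x. ennreal (q x))) A + (\<alpha> * emeasure Mb A) / \<alpha>"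
    proof -
      have "emeasure P1 (UNIV \<times> A) = emeasure (density lborel (\<lambda>x. ennreal (q x))) A"
        unfolding P1_def using \<open>UNIV \<times> A \<in> sets ?B\<close> by (subst emeasure_distr) (auto simp: vimage_def)
      moreover have "emeasure (Ma \<Otimes>\<^sub>M Mb) (UNIV \<times> A) = \<alpha> * emeasure Mb A"
        using A setsM Ma1 by (subst Mb.emeasure_pair_measure_Times) auto
      ultimately show ?thesis by (simp add: \<mu>_def)
    qed
    also have "(\<alpha> * emeasure Mb A) / \<alpha> = emeasure Mb A"
      unfolding mult.commute[of \<alpha>] by (rule cancel) (unfold Mb_def, rule emeasure_density_le_integral, simp_all add: b\<alpha>)
    also have "emeasure (density lborel (\<lambda>x. ennreal (q x))) A + emeasure Mb A = emeasure (density lborel (\<lambda>x. ennreal (g x))) A"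
      unfolding Mb_def gq by (rule sum_density[OF A]) measurable
    finally show "emeasure (distr \<pi> borel snd) A = emeasure (density lborel (\<lambda>x. ennreal (g x))) A" .
  qed simp
  have fstm: "fst \<in> \<pi> \<rightarrow>\<^sub>M borel" and sndm: "snd \<in> \<pi> \<rightarrow>\<^sub>M borel"
    by (simp_all add: measurable_cong_sets[OF sets\<pi>(1) refl])
  have "AE x in density lborel (\<lambda>x. ennreal (f x)). norm x \<le> R" "AE x in density lborel (\<lambda>x. ennreal (g x)). norm x \<le> R"
  proof -
    have "ennreal (f x) \<noteq> 0 \<longrightarrow> norm x \<le> R" "ennreal (g x) \<noteq> 0 \<longrightarrow> norm x \<le> R" for x
      using out[of x] by (cases "norm x \<le> R"; simp)+
    then show "AE x in density lborel (\<lambda>x. ennreal (f x)). norm x \<le> R" "AE x in density lborel (\<lambda>x. ennreal (g x)). norm x \<le> R"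
      by (simp_all add: AE_density)
  qed
  then have ae: "AE p in \<pi>. norm (fst p) \<le> R" "AE p in \<pi>. norm (snd p) \<le> R"
    unfolding m1[symmetric] m2[symmetric] using AE_distrD[OF fstm] AE_distrD[OF sndm] by blast+
  \<comment> \<open>Cost arises only off the diagonal, where the stationary part vanishes and the
    coupled surplus has mass at most alpha.\<close>
  define S where "S = {p :: 'a \<times> 'a. fst p \<noteq> snd p}"
  have "open S" unfolding S_def by (intro open_Collect_neq continuous_intros)
  then have "S \<in> sets borel" by (rule borel_open)
  then have S: "S \<in> sets ?B" unfolding borel_prod .
  define c where "c = (INF \<pi>\<in>couplings (density lborel (\<lambda>x. ennreal (f x))) (density lborel (\<lambda>x. ennreal (g x))).
      \<integral>\<^sup>+p. ennreal ((dist (fst p) (snd p))\<^sup>2) \<partial>\<pi>)"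
  have "c \<le> (\<integral>\<^sup>+p. ennreal ((dist (fst p) (snd p))\<^sup>2) \<partial>\<pi>)"
    unfolding c_def by (rule INF_lower) (simp add: couplings_def sets\<pi> m1 m2)
  also have "\<dots> \<le> (\<integral>\<^sup>+p. ennreal (4 * R\<^sup>2) * indicator S p \<partial>\<pi>)"
  proof (rule nn_integral_mono_AE)
    show "AE p in \<pi>. ennreal ((dist (fst p) (snd p))\<^sup>2) \<le> ennreal (4 * R\<^sup>2) * indicator S p"
      using ae
    proof eventually_elim
      case (elim p)
      have "dist (fst p) (snd p) \<le> 2 * R"
        using norm_triangle_ineq4[of "fst p" "snd p"] elim by (simp add: dist_norm)
      then have "(dist (fst p) (snd p))\<^sup>2 \<le> (2 * R)\<^sup>2" by (intro power_mono) auto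
      then show ?case by (auto simp: S_def indicator_def power2_eq_square intro!: ennreal_leI)
    qed
  qed
  also have "\<dots> = ennreal (4 * R\<^sup>2) * \<mu> S"
    using S sets\<pi> em[OF S] by (simp add: nn_integral_cmult_indicator)
  also have "\<mu> S \<le> \<alpha>"
  proof -
    have "emeasure P1 S = 0"
      unfolding P1_def using S by (subst emeasure_distr) (auto simp: S_def)
    moreover have "emeasure (Ma \<Otimes>\<^sub>M Mb) S \<le> \<alpha> * \<alpha>"
    proof -
      have "emeasure (Ma \<Otimes>\<^sub>M Mb) S \<le> emeasure (Ma \<Otimes>\<^sub>M Mb) (UNIV \<times> UNIV)"
      proof (rule emeasure_mono)
        show "UNIV \<times> UNIV \<in> sets (Ma \<Otimes>\<^sub>M Mb)" by (rule pair_measureI) (use setsM in auto)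
      qed simp
      also have "\<dots> = \<alpha> * \<alpha>" using setsM Ma1 Mb1 by (subst Mb.emeasure_pair_measure_Times) auto
      finally show ?thesis .
    qed
    then have "emeasure (Ma \<Otimes>\<^sub>M Mb) S / \<alpha> \<le> (\<alpha> * \<alpha>) / \<alpha>" by (rule divide_right_mono_ennreal)
    ultimately show ?thesis using cancel[of \<alpha>] by (simp add: \<mu>_def)
  qed
  also have "\<alpha> \<le> ennreal (e * measure lborel (cball (0::'a) R))"
  proof -
    have "\<alpha> \<le> (\<integral>\<^sup>+x. ennreal e * indicator (cball (0::'a) R) x \<partial>lborel)"
      unfolding \<alpha>_def
    proof (rule nn_integral_mono)
      fix x :: 'a
      have "f x - q x \<le> e" using e(2)[of x] e(1) by (auto simp: q_def min_def)
      then show "a x \<le> ennreal e * indicator (cball 0 R) x"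
        using out[of x] e by (cases "norm x \<le> R") (auto simp: a_def q_def intro: ennreal_leI)
    qed
    also have "\<dots> = ennreal e * emeasure lborel (cball (0::'a) R)"
      by (simp add: nn_integral_cmult_indicator)
    also have "\<dots> = ennreal (e * measure lborel (cball (0::'a) R))"
      using emeasure_cball_less_top[of "0::'a" R] e by (simp add: emeasure_eq_ennreal_measure ennreal_mult')
    finally show ?thesis .
  qed
  finally have c: "c \<le> ennreal (4 * R\<^sup>2) * ennreal (e * measure lborel (cball (0::'a) R))"
    by (simp add: mult_left_mono)
  then have c': "c \<le> ennreal (4 * R\<^sup>2 * (e * measure lborel (cball (0::'a) R)))"
    by (simp add: ennreal_mult')
  then have "c \<noteq> \<infinity>" by (auto simp: top_unique)
  moreover have "enn2real c \<le> 4 * R\<^sup>2 * (e * measure lborel (cball (0::'a) R))"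
    using c' e by (intro enn2real_leI) auto
  ultimately show ?thesis
    by (simp add: W2_def Let_def flip: c_def) (simp add: ennreal_leI)
qed

context limit_solution
begin

lemma density_nn_integral:
  assumes "t \<in> {0..Ts}"
  shows "(\<integral>\<^sup>+x. ennreal (\<rho> t x) \<partial>lborel) = 1"
  using nn_integral_eq_integral[OF density_integrable[OF assms]] mass_one[OF assms] \<rho>nn assms by auto

lemma second_moment:
  assumes t: "t \<in> {0..Ts}"
  shows "(\<integral>\<^sup>+x. ennreal ((norm x)\<^sup>2 * \<rho> t x) \<partial>lborel) \<le> ennreal (R\<^sup>2)"
proof -
  have [measurable]: "\<rho> t \<in> borel_measurable borel" using C1b_measurable[OF \<rho>C] t by auto
  have nn: "0 \<le> \<rho> t x" for x using \<rho>nn t by auto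
  have "(\<integral>\<^sup>+x. ennreal ((norm x)\<^sup>2 * \<rho> t x) \<partial>lborel) \<le> (\<integral>\<^sup>+x. ennreal (R\<^sup>2) * ennreal (\<rho> t x) \<partial>lborel)"
  proof (rule nn_integral_mono)
    fix x :: 'a
    have "(norm x)\<^sup>2 * \<rho> t x \<le> R\<^sup>2 * \<rho> t x"
    proof (cases "norm x \<le> R")
      case True
      then show ?thesis using nn by (intro mult_right_mono power_mono) auto
    next
      case False
      then show ?thesis using supportedD[OF \<rho>R, of t x] t by auto
    qed
    then show "ennreal ((norm x)\<^sup>2 * \<rho> t x) \<le> ennreal (R\<^sup>2) * ennreal (\<rho> t x)"
      using nn[of x] by (simp add: ennreal_mult'[symmetric] ennreal_leI)
  qed
  also have "\<dots> = ennreal (R\<^sup>2)"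
    using density_nn_integral[OF t] by (simp add: nn_integral_cmult)
  finally show ?thesis .
qed

lemma norms_bound:
  assumes t: "t \<in> {0..Ts}"
  shows "Linf_norm (\<rho> t) \<le> ennreal N" "holder_seminorm \<beta> (\<rho> t) \<le> ennreal (2 * N)"
    "W1inf_norm (velocity \<kappa> (\<rho> t)) \<le> ennreal ((1 + real DIM('a)) * L)"
proof -
  have C: "C1b \<beta> N (\<rho> t)" "supported R (\<rho> t)" using \<rho>C \<rho>R t by auto
  show "Linf_norm (\<rho> t) \<le> ennreal N"
    by (rule Linf_norm_le[OF C1b_measurable[OF C(1)]]) (use C1bD(2)[OF C(1)] in simp)
  show "holder_seminorm \<beta> (\<rho> t) \<le> ennreal (2 * N)"
    by (rule holder_seminorm_le) (use C1b_holder[OF C(1) \<beta>(1) less_imp_le[OF \<beta>(2)]] N in \<open>auto simp: dist_norm\<close>)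
  show "W1inf_norm (velocity \<kappa> (\<rho> t)) \<le> ennreal ((1 + real DIM('a)) * L)"
    unfolding velocity_eq[OF t] by (rule velocity_W1inf[OF C])
qed

lemma total_bound:
  assumes t: "t \<in> {0..Ts}"
  shows "Linf_norm (\<rho> t) + holder_seminorm \<beta> (\<rho> t) + (\<integral>\<^sup>+x. ennreal ((norm x)\<^sup>2 * \<rho> t x) \<partial>lborel)
      + W1inf_norm (velocity \<kappa> (\<rho> t))
    \<le> ennreal N + ennreal (2 * N) + ennreal (R\<^sup>2) + ennreal ((1 + real DIM('a)) * L)"
  by (intro add_mono norms_bound[OF t] second_moment[OF t])

lemma solution_cont_W2:
  assumes T: "T < Ts"
  shows "cont_W2 T (\<lambda>t. density lborel (\<lambda>x. ennreal (\<rho> t x)))"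
  unfolding cont_W2_def
proof (intro ballI conjI)
  fix t assume t0: "t \<in> {0..T}"
  then have t: "t \<in> {0..Ts}" using T by auto
  have meas: "\<rho> s \<in> borel_measurable borel" if "s \<in> {0..Ts}" for s
    using C1b_measurable[OF \<rho>C] that by auto
  note [measurable] = meas[OF t]
  show "density lborel (\<lambda>x. ennreal (\<rho> t x)) \<in> P2"
    unfolding P2_def
  proof (intro CollectI conjI)
    show "prob_space (density lborel (\<lambda>x. ennreal (\<rho> t x)))"
      by (rule prob_spaceI) (simp add: emeasure_density density_nn_integral[OF t])
    have "(\<integral>\<^sup>+x. ennreal ((norm x)\<^sup>2) \<partial>density lborel (\<lambda>x. ennreal (\<rho> t x)))
      = (\<integral>\<^sup>+x. ennreal ((norm x)\<^sup>2 * \<rho> t x) \<partial>lborel)"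
      using \<rho>nn t by (subst nn_integral_density) (auto simp: ennreal_mult' mult.commute)
    also have "\<dots> < \<infinity>" using le_less_trans[OF second_moment[OF t] ennreal_less_top] by simp
    finally show "(\<integral>\<^sup>+x. ennreal ((norm x)\<^sup>2) \<partial>density lborel (\<lambda>x. ennreal (\<rho> t x))) < \<infinity>" .
  qed simp
  show "((\<lambda>s. W2 (density lborel (\<lambda>x. ennreal (\<rho> s x))) (density lborel (\<lambda>x. ennreal (\<rho> t x)))) \<longlongrightarrow> 0) (at t within {0..T})"
  proof (rule ennreal_tendsto_zero)
    let ?b = "\<lambda>s. sqrt (4 * R\<^sup>2 * (L1 * \<bar>s - t\<bar> * measure lborel (cball (0::'a) R)))"
    show "W2 (density lborel (\<lambda>x. ennreal (\<rho> s x))) (density lborel (\<lambda>x. ennreal (\<rho> t x))) \<le> ennreal (?b s)"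
      if s0: "s \<in> {0..T}" for s
    proof (rule W2_densities)
      have s: "s \<in> {0..Ts}" using s0 T by auto
      show "\<rho> s \<in> borel_measurable borel" "\<rho> t \<in> borel_measurable borel" by (rule meas; fact)+
      show "0 \<le> \<rho> s x" "0 \<le> \<rho> t x" for x using \<rho>nn s t by auto
      show "(\<integral>\<^sup>+x. ennreal (\<rho> s x) \<partial>lborel) = 1" "(\<integral>\<^sup>+x. ennreal (\<rho> t x) \<partial>lborel) = 1"
        by (rule density_nn_integral; fact)+
      show "\<rho> s x = 0" "\<rho> t x = 0" if "R < norm x" for x
        using supportedD[OF \<rho>R] that s t by auto
      show "0 \<le> L1 * \<bar>s - t\<bar>" using constants_pos by (intro mult_nonneg_nonneg) auto
      show "\<bar>\<rho> s x - \<rho> t x\<bar> \<le> L1 * \<bar>s - t\<bar>" for x by (rule lipschitz_time[OF s t])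
    qed
    have "(?b \<longlongrightarrow> sqrt (4 * R\<^sup>2 * (0 * measure lborel (cball (0::'a) R)))) (at t within {0..T})"
      by (intro tendsto_real_sqrt tendsto_mult tendsto_const gap_lim)
    then show "(?b \<longlongrightarrow> 0) (at t within {0..T})" by simp
  qed
qed

end

subsection \<open>Uniqueness\<close>

text \<open>The class bounds the norm only at almost every time, so a bound at all times is drawn
  from continuity: the norm is locally bounded, and finitely many neighbourhoods cover
  [0, T].\<close>

lemma cont_C1_uniform_bound:
  fixes \<sigma> :: "real \<Rightarrow> 'a::euclidean_space \<Rightarrow> real"
  assumes cont: "cont_C1 \<alpha> Ts \<sigma>" and T: "T < Ts"
  obtains M where "\<And>t. t \<in> {0..T} \<Longrightarrow> C1b \<alpha> M (\<sigma> t)"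
proof -
  have "\<exists>d M. 0 < d \<and> (\<forall>s\<in>{0..T} \<inter> ball t d. C1b \<alpha> M (\<sigma> s))" if t0: "t \<in> {0..T}" for t
  proof -
    have t: "t \<in> {0..<Ts}" using t0 T by auto
    obtain M where M: "C1b \<alpha> M (\<sigma> t)"
      using cont t C1_space_C1b unfolding cont_C1_def by metis
    have "((\<lambda>s. C1_norm \<alpha> (\<lambda>x. \<sigma> s x - \<sigma> t x)) \<longlongrightarrow> 0) (at t within {0..<Ts})"
      using cont t unfolding cont_C1_def by blast
    then have "\<forall>\<^sub>F s in at t within {0..<Ts}. C1_norm \<alpha> (\<lambda>x. \<sigma> s x - \<sigma> t x) < 1"
      by (rule order_tendstoD) simp
    then obtain d where d: "0 < d" "\<And>s. s \<in> {0..<Ts} \<Longrightarrow> s \<noteq> t \<Longrightarrow> dist s t < d \<Longrightarrow> C1_norm \<alpha> (\<lambda>x. \<sigma> s x - \<sigma> t x) < 1"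
      unfolding eventually_at by blast
    have "C1b \<alpha> (1 + M) (\<sigma> s)" if s0: "s \<in> {0..T} \<inter> ball t d" for s
    proof (cases "s = t")
      case True
      then show ?thesis using C1b_mono[OF M] by simp
    next
      case False
      have s: "s \<in> {0..<Ts}" "dist s t < d" using s0 T by (auto simp: dist_commute)
      have ds: "\<sigma> s differentiable (at x)" for x
        using cont s unfolding cont_C1_def C1_space_def by blast
      have "C1_norm \<alpha> (\<lambda>x. \<sigma> s x - \<sigma> t x) \<le> ennreal 1"
        using d(2)[OF s(1) False s(2)] by simp
      then have "C1b \<alpha> 1 (\<lambda>x. \<sigma> s x - \<sigma> t x)"
        using ds C1bD(1)[OF M] by (intro C1_norm_C1b differentiable_diff) auto
      from C1b_add[OF this M] show ?thesis by simp
    qed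
    then show ?thesis using d(1) by blast
  qed
  then obtain d M where dM: "\<And>t. t \<in> {0..T} \<Longrightarrow> 0 < d t" "\<And>t s. t \<in> {0..T} \<Longrightarrow> s \<in> {0..T} \<inter> ball t (d t) \<Longrightarrow> C1b \<alpha> (M t) (\<sigma> s)"
    by metis
  have "t \<in> ball t (d t)" if "t \<in> {0..T}" for t using dM(1)[OF that] by simp
  then have cover: "{0..T} \<subseteq> (\<Union>t\<in>{0..T}. ball t (d t))" by blast
  obtain I where I: "I \<subseteq> {0..T}" "finite I" "{0..T} \<subseteq> (\<Union>t\<in>I. ball t (d t))"
    using compactE_image[OF compact_Icc open_ball cover] by metis
  have M0: "0 \<le> M t" if "t \<in> I" for t
  proof -
    have "t \<in> {0..T}" using I(1) that by auto
    then have "C1b \<alpha> (M t) (\<sigma> t)" using dM(1)[of t] by (intro dM(2)) auto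
    then show ?thesis by (rule C1b_nonneg)
  qed
  show thesis
  proof (rule that[of "\<Sum>t\<in>I. M t"])
    fix s assume s: "s \<in> {0..T}"
    then obtain t where t: "t \<in> I" "s \<in> ball t (d t)" using I by auto
    then have "C1b \<alpha> (M t) (\<sigma> s)" using dM(2)[of t s] I s by auto
    moreover have "M t \<le> (\<Sum>t\<in>I. M t)" using t I M0 by (intro member_le_sum) auto
    ultimately show "C1b \<alpha> (\<Sum>t\<in>I. M t) (\<sigma> s)" by (rule C1b_mono)
  qed
qed

context admissible_kernel
begin

text \<open>Where the gradients agree, the term that cost a power gamma in \<open>rate_diff\<close>
  disappears; what remains is linear in delta and can be beaten by an exponential weight in
  time.\<close>

lemma rate_diff_critical:
  assumes f: "C1b \<alpha> M f" "supported R f" and g: "C1b \<alpha> M g" "supported R g"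
    and \<delta>: "\<And>x. \<bar>f x - g x\<bar> \<le> \<delta>" and crit: "gradient f x = gradient g x"
  shows "\<bar>rate f x - rate g x\<bar> \<le> 3 * M * E * \<delta>"
proof -
  note fm = C1b_measurable[OF f(1)] C1bD(2)[OF f(1)] f(2) and gm = C1b_measurable[OF g(1)] C1bD(2)[OF g(1)] g(2)
  have M: "0 \<le> M" "0 \<le> E" using C1b_nonneg[OF f(1)] E by auto
  have dm: "(\<lambda>x. f x - g x) \<in> borel_measurable borel" using fm(1) gm(1) by measurable
  have u: "norm (conv f k x - conv g k x) \<le> \<delta> * E"
    unfolding conv_k_diff(1)[OF fm gm] by (rule velocity_bound[OF dm \<delta> supported_diff[OF f(2) g(2)]])
  have d: "\<bar>divu f x - divu g x\<bar> \<le> \<delta> * E"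
    unfolding conv_k_diff(2)[OF fm gm] by (rule divu_bound[OF dm \<delta> supported_diff[OF f(2) g(2)]])
  have \<delta>0: "0 \<le> \<delta>" using \<delta>[of x] by linarith
  have "\<bar>gradient g x \<bullet> (conv f k x - conv g k x)\<bar> \<le> M * (\<delta> * E)"
    by (rule order_trans[OF Cauchy_Schwarz_ineq2 mult_mono[OF C1bD(3)[OF g(1)] u]]) (use M in auto)
  moreover have "\<bar>(f x - g x) * divu f x\<bar> \<le> \<delta> * (M * E)"
    unfolding abs_mult by (rule mult_mono[OF \<delta> divu_bound[OF fm]]) (use \<delta>0 in auto)
  moreover have "\<bar>g x * (divu f x - divu g x)\<bar> \<le> M * (\<delta> * E)"
    unfolding abs_mult by (rule mult_mono[OF C1bD(2)[OF g(1)] d]) (use M in auto)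
  moreover have "rate f x - rate g x = - (gradient g x \<bullet> (conv f k x - conv g k x))
      - (f x - g x) * divu f x - g x * (divu f x - divu g x)"
    by (simp add: rate_def crit algebra_simps inner_diff_right)
  ultimately have "\<bar>rate f x - rate g x\<bar> \<le> M * (\<delta> * E) + \<delta> * (M * E) + M * (\<delta> * E)" by linarith
  then show ?thesis by (simp add: algebra_simps)
qed

lemma classical_rate:
  assumes sol: "classical_solution \<beta> \<kappa> f0 Ts \<sigma>"
    and k\<kappa>: "\<And>x. x \<noteq> 0 \<Longrightarrow> k x = - gradient (kernel \<kappa>) x"
    and t: "t \<in> {0..<Ts}" and \<sigma>: "C1b \<alpha> M (\<sigma> t)" "0 < \<alpha>" "supported R (\<sigma> t)"
  shows "((\<lambda>s. \<sigma> s x) has_real_derivative rate (\<sigma> t) x) (at t within {0..<Ts})"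
proof -
  have v: "velocity \<kappa> (\<sigma> t) = conv (\<sigma> t) k"
    using velocity_eq_conv[OF k(1) k\<kappa> C1b_measurable[OF \<sigma>(1)]] by auto
  obtain D where D: "((\<lambda>s. \<sigma> s x) has_real_derivative D) (at t within {0..<Ts})"
    "D + divergence (\<lambda>y. \<sigma> t y *\<^sub>R velocity \<kappa> (\<sigma> t) y) x = 0"
    using sol t unfolding classical_solution_def by blast
  have "D = rate (\<sigma> t) x" using D(2) unfolding v flux_divergence[OF \<sigma>] by simp
  then show ?thesis using D(1) by simp
qed

text \<open>At a positive maximum of \<open>exp (- 2 \<Lambda> t) (\<sigma>\<^sub>1 - \<sigma>\<^sub>2)\<^sup>2\<close> the gradients agree, so there the
  difference of the two equations is controlled by the maximum itself; for large \<open>\<Lambda>\<close> the time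
  derivative is then negative.\<close>

lemma unique_until:
  fixes \<sigma>1 \<sigma>2 :: "real \<Rightarrow> 'a \<Rightarrow> real"
  assumes T: "T < Ts" and \<alpha>: "0 < \<alpha>"
    and C: "\<And>t. t \<in> {0..T} \<Longrightarrow> C1b \<alpha> M (\<sigma>1 t)" "\<And>t. t \<in> {0..T} \<Longrightarrow> C1b \<alpha> M (\<sigma>2 t)"
    and S: "\<And>t. t \<in> {0..T} \<Longrightarrow> supported R (\<sigma>1 t)" "\<And>t. t \<in> {0..T} \<Longrightarrow> supported R (\<sigma>2 t)"
    and D: "\<And>t x. t \<in> {0..T} \<Longrightarrow> ((\<lambda>s. \<sigma>1 s x) has_real_derivative rate (\<sigma>1 t) x) (at t within {0..<Ts})"
      "\<And>t x. t \<in> {0..T} \<Longrightarrow> ((\<lambda>s. \<sigma>2 s x) has_real_derivative rate (\<sigma>2 t) x) (at t within {0..<Ts})"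
    and init: "\<sigma>1 0 = \<sigma>2 0" and t1: "t1 \<in> {0..T}"
  shows "\<sigma>1 t1 x1 = \<sigma>2 t1 x1"
proof (rule ccontr)
  assume neq: "\<sigma>1 t1 x1 \<noteq> \<sigma>2 t1 x1"
  let ?S = "{0..T} \<times> cball (0::'a) R"
  define w where "w t x = \<sigma>1 t x - \<sigma>2 t x" for t x
  have M: "0 \<le> M" "0 \<le> E" using C1b_nonneg[OF C(1)[OF t1]] E by auto
  define \<Lambda> where "\<Lambda> = 3 * M * E + 1"
  define W where "W p = exp (- 2 * \<Lambda> * fst p) * (w (fst p) (snd p))\<^sup>2" for p
  have out: "w t x = 0" if "t \<in> {0..T}" "R < norm x" for t x
    using supportedD[OF S(1)[OF that(1)] that(2)] supportedD[OF S(2)[OF that(1)] that(2)] by (simp add: w_def)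
  have x1: "norm x1 \<le> R" using out[OF t1, of x1] neq by (auto simp: w_def not_le[symmetric])
  \<comment> \<open>Joint continuity follows from a Lipschitz constant in space that is uniform in
    time, and continuity in time at each fixed point.\<close>
  have joint: "continuous_on ?S (\<lambda>p. \<sigma> (fst p) (snd p))"
    if C: "\<And>t. t \<in> {0..T} \<Longrightarrow> C1b \<alpha> M (\<sigma> t)"
      and D: "\<And>t x. t \<in> {0..T} \<Longrightarrow> ((\<lambda>s. \<sigma> s x) has_real_derivative rate (\<sigma> t) x) (at t within {0..<Ts})"
    for \<sigma> :: "real \<Rightarrow> 'a \<Rightarrow> real"
    unfolding continuous_on_def
  proof
    fix p assume p: "p \<in> ?S"
    let ?x = "snd p"
    have "((\<lambda>s. \<sigma> s ?x) has_real_derivative rate (\<sigma> t) ?x) (at t within {0..T})" if "t \<in> {0..T}" for t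
      by (rule has_field_derivative_subset[OF D[OF that]]) (use T in auto)
    then have "continuous_on {0..T} (\<lambda>s. \<sigma> s ?x)"
      by (meson DERIV_continuous_on)
    then have "continuous_on ?S (\<lambda>q. \<sigma> (fst q) ?x)"
      by (rule continuous_on_compose2) (auto intro: continuous_intros)
    then have 1: "((\<lambda>q. \<sigma> (fst q) ?x - \<sigma> (fst p) ?x) \<longlongrightarrow> 0) (at p within ?S)"
      using p LIM_zero unfolding continuous_on_def by blast
    have 2: "((\<lambda>q. M * norm (snd q - ?x)) \<longlongrightarrow> 0) (at p within ?S)"
      by (auto intro!: tendsto_eq_intros)
    have "((\<lambda>q. M * norm (snd q - ?x) + \<bar>\<sigma> (fst q) ?x - \<sigma> (fst p) ?x\<bar>) \<longlongrightarrow> 0) (at p within ?S)"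
      using tendsto_add[OF 2 tendsto_rabs[OF 1]] by simp
    then have "((\<lambda>q. \<sigma> (fst q) (snd q) - \<sigma> (fst p) (snd p)) \<longlongrightarrow> 0) (at p within ?S)"
    proof (rule Lim_null_comparison[rotated])
      have "norm (\<sigma> (fst q) (snd q) - \<sigma> (fst p) (snd p)) \<le> M * norm (snd q - ?x) + \<bar>\<sigma> (fst q) ?x - \<sigma> (fst p) ?x\<bar>"
        if "q \<in> ?S" for q
      proof -
        have "fst q \<in> {0..T}" using that by auto
        from C1b_lipschitz[OF C[OF this], of "snd q" ?x] show ?thesis unfolding real_norm_def by linarith
      qed
      then show "\<forall>\<^sub>F q in at p within ?S. norm (\<sigma> (fst q) (snd q) - \<sigma> (fst p) (snd p))
          \<le> M * norm (snd q - ?x) + \<bar>\<sigma> (fst q) ?x - \<sigma> (fst p) ?x\<bar>"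
        unfolding eventually_at_filter by (intro always_eventually) blast
    qed
    then show "((\<lambda>p. \<sigma> (fst p) (snd p)) \<longlongrightarrow> \<sigma> (fst p) (snd p)) (at p within ?S)"
      by (rule LIM_zero_cancel)
  qed
  have "continuous_on ?S W"
    unfolding W_def[abs_def] w_def
    by (intro continuous_on_mult continuous_on_exp continuous_on_power continuous_on_diff
        joint[OF C(1) D(1)] joint[OF C(2) D(2)] continuous_on_const continuous_on_fst continuous_on_id) auto
  moreover have "compact ?S" by (intro compact_Times compact_Icc compact_cball)
  moreover have p1: "(t1, x1) \<in> ?S" using t1 x1 by auto
  ultimately obtain p where p: "p \<in> ?S" "\<And>q. q \<in> ?S \<Longrightarrow> W q \<le> W p"
    using continuous_attains_sup[of ?S W] by blast
  obtain t0 x0 where p0: "p = (t0, x0)" by (cases p)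
  have t0: "t0 \<in> {0..T}" using p p0 by auto
  have "0 < W (t1, x1)" using neq by (simp add: W_def w_def)
  then have "0 < W p" using p(2)[OF p1] by simp
  then have w0: "w t0 x0 \<noteq> 0" by (auto simp: W_def p0)
  then have "t0 \<noteq> 0" using init by (auto simp: w_def)
  then have t0pos: "0 < t0" using t0 by auto
  \<comment> \<open>The maximum over the ball is one over the whole space, since \<open>w\<close>
    vanishes outside; squaring treats both signs of \<open>w\<close> at once.\<close>
  have wmax: "\<bar>w t0 x\<bar> \<le> \<bar>w t0 x0\<bar>" for x
  proof (cases "norm x \<le> R")
    case True
    then have "W (t0, x) \<le> W (t0, x0)" using p(2)[of "(t0, x)"] t0 p0 by auto
    then have "(w t0 x)\<^sup>2 \<le> (w t0 x0)\<^sup>2" by (simp add: W_def)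
    then show ?thesis by (simp add: abs_le_square_iff)
  qed (use out[OF t0, of x] in simp)
  have crit: "gradient (\<sigma>1 t0) x0 = gradient (\<sigma>2 t0) x0"
  proof -
    let ?g = "gradient (\<sigma>1 t0) x0 - gradient (\<sigma>2 t0) x0"
    have dw: "(w t0 has_derivative (\<lambda>v. ?g \<bullet> v)) (at x0)"
      using has_derivative_diff[OF C1bD(5)[OF C(1)[OF t0]] C1bD(5)[OF C(2)[OF t0]]]
      by (simp add: w_def[abs_def] inner_diff_left)
    have "(\<lambda>v. w t0 x0 * (?g \<bullet> v) + (?g \<bullet> v) * w t0 x0) = (\<lambda>v. 0)"
    proof (rule differential_zero_maxmin[OF UNIV_I open_UNIV has_derivative_mult[OF dw dw]])
      have "w t0 x * w t0 x \<le> w t0 x0 * w t0 x0" for x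
        using wmax[of x] abs_le_square_iff[of "w t0 x" "w t0 x0"] by (simp add: power2_eq_square)
      then show "(\<forall>y\<in>UNIV. w t0 y * w t0 y \<le> w t0 x0 * w t0 x0) \<or> (\<forall>y\<in>UNIV. w t0 x0 * w t0 x0 \<le> w t0 y * w t0 y)"
        by blast
    qed
    from fun_cong[OF this, of ?g] have "?g \<bullet> ?g = 0" using w0 by simp
    then show ?thesis by simp
  qed
  define d' where "d' = rate (\<sigma>1 t0) x0 - rate (\<sigma>2 t0) x0"
  have d': "\<bar>d'\<bar> \<le> 3 * M * E * \<bar>w t0 x0\<bar>"
    unfolding d'_def by (rule rate_diff_critical[OF C(1)[OF t0] S(1)[OF t0] C(2)[OF t0] S(2)[OF t0] _ crit])
      (use wmax in \<open>simp add: w_def\<close>)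
  \<comment> \<open>As 0 < t0 \<le> T < Ts, the time \<open>t0\<close> is interior to the interval
    of existence even if it equals \<open>T\<close>, so the derivative is two-sided. The
    contradiction then comes from comparing with earlier times.\<close>
  have wder: "((\<lambda>s. w s x0) has_real_derivative d') (at t0)"
  proof -
    have "((\<lambda>s. w s x0) has_real_derivative d') (at t0 within {0..<Ts})"
      unfolding w_def d'_def by (intro DERIV_diff D t0)
    then have "((\<lambda>s. w s x0) has_real_derivative d') (at t0 within {0<..<Ts})"
      by (rule has_field_derivative_subset) auto
    moreover have "at t0 within {0<..<Ts} = at t0"
      by (rule at_within_open) (use t0 t0pos T in auto)
    ultimately show ?thesis by simp
  qed
  let ?\<phi> = "\<lambda>s. exp (- 2 * \<Lambda> * s) * (w s x0)\<^sup>2"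
  let ?D = "exp (- 2 * \<Lambda> * t0) * (2 * (w t0 x0 * d') - 2 * \<Lambda> * (w t0 x0)\<^sup>2)"
  have der: "(?\<phi> has_real_derivative ?D) (at t0)"
    by (auto intro!: derivative_eq_intros wder simp: algebra_simps power2_eq_square)
  have "?D < 0"
  proof -
    have "w t0 x0 * d' \<le> \<bar>w t0 x0\<bar> * \<bar>d'\<bar>" by (metis abs_ge_self abs_mult)
    also have "\<dots> \<le> \<bar>w t0 x0\<bar> * (3 * M * E * \<bar>w t0 x0\<bar>)" using d' by (intro mult_left_mono) auto
    also have "\<dots> = 3 * M * E * (w t0 x0)\<^sup>2" by (simp add: power2_eq_square mult_ac)
    also have "\<dots> < \<Lambda> * (w t0 x0)\<^sup>2" using w0 by (intro mult_strict_right_mono) (auto simp: \<Lambda>_def)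
    finally show ?thesis by (intro mult_pos_neg) auto
  qed
  then obtain d where d: "0 < d" "\<And>h. 0 < h \<Longrightarrow> h < d \<Longrightarrow> ?\<phi> t0 < ?\<phi> (t0 - h)"
    using DERIV_neg_dec_left[OF der] by blast
  define h where "h = min (d / 2) t0"
  have h: "0 < h" "h < d" "h \<le> t0" using d(1) t0pos by (auto simp: h_def)
  have "(t0 - h, x0) \<in> ?S" using h t0 p(1) p0 by auto
  from p(2)[OF this] have "?\<phi> (t0 - h) \<le> ?\<phi> t0" by (simp add: W_def p0)
  then show False using d(2)[OF h(1,2)] by simp
qed

end

lemma solutions_unique:
  fixes k :: "'a::euclidean_space \<Rightarrow> 'a" and \<sigma>1 \<sigma>2 :: "real \<Rightarrow> 'a \<Rightarrow> real"
  assumes dim: "2 \<le> DIM('a)" and \<beta>: "0 < \<beta>" "\<beta> < 1" and C: "0 \<le> C" and adm: "admissible C \<beta> k m c"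
    and k\<kappa>: "\<And>x. x \<noteq> 0 \<Longrightarrow> k x = - gradient (kernel \<kappa>) x"
    and sol: "\<sigma>1 \<in> solution_class \<beta> \<kappa> f0 Ts" "\<sigma>2 \<in> solution_class \<beta> \<kappa> f0 Ts" and t: "t \<in> {0..<Ts}"
  shows "\<sigma>1 t = \<sigma>2 t"
proof (cases "t = 0")
  case True
  then show ?thesis using sol by (simp add: solution_class_def classical_solution_def)
next
  case False
  then have T: "0 < t" "t < Ts" using t by auto
  \<comment> \<open>Any exponent strictly below beta: continuity in time is required of a solution
    in those norms only.\<close>
  define \<alpha> where "\<alpha> = \<beta> / 2"
  have \<alpha>: "0 < \<alpha>" "\<alpha> < \<beta>" using \<beta> by (auto simp: \<alpha>_def)
  have cl: "classical_solution \<beta> \<kappa> f0 Ts \<sigma>1" "classical_solution \<beta> \<kappa> f0 Ts \<sigma>2"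
    using sol by (auto simp: solution_class_def)
  then have cont: "cont_C1 \<alpha> Ts \<sigma>1" "cont_C1 \<alpha> Ts \<sigma>2"
    using \<alpha> unfolding classical_solution_def by blast+
  obtain M1 M2 where M: "\<And>s. s \<in> {0..t} \<Longrightarrow> C1b \<alpha> M1 (\<sigma>1 s)" "\<And>s. s \<in> {0..t} \<Longrightarrow> C1b \<alpha> M2 (\<sigma>2 s)"
    using cont_C1_uniform_bound[OF cont(1) T(2)] cont_C1_uniform_bound[OF cont(2) T(2)] by metis
  define M where "M = max M1 M2"
  have C1: "C1b \<alpha> M (\<sigma>1 s)" "C1b \<alpha> M (\<sigma>2 s)" if "s \<in> {0..t}" for s
    using C1b_mono[OF M(1)[OF that]] C1b_mono[OF M(2)[OF that]] by (simp_all add: M_def)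
  have cs: "\<exists>K. compact K \<and> (\<forall>s\<in>{0..t}. supp (\<sigma> s) \<subseteq> K)" if "\<sigma> \<in> solution_class \<beta> \<kappa> f0 Ts" for \<sigma>
    using that T by (simp add: solution_class_def)
  obtain K1 K2 where K: "compact K1" "\<And>s. s \<in> {0..t} \<Longrightarrow> supp (\<sigma>1 s) \<subseteq> K1"
    "compact K2" "\<And>s. s \<in> {0..t} \<Longrightarrow> supp (\<sigma>2 s) \<subseteq> K2"
    using cs[OF sol(1)] cs[OF sol(2)] by metis
  obtain R where R: "\<forall>x\<in>K1 \<union> K2. norm x \<le> R"
    using compact_imp_bounded[OF compact_Un[OF K(1,3)]] unfolding bounded_iff by blast
  \<comment> \<open>The radius comes from the two given solutions and may exceed the one used for
    existence, so \<open>field_const\<close> is formed anew for it.\<close>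
  interpret admissible_kernel C \<beta> R 1 "field_const TYPE('a) C \<beta> R" k m c
    by unfold_locales (use dim \<beta> C adm in auto)
  have S: "supported R (\<sigma>1 s)" "supported R (\<sigma>2 s)" if "s \<in> {0..t}" for s
  proof -
    have "supp (\<sigma>1 s) \<subseteq> cball 0 R" "supp (\<sigma>2 s) \<subseteq> cball 0 R"
      using K(2,4)[OF that] R by auto
    then show "supported R (\<sigma>1 s)" "supported R (\<sigma>2 s)"
      unfolding supported_def using zero_outside_supp by blast+
  qed
  have "\<sigma>1 t x = \<sigma>2 t x" for x
  proof (rule unique_until[OF T(2) \<alpha>(1) C1 S])
    fix s x assume s: "s \<in> {0..t}"
    then have s': "s \<in> {0..<Ts}" using T by auto
    show "((\<lambda>s. \<sigma>1 s x) has_real_derivative rate (\<sigma>1 s) x) (at s within {0..<Ts})"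
      by (rule classical_rate[OF cl(1) k\<kappa> s' C1(1)[OF s] \<alpha>(1) S(1)[OF s]])
    show "((\<lambda>s. \<sigma>2 s x) has_real_derivative rate (\<sigma>2 s) x) (at s within {0..<Ts})"
      by (rule classical_rate[OF cl(2) k\<kappa> s' C1(2)[OF s] \<alpha>(1) S(2)[OF s]])
  qed (use cl T in \<open>auto simp: classical_solution_def\<close>)
  then show ?thesis by auto
qed

subsection \<open>Well-posedness\<close>

theorem proposition5p5:
  fixes \<rho>0 :: "real ^ 'n \<Rightarrow> real" and \<beta> \<kappa>s :: real
  assumes "CARD('n) \<ge> 2" and "0 < \<beta>" and "\<beta> < 1" and "0 < \<kappa>s"
    and "\<rho>0 \<in> C1c_space \<beta>"
    and "\<forall>x. \<rho>0 x \<ge> 0" and "(LINT x|lborel. \<rho>0 x) = 1"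
  shows "\<exists>Ts>0. \<exists>\<rho> :: real \<Rightarrow> real \<Rightarrow> real ^ 'n \<Rightarrow> real.
    (\<forall>\<kappa>\<in>{0..\<kappa>s}.
       \<rho> \<kappa> \<in> solution_class \<beta> \<kappa> \<rho>0 Ts \<and>
       (\<forall>\<sigma>\<in>solution_class \<beta> \<kappa> \<rho>0 Ts. \<forall>t\<in>{0..<Ts}. \<sigma> t = \<rho> \<kappa> t)) \<and>
    (\<forall>T. 0 < T \<and> T < Ts \<longrightarrow>
       (\<exists>R. \<forall>\<kappa>\<in>{0..\<kappa>s}. \<forall>t\<in>{0..T}. supp (\<rho> \<kappa> t) \<subseteq> ball 0 R) \<and>
       (SUP \<kappa>\<in>{0..\<kappa>s}. SUP t\<in>{0..T}.
          Linf_norm (\<rho> \<kappa> t) + holder_seminorm \<beta> (\<rho> \<kappa> t)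
          + (\<integral>\<^sup>+x. ennreal ((norm x)\<^sup>2 * \<rho> \<kappa> t x) \<partial>lborel)
          + W1inf_norm (velocity \<kappa> (\<rho> \<kappa> t))) < \<infinity>) \<and>
    (\<forall>\<kappa>\<in>{0<..\<kappa>s}. \<forall>T. 0 \<le> T \<and> T < Ts \<longrightarrow>
       cont_W2 T (\<lambda>t. density lborel (\<lambda>x. ennreal (\<rho> \<kappa> t x))) \<and>
       1 + (SUP t\<in>{0..T}. Linf_norm (\<rho> \<kappa> t) + W1inf_norm (velocity \<kappa> (\<rho> \<kappa> t))) < \<infinity>)"
proof -
  have dim: "2 \<le> DIM(real ^ 'n)" using assms(1) by simp
  note \<beta> = assms(2,3)
  have \<rho>0: "\<rho>0 \<in> C1_space \<beta>" "compact (supp \<rho>0)" using assms(5) by (auto simp: C1c_space_def)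
  obtain M0 where M0: "C1b \<beta> M0 \<rho>0" by (rule C1_space_C1b[OF \<rho>0(1)])
  obtain R0 where R0: "\<forall>x\<in>supp \<rho>0. norm x \<le> R0"
    using compact_imp_bounded[OF \<rho>0(2)] unfolding bounded_iff by blast
  then have "supp \<rho>0 \<subseteq> cball 0 R0" by auto
  note out0 = zero_outside_supp[OF this]
  obtain C where C: "0 \<le> C" "\<And>\<kappa>. 0 \<le> \<kappa> \<Longrightarrow> \<kappa> \<le> \<kappa>s \<Longrightarrow>
      \<exists>(k :: real ^ 'n \<Rightarrow> real ^ 'n) m c. admissible C \<beta> k m c \<and> (\<forall>x. x \<noteq> 0 \<longrightarrow> k x = - gradient (kernel \<kappa>) x)"
    using kernels_admissible[OF dim assms(4) \<beta>] by blast
  \<comment> \<open>All constants are fixed before kappa: \<open>C\<close> is uniform on the closed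
    range, \<open>M0\<close> and \<open>R0\<close> belong to the initial density. Hence
    \<open>Ts\<close> is independent of kappa.\<close>
  define N where "N = M0 + 1"
  define R where "R = R0 + 1"
  define E where "E = field_const TYPE(real ^ 'n) C \<beta> R"
  define L where "L = N * E"
  define K where "K = 6 * N * L + (N + 6 * N * L) * (3 * L + L\<^sup>2)"
  \<comment> \<open>The denominator is positive and dominates both \<open>K\<close> and
    \<open>L\<close>, which gives the two smallness conditions at once.\<close>
  define Ts where "Ts = 1 / (\<bar>K\<bar> + \<bar>L\<bar> + 1)"
  define B where "B = ennreal N + ennreal (2 * N) + ennreal (R\<^sup>2) + ennreal ((1 + real DIM(real ^ 'n)) * L)"
  have N1: "1 \<le> N" using C1b_nonneg[OF M0] by (simp add: N_def)
  have Ts0: "0 < Ts" by (simp add: Ts_def)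
  have TsK: "Ts * K \<le> 1" "Ts * L \<le> 1" by (auto simp: Ts_def divide_le_eq)
  \<comment> \<open>Everything asserted for a single kappa, so that one choice yields the whole
    family. The support and norm bounds hold up to the closed end \<open>Ts\<close>; one radius and
    one \<open>B\<close> therefore cover every T < Ts.\<close>
  define good where "good \<kappa> r \<longleftrightarrow> r \<in> solution_class \<beta> \<kappa> \<rho>0 Ts \<and>
      (\<forall>\<sigma>\<in>solution_class \<beta> \<kappa> \<rho>0 Ts. \<forall>t\<in>{0..<Ts}. \<sigma> t = r t) \<and>
      (\<forall>t\<in>{0..Ts}. supp (r t) \<subseteq> ball 0 (R + 1) \<and>
        Linf_norm (r t) + holder_seminorm \<beta> (r t) + (\<integral>\<^sup>+x. ennreal ((norm x)\<^sup>2 * r t x) \<partial>lborel)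
          + W1inf_norm (velocity \<kappa> (r t)) \<le> B) \<and>
      (\<forall>T<Ts. cont_W2 T (\<lambda>t. density lborel (\<lambda>x. ennreal (r t x))))"
    for \<kappa> and r :: "real \<Rightarrow> real ^ 'n \<Rightarrow> real"
  have "\<exists>r. good \<kappa> r" if \<kappa>: "\<kappa> \<in> {0..\<kappa>s}" for \<kappa>
  proof -
    obtain k :: "real ^ 'n \<Rightarrow> real ^ 'n" and m c where adm: "admissible C \<beta> k m c"
      and k\<kappa>: "\<And>x. x \<noteq> 0 \<Longrightarrow> k x = - gradient (kernel \<kappa>) x"
      using C(2)[of \<kappa>] \<kappa> by auto
    interpret A: admissible_kernel C \<beta> R N E k m c
      by unfold_locales (use dim \<beta> C(1) N1 adm in \<open>auto simp: E_def\<close>)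
    interpret S: euler_scheme C \<beta> R N E k m c \<rho>0 M0 R0 Ts
      by unfold_locales
        (use M0 out0 assms(6) Ts0 TsK in \<open>auto simp: A.supported_def N_def[symmetric] R_def L_def[symmetric] K_def[symmetric]\<close>)
    obtain \<rho> where \<rho>: "\<rho> 0 = \<rho>0" "\<And>t. 0 \<le> t \<Longrightarrow> t \<le> Ts \<Longrightarrow> C1b \<beta> N (\<rho> t)"
      "\<And>t. 0 \<le> t \<Longrightarrow> t \<le> Ts \<Longrightarrow> A.supported R (\<rho> t)" "\<And>t x. 0 \<le> t \<Longrightarrow> t \<le> Ts \<Longrightarrow> 0 \<le> \<rho> t x"
      "\<And>s t x. 0 \<le> s \<Longrightarrow> s \<le> t \<Longrightarrow> t \<le> Ts \<Longrightarrow> \<bar>\<rho> t x - \<rho> s x\<bar> \<le> A.L1 * (t - s)"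
      "\<And>s t x. 0 \<le> s \<Longrightarrow> s \<le> t \<Longrightarrow> t \<le> Ts \<Longrightarrow>
        \<bar>\<rho> t x - \<rho> s x - (t - s) * A.rate (\<rho> s) x\<bar> \<le> (t - s) * S.modulus (t - s)"
      using S.euler_limit by blast
    interpret Q: limit_solution C \<beta> R N E k m c \<rho>0 M0 R0 Ts \<rho> \<kappa>
      by unfold_locales (use \<rho> k\<kappa> assms(7) in auto)
    have "good \<kappa> \<rho>"
      unfolding good_def
    proof (intro conjI ballI allI impI)
      show cls: "\<rho> \<in> solution_class \<beta> \<kappa> \<rho>0 Ts" by (rule Q.in_solution_class)
      show "\<sigma> t = \<rho> t" if "\<sigma> \<in> solution_class \<beta> \<kappa> \<rho>0 Ts" "t \<in> {0..<Ts}" for \<sigma> t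
        by (rule solutions_unique[OF dim \<beta> C(1) adm k\<kappa> that(1) cls that(2)])
      fix t assume t: "t \<in> {0..Ts}"
      have "supp (\<rho> t) \<subseteq> cball 0 R"
        by (rule supp_subset_cball) (use A.supportedD[OF \<rho>(3)] t in auto)
      then show "supp (\<rho> t) \<subseteq> ball 0 (R + 1)" by auto
      show "Linf_norm (\<rho> t) + holder_seminorm \<beta> (\<rho> t) + (\<integral>\<^sup>+x. ennreal ((norm x)\<^sup>2 * \<rho> t x) \<partial>lborel)
          + W1inf_norm (velocity \<kappa> (\<rho> t)) \<le> B"
        unfolding B_def L_def by (rule Q.total_bound[OF t])
    next
      show "cont_W2 T (\<lambda>t. density lborel (\<lambda>x. ennreal (\<rho> t x)))" if "T < Ts" for T
        by (rule Q.solution_cont_W2[OF that])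
    qed
    then show ?thesis by blast
  qed
  then obtain \<rho> where "\<And>\<kappa>. \<kappa> \<in> {0..\<kappa>s} \<Longrightarrow> good \<kappa> (\<rho> \<kappa>)"
    by metis
  then have g: "\<rho> \<kappa> \<in> solution_class \<beta> \<kappa> \<rho>0 Ts"
      "\<forall>\<sigma>\<in>solution_class \<beta> \<kappa> \<rho>0 Ts. \<forall>t\<in>{0..<Ts}. \<sigma> t = \<rho> \<kappa> t"
      "\<And>t. t \<in> {0..Ts} \<Longrightarrow> supp (\<rho> \<kappa> t) \<subseteq> ball 0 (R + 1)"
      "\<And>t. t \<in> {0..Ts} \<Longrightarrow> Linf_norm (\<rho> \<kappa> t) + holder_seminorm \<beta> (\<rho> \<kappa> t)
        + (\<integral>\<^sup>+x. ennreal ((norm x)\<^sup>2 * \<rho> \<kappa> t x) \<partial>lborel) + W1inf_norm (velocity \<kappa> (\<rho> \<kappa> t)) \<le> B"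
      "\<And>T. T < Ts \<Longrightarrow> cont_W2 T (\<lambda>t. density lborel (\<lambda>x. ennreal (\<rho> \<kappa> t x)))"
    if "\<kappa> \<in> {0..\<kappa>s}" for \<kappa>
    using that unfolding good_def by blast+
  have Bfin: "B < \<infinity>" by (simp add: B_def)
  show ?thesis
  proof (rule exI, rule conjI[OF Ts0], rule exI[of _ \<rho>], intro conjI ballI allI impI)
    fix T assume T: "0 < T \<and> T < Ts"
    show "\<exists>R. \<forall>\<kappa>\<in>{0..\<kappa>s}. \<forall>t\<in>{0..T}. supp (\<rho> \<kappa> t) \<subseteq> ball 0 R"
      by (intro exI[of _ "R + 1"] ballI g(3)) (use T in auto)
    have "(SUP \<kappa>\<in>{0..\<kappa>s}. SUP t\<in>{0..T}. Linf_norm (\<rho> \<kappa> t) + holder_seminorm \<beta> (\<rho> \<kappa> t)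
          + (\<integral>\<^sup>+x. ennreal ((norm x)\<^sup>2 * \<rho> \<kappa> t x) \<partial>lborel) + W1inf_norm (velocity \<kappa> (\<rho> \<kappa> t))) \<le> B"
      by (intro SUP_least g(4)) (use T in auto)
    then show "(SUP \<kappa>\<in>{0..\<kappa>s}. SUP t\<in>{0..T}. Linf_norm (\<rho> \<kappa> t) + holder_seminorm \<beta> (\<rho> \<kappa> t)
          + (\<integral>\<^sup>+x. ennreal ((norm x)\<^sup>2 * \<rho> \<kappa> t x) \<partial>lborel) + W1inf_norm (velocity \<kappa> (\<rho> \<kappa> t))) < \<infinity>"
      using Bfin by (rule le_less_trans)
  next
    fix \<kappa> T assume \<kappa>: "\<kappa> \<in> {0<..\<kappa>s}" and T: "0 \<le> T \<and> T < Ts"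
    then have \<kappa>': "\<kappa> \<in> {0..\<kappa>s}" by auto
    show "cont_W2 T (\<lambda>t. density lborel (\<lambda>x. ennreal (\<rho> \<kappa> t x)))" using g(5)[OF \<kappa>'] T by blast
    have "(SUP t\<in>{0..T}. Linf_norm (\<rho> \<kappa> t) + W1inf_norm (velocity \<kappa> (\<rho> \<kappa> t))) \<le> B"
    proof (rule SUP_least)
      fix t assume "t \<in> {0..T}"
      then have t: "t \<in> {0..Ts}" using T by auto
      have "Linf_norm (\<rho> \<kappa> t) + W1inf_norm (velocity \<kappa> (\<rho> \<kappa> t))
        \<le> Linf_norm (\<rho> \<kappa> t) + holder_seminorm \<beta> (\<rho> \<kappa> t)
          + (\<integral>\<^sup>+x. ennreal ((norm x)\<^sup>2 * \<rho> \<kappa> t x) \<partial>lborel) + W1inf_norm (velocity \<kappa> (\<rho> \<kappa> t))"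
        by (intro add_right_mono) (simp add: add.assoc)
      then show "Linf_norm (\<rho> \<kappa> t) + W1inf_norm (velocity \<kappa> (\<rho> \<kappa> t)) \<le> B"
        using g(4)[OF \<kappa>' t] by (rule order_trans)
    qed
    then have "1 + (SUP t\<in>{0..T}. Linf_norm (\<rho> \<kappa> t) + W1inf_norm (velocity \<kappa> (\<rho> \<kappa> t))) \<le> 1 + B"
      by (rule add_left_mono)
    also have "\<dots> < \<infinity>" using Bfin by simp
    finally show "1 + (SUP t\<in>{0..T}. Linf_norm (\<rho> \<kappa> t) + W1inf_norm (velocity \<kappa> (\<rho> \<kappa> t))) < \<infinity>" .
  next
    fix \<kappa> assume \<kappa>: "\<kappa> \<in> {0..\<kappa>s}"
    show "\<rho> \<kappa> \<in> solution_class \<beta> \<kappa> \<rho>0 Ts" by (rule g(1)[OF \<kappa>])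
    fix \<sigma> t assume "\<sigma> \<in> solution_class \<beta> \<kappa> \<rho>0 Ts" "t \<in> {0..<Ts}"
    then show "\<sigma> t = \<rho> \<kappa> t" using g(2)[OF \<kappa>] by blast
  qed
qed

end
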